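(* Let $K$ be a field of characteristic zero, let $A_1=K\langle X,Y\mid [Y,X]=1\rangle$ be the first Weyl algebra over $K$, let $x,y\in A_1$ be elements with $[y,x]=1$, and let $A_1':=K\langle x,y\rangle$ be the $K$-subalgebra of $A_1$ generated by $x$ and $y$. Then $\mathrm{Frac}(A_1')\cap A_1=A_1'$, where the intersection is taken in $\mathrm{Frac}(A_1)$.
   Context: For elements $a,b$ of an algebra, $[a,b]:=ab-ba$. The algebra $A_1'$ is itself isomorphic to the first Weyl algebra. $\mathrm{Frac}(A_1)$ and $\mathrm{Frac}(A_1')$ denote the total skew fields of fractions of the (Ore) domains $A_1$ and $A_1'$; since $A_1'\subseteq A_1$, one has $\mathrm{Frac}(A_1')\subseteq \mathrm{Frac}(A_1)$. *)

theory Defs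
  imports
    "HOL-Library.Poly_Mapping"
    "HOL-Computational_Algebra.Polynomial"
begin

datatype gen = GX | GY

text \<open>
  The free monoid on two letters, written additively because the convolution product of
  \<^typ>\<open>'a \<Rightarrow>\<^sub>0 'b\<close> is indexed by an additive (not necessarily commutative) monoid.
  Its unit \<open>0\<close> is the empty word, so the scalar \<open>c\<close> is \<open>Poly_Mapping.single 0 c\<close>.
\<close>

datatype word = Word (letters: "gen list")

instantiation word :: monoid_add
begin

definition zero_word :: word where "0 = Word []"

definition plus_word :: "word \<Rightarrow> word \<Rightarrow> word"
  where "v + w = Word (letters v @ letters w)"

instance
  by standard (simp_all add: zero_word_def plus_word_def)

end

type_synonym 'k free_alg = "word \<Rightarrow>\<^sub>0 'k"

definition free_X :: "'k::field free_alg" where "free_X = Poly_Mapping.single (Word [GX]) 1"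

definition free_Y :: "'k::field free_alg" where "free_Y = Poly_Mapping.single (Word [GY]) 1"

definition two_sided_ideal :: "'a::ring_1 set \<Rightarrow> bool"
  where "two_sided_ideal I \<longleftrightarrow> 0 \<in> I \<and> (\<forall>a\<in>I. \<forall>b\<in>I. a - b \<in> I) \<and>
    (\<forall>a\<in>I. \<forall>r. r * a \<in> I \<and> a * r \<in> I)"

definition commutator :: "'a::ring_1 \<Rightarrow> 'a \<Rightarrow> 'a"
  where "commutator a b = a * b - b * a"

definition weyl_ideal :: "'k::field free_alg set"
  where "weyl_ideal = two_sided_ideal hull {commutator free_Y free_X - 1}"

lemma two_sided_ideal_weyl_ideal: "two_sided_ideal (weyl_ideal :: 'k::field free_alg set)"
  unfolding weyl_ideal_def by (rule hull_in) (auto simp: two_sided_ideal_def)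

lemma weyl_ideal_closed:
  fixes a b r :: "'k::field free_alg"
  shows "0 \<in> (weyl_ideal :: 'k free_alg set)"
    and "a \<in> weyl_ideal \<Longrightarrow> b \<in> weyl_ideal \<Longrightarrow> a - b \<in> weyl_ideal"
    and "a \<in> weyl_ideal \<Longrightarrow> r * a \<in> weyl_ideal"
    and "a \<in> weyl_ideal \<Longrightarrow> a * r \<in> weyl_ideal"
  using two_sided_ideal_weyl_ideal[where 'k='k] unfolding two_sided_ideal_def by blast+

lemma weyl_ideal_uminus:
  fixes a :: "'k::field free_alg"
  shows "a \<in> weyl_ideal \<Longrightarrow> - a \<in> weyl_ideal"
  using weyl_ideal_closed(2)[OF weyl_ideal_closed(1), of a] by simp

lemma weyl_ideal_add:
  fixes a b :: "'k::field free_alg"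
  shows "a \<in> weyl_ideal \<Longrightarrow> b \<in> weyl_ideal \<Longrightarrow> a + b \<in> weyl_ideal"
  using weyl_ideal_closed(2)[of a "- b"] weyl_ideal_uminus[of b] by simp

text \<open>
  \<open>X\<close> acts on \<open>K[t]\<close> as multiplication by \<open>t\<close> and \<open>Y\<close> as \<open>d/dt\<close>.  This is only used to see
  that the ideal \<^const>\<open>weyl_ideal\<close> is proper.
\<close>

primrec gen_act :: "gen \<Rightarrow> 'k::field poly \<Rightarrow> 'k poly" where
  "gen_act GX f = pCons 0 f"
| "gen_act GY f = pderiv f"

definition word_act :: "word \<Rightarrow> 'k::field poly \<Rightarrow> 'k poly"
  where "word_act w f = foldr gen_act (letters w) f"

definition free_act :: "'k::field free_alg \<Rightarrow> 'k poly \<Rightarrow> 'k poly"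
  where "free_act p f =
    (\<Sum>w\<in>Poly_Mapping.keys p. smult (Poly_Mapping.lookup p w) (word_act w f))"

lemma gen_act_linear:
  "gen_act a (f + g) = gen_act a f + gen_act a g"
  "gen_act a (smult c f) = smult c (gen_act a f)"
  by (cases a; simp add: pderiv_add pderiv_smult)+

lemma foldr_gen_act_linear:
  "foldr gen_act as (f + g) = foldr gen_act as f + foldr gen_act as g"
  "foldr gen_act as (smult c f) = smult c (foldr gen_act as f)"
  by (induction as) (simp_all add: gen_act_linear)

lemma word_act_simps:
  "word_act w (f + g) = word_act w f + word_act w g"
  "word_act w (smult c f) = smult c (word_act w f)"
  "word_act (v + w) f = word_act v (word_act w f)"
  "word_act 0 f = f"
  by (simp_all add: word_act_def foldr_gen_act_linear plus_word_def zero_word_def)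

lemma free_act_superset:
  assumes "finite A" "Poly_Mapping.keys p \<subseteq> A"
  shows "free_act p f = (\<Sum>w\<in>A. smult (Poly_Mapping.lookup p w) (word_act w f))"
  unfolding free_act_def using assms
  by (intro sum.mono_neutral_left) (auto simp: in_keys_iff)

lemma free_act_add: "free_act (p + q) f = free_act p f + free_act q f"
proof -
  let ?A = "Poly_Mapping.keys p \<union> Poly_Mapping.keys q"
  have "Poly_Mapping.keys (p + q) \<subseteq> ?A"
    by (rule Poly_Mapping.keys_add)
  then show ?thesis
    by (simp add: free_act_superset[of ?A] lookup_add smult_add_left sum.distrib)
qed

lemma free_act_zero [simp]: "free_act 0 f = 0"
  by (simp add: free_act_def)

lemma free_act_uminus: "free_act (- p) f = - free_act p f"
  using free_act_add[of p "- p" f] by (simp add: eq_neg_iff_add_eq_0 add.commute)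

lemma free_act_diff: "free_act (p - q) f = free_act p f - free_act q f"
  using free_act_add[of p "- q" f] by (simp add: free_act_uminus)

lemma free_act_single [simp]: "free_act (Poly_Mapping.single w c) f = smult c (word_act w f)"
  by (simp add: free_act_def)

lemma free_act_linear: "free_act p (f + g) = free_act p f + free_act p g"
  by (simp add: free_act_def word_act_simps smult_add_right sum.distrib)

lemma free_alg_induct [case_names single add]:
  fixes p :: "'k::field free_alg"
  assumes "\<And>w c. P (Poly_Mapping.single w c)"
    and "\<And>p q. P p \<Longrightarrow> P q \<Longrightarrow> P (p + q)"
  shows "P p"
proof (induction p rule: update_induct)
  case const
  show ?case using assms(1)[of 0 0] by simp
next
  case (update f a b)
  have "Poly_Mapping.update a b f = f + Poly_Mapping.single a b"
    using update(1) by (intro poly_mapping_eqI)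
      (auto simp: lookup_update lookup_add lookup_single when_def in_keys_iff)
  then show ?case using assms update by metis
qed

lemma free_act_mult: "free_act (p * q) f = free_act p (free_act q f)"
proof (induction p rule: free_alg_induct)
  case (single v c)
  show ?case
  proof (induction q rule: free_alg_induct)
    case (single w d)
    show ?case by (simp add: mult_single word_act_simps)
  next
    case (add q r)
    then show ?case
      by (simp add: distrib_left free_act_add free_act_linear word_act_simps smult_add_right)
  qed
next
  case (add p r)
  then show ?case by (simp add: distrib_right free_act_add)
qed

lemma free_act_one [simp]: "free_act 1 f = f"
  using free_act_single[of 0 1 f] by (simp add: word_act_simps)

lemma free_act_weyl_ideal:
  fixes p :: "'k::field free_alg"
  assumes "p \<in> weyl_ideal"
  shows "free_act p f = 0"
proof -
  have zero [simp]: "free_act r 0 = 0" for r :: "'k free_alg"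
    using word_act_simps(2)[of _ 0 "0 :: 'k poly"] by (simp add: free_act_def)
  have "two_sided_ideal {p :: 'k free_alg. \<forall>f. free_act p f = 0}"
    by (auto simp: two_sided_ideal_def free_act_diff free_act_mult)
  moreover have "commutator free_Y free_X - 1 \<in> {p :: 'k free_alg. \<forall>f. free_act p f = 0}"
    by (auto simp: commutator_def free_act_diff free_act_mult free_X_def free_Y_def
        word_act_def pderiv_pCons)
  ultimately have "weyl_ideal \<subseteq> {p :: 'k free_alg. \<forall>f. free_act p f = 0}"
    unfolding weyl_ideal_def by (intro hull_minimal) auto
  then show ?thesis using assms by auto
qed

lemma one_notin_weyl_ideal: "1 \<notin> weyl_ideal"
  using free_act_weyl_ideal[of 1 1] by auto

quotient_type (overloaded) 'k weyl = "'k::field free_alg" / "\<lambda>p q. p - q \<in> weyl_ideal"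
proof (rule equivpI)
  show "reflp (\<lambda>p q :: 'k free_alg. p - q \<in> weyl_ideal)"
    by (rule reflpI) (simp add: weyl_ideal_closed)
  show "symp (\<lambda>p q :: 'k free_alg. p - q \<in> weyl_ideal)"
    by (rule sympI) (metis minus_diff_eq weyl_ideal_uminus)
  show "transp (\<lambda>p q :: 'k free_alg. p - q \<in> weyl_ideal)"
  proof (rule transpI)
    fix p q r :: "'k free_alg"
    assume "p - q \<in> weyl_ideal" "q - r \<in> weyl_ideal"
    then have "(p - q) + (q - r) \<in> weyl_ideal"
      by (rule weyl_ideal_add)
    then show "p - r \<in> weyl_ideal"
      by simp
  qed
qed

instantiation weyl :: (field) ring_1
begin

lift_definition zero_weyl :: "'a weyl" is 0 .

lift_definition one_weyl :: "'a weyl" is 1 .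

lift_definition plus_weyl :: "'a weyl \<Rightarrow> 'a weyl \<Rightarrow> 'a weyl" is "(+)"
  by (simp add: add_diff_add weyl_ideal_add)

lift_definition uminus_weyl :: "'a weyl \<Rightarrow> 'a weyl" is uminus
  using weyl_ideal_uminus by fastforce

lift_definition minus_weyl :: "'a weyl \<Rightarrow> 'a weyl \<Rightarrow> 'a weyl" is "(-)"
proof -
  fix a b c d :: "'a free_alg"
  assume "a - b \<in> weyl_ideal" "c - d \<in> weyl_ideal"
  then have "(a - b) - (c - d) \<in> weyl_ideal"
    by (rule weyl_ideal_closed(2))
  then show "(a - c) - (b - d) \<in> weyl_ideal"
    by (simp add: algebra_simps)
qed

lift_definition times_weyl :: "'a weyl \<Rightarrow> 'a weyl \<Rightarrow> 'a weyl" is "(*)"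
proof -
  fix a b c d :: "'a free_alg"
  assume "a - b \<in> weyl_ideal" "c - d \<in> weyl_ideal"
  then have "(a - b) * c + b * (c - d) \<in> weyl_ideal"
    by (intro weyl_ideal_add weyl_ideal_closed(4)[of "a - b"] weyl_ideal_closed(3)[of "c - d"])
  then show "a * c - b * d \<in> weyl_ideal"
    by (simp add: algebra_simps)
qed

instance
proof
  show "(0 :: 'a weyl) \<noteq> 1"
    by transfer (metis diff_0 minus_minus one_notin_weyl_ideal weyl_ideal_uminus)
qed (transfer; simp add: algebra_simps weyl_ideal_closed)+

end

lift_definition weyl_const :: "'k::field \<Rightarrow> 'k weyl" is "Poly_Mapping.single 0" .

lift_definition weyl_X :: "'k::field weyl" is free_X .

lift_definition weyl_Y :: "'k::field weyl" is free_Y .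

lemma commutator_weyl_Y_X: "commutator weyl_Y (weyl_X :: 'k::field weyl) = 1"
  unfolding commutator_def
  by transfer (auto simp: weyl_ideal_def commutator_def intro: hull_inc)

text \<open>
  Closure under negation and scalar multiplication follows from containing the constants.
\<close>

definition weyl_subalgebra :: "'k::field weyl set \<Rightarrow> bool"
  where "weyl_subalgebra S \<longleftrightarrow> range weyl_const \<subseteq> S \<and>
    (\<forall>a\<in>S. \<forall>b\<in>S. a + b \<in> S \<and> a * b \<in> S)"

definition ring_embedding :: "('a::ring_1 \<Rightarrow> 'b::ring_1) \<Rightarrow> bool"
  where "ring_embedding \<phi> \<longleftrightarrow> inj \<phi> \<and> \<phi> 1 = 1 \<and>
    (\<forall>a b. \<phi> (a + b) = \<phi> a + \<phi> b \<and> \<phi> (a * b) = \<phi> a * \<phi> b)"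

text \<open>
  For a subring \<open>S\<close> satisfying the right Ore condition, \<open>fractions \<phi> S\<close> is the copy of
  \<open>Frac S\<close> inside the division ring \<open>'d\<close> in which \<open>\<phi>\<close> embeds the ambient ring.
\<close>

definition fractions :: "('a::ring_1 \<Rightarrow> 'd::division_ring) \<Rightarrow> 'a set \<Rightarrow> 'd set"
  where "fractions \<phi> S = {\<phi> a * inverse (\<phi> s) | a s. a \<in> S \<and> s \<in> S \<and> s \<noteq> 0}"

text \<open>
  \<open>'d\<close> together with \<open>\<phi>\<close> is the skew field of fractions of \<open>'a\<close>; for an Ore domain the pair
  exists and is unique up to unique isomorphism under \<open>'a\<close>.
\<close>

definition skew_field_of_fractions :: "('a::ring_1 \<Rightarrow> 'd::division_ring) \<Rightarrow> bool"
  where "skew_field_of_fractions \<phi> \<longleftrightarrow> ring_embedding \<phi> \<and> fractions \<phi> UNIV = UNIV"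

end

theory Submission
  imports Defs "HOL-Algebra.Algebraic_Closure_Type"
begin

text \<open>
  The proof is by reduction modulo a prime.  Suppose that \<open>c s = a\<close> with \<open>s, a \<in> A\<^sub>1'\<close>, \<open>s \<noteq> 0\<close>, but
  \<open>c \<notin> A\<^sub>1'\<close>.  In the algebraic closure of \<open>K\<close> there is a valuation ring \<open>O\<close> with residue field
  \<open>k\<close> of characteristic \<open>p\<close> which contains the finitely many coefficients in question, including those
  of a linear functional which separates \<open>c\<close> from the monomials \<open>x\<^sup>i y\<^sup>j\<close> of bounded degree.
  So everything reduces to \<open>A\<^sub>1(k)\<close>.

  There, \<open>x\<^sup>p\<close> and \<open>y\<^sup>p\<close> lie in the centre \<open>Z = k[X\<^sup>p, Y\<^sup>p]\<close>, and \<open>A\<^sub>1(k)\<close> is free over \<open>Z\<close> on the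
  \<open>x\<^sup>i y\<^sup>j\<close> with \<open>i, j < p\<close>.  A suitable right multiple of \<open>s\<close> is a nonzero element of
  \<open>Z' = k[x\<^sup>p, y\<^sup>p]\<close>, so the coordinates of \<open>c\<close> lie in \<open>Z \<inter> Frac(Z')\<close>.  This is \<open>Z'\<close>, for otherwise a prime
  \<open>\<pi>\<close> of \<open>Z\<close> divides both \<open>x\<^sup>p - \<xi>\<close> and \<open>y\<^sup>p - \<mu>\<close> for some \<open>\<xi>, \<mu> \<in> k\<close>.  Then \<open>\<pi>\<close> divides their Poisson
  bracket, which is defined by commutators of lifts divided by \<open>p\<close>; but the bracket is the unit
  \<open>(p - 1)!\<close>, since \<open>[y\<^sup>p, x\<^sup>p] \<equiv> p!\<close> modulo \<open>p\<^sup>2\<close>.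

  Hence \<open>c\<close> reduces to a polynomial in \<open>x\<close> and \<open>y\<close>, whose degree is at most that of \<open>a\<close>, which
  contradicts the choice of the functional.
\<close>

section \<open>Representations and normal forms\<close>

text \<open>Over a field of characteristic p the theorem itself is false, so reduction alone cannot
  be the argument. Take x = X and y = Y + X^(p-1) Y^p. Then [y, x] = 1 and y^p = X^(p(p-1)) Y^(p^2),
  so Y^(p^2) is the quotient of y^p by a power of x^p without lying in A_1'; the central prime X^p
  divides both p-th powers. The lift to characteristic zero excludes this, because it provides the
  bracket. Commutators are divided there by p itself, which does not generate the maximal ideal of
  the valuation ring; so the conditions modulo p and modulo the maximal ideal have to be kept apart.

  Algebraic closedness of the residue field is what splits a polynomial in one p-th power into
  linear factors. That c lies outside A_1' is not an identity, so it would not survive reduction by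
  itself. The functional turns it into equations, and the degree bound, valid in every
  characteristic, makes finitely many of them suffice.\<close>

hide_const (open) up_ring.coeff up_ring.monom module.smult Polynomials.degree Polynomials.lead_coeff Divisibility.prime Divisibility.irreducible

lemma weyl_const_simps [simp]:
  "weyl_const 0 = 0" "weyl_const 1 = 1"
  by (transfer; simp add: weyl_ideal_closed)+

lemma weyl_const_add: "weyl_const (a + b) = weyl_const a + weyl_const b"
  by transfer (simp add: single_add weyl_ideal_closed)

lemma weyl_const_mult: "weyl_const (a * b) = weyl_const a * weyl_const b"
  by transfer (simp add: mult_single weyl_ideal_closed)

lemma weyl_const_of_nat: "weyl_const (of_nat n) = of_nat n"
  by (induction n) (simp_all add: weyl_const_add)

lemma single_0_commute: "Poly_Mapping.single 0 c * p = p * Poly_Mapping.single (0 :: word) (c :: 'k :: field)"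
  by (induction p rule: free_alg_induct) (simp_all add: mult_single algebra_simps)

lemma weyl_const_commute: "weyl_const c * a = a * weyl_const c"
  by transfer (simp add: single_0_commute weyl_ideal_closed)

lemma weyl_Y_X: "weyl_Y * weyl_X = weyl_X * weyl_Y + (1 :: 'k :: field weyl)"
  using commutator_weyl_Y_X[where 'k = 'k] by (simp add: commutator_def algebra_simps)

lemma weyl_induct [case_names const add X Y]:
  fixes a :: "'k :: field weyl"
  assumes const: "\<And>c. P (weyl_const c)"
    and add: "\<And>a b. P a \<Longrightarrow> P b \<Longrightarrow> P (a + b)"
    and X: "\<And>a. P a \<Longrightarrow> P (weyl_X * a)"
    and Y: "\<And>a. P a \<Longrightarrow> P (weyl_Y * a)"
  shows "P a"
proof (induction a rule: weyl.abs_induct)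
  fix p :: "'k free_alg"
  show "P (abs_weyl p)"
  proof (induction p rule: free_alg_induct)
    case (single w c)
    obtain gs where w: "w = Word gs" by (cases w)
    show ?case unfolding w
    proof (induction gs)
      case Nil
      then show ?case using const[of c] by (simp add: weyl_const_def zero_word_def)
    next
      case (Cons g gs)
      have *: "Poly_Mapping.single (Word (g # gs)) c = Poly_Mapping.single (Word [g]) 1 * Poly_Mapping.single (Word gs) c"
        by (simp add: mult_single plus_word_def)
      have "abs_weyl (Poly_Mapping.single (Word (g # gs)) c) =
          (case g of GX \<Rightarrow> weyl_X | GY \<Rightarrow> weyl_Y) * abs_weyl (Poly_Mapping.single (Word gs) c)"
        unfolding * times_weyl.abs_eq[symmetric]
        by (cases g) (simp_all add: weyl_X_def weyl_Y_def free_X_def free_Y_def)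
      then show ?case
        using X[OF Cons] Y[OF Cons] by (cases g) simp_all
    qed
  next
    case (add p q)
    then show ?case using assms(2)[OF add] by (simp add: plus_weyl.abs_eq)
  qed
qed

section \<open>Homomorphisms from the Weyl algebra\<close>

definition free_eval :: "('k::field \<Rightarrow> 'b::ring_1) \<Rightarrow> 'b \<Rightarrow> 'b \<Rightarrow> 'k free_alg \<Rightarrow> 'b" where
  "free_eval \<kappa> x y p = (\<Sum>w\<in>Poly_Mapping.keys p.
     \<kappa> (Poly_Mapping.lookup p w) * prod_list (map (case_gen x y) (letters w)))"

definition weyl_hom :: "('k::field \<Rightarrow> 'b::ring_1) \<Rightarrow> 'b \<Rightarrow> 'b \<Rightarrow> 'k weyl \<Rightarrow> 'b" where
  "weyl_hom \<kappa> x y a = free_eval \<kappa> x y (rep_weyl a)"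

text \<open>Scalars are only required to commute with x and y: in a ring of additive endomorphisms
  they are not central. A general \<kappa> also covers base change, where the field changes.\<close>

locale weyl_representation =
  fixes \<kappa> :: "'k::field \<Rightarrow> 'b::ring_1" and x y :: 'b
  assumes \<kappa>_1 [simp]: "\<kappa> 1 = 1"
    and \<kappa>_add: "\<kappa> (c + d) = \<kappa> c + \<kappa> d"
    and \<kappa>_mult: "\<kappa> (c * d) = \<kappa> c * \<kappa> d"
    and \<kappa>_x: "\<kappa> c * x = x * \<kappa> c"
    and \<kappa>_y: "\<kappa> c * y = y * \<kappa> c"
    and weyl_relation: "y * x = x * y + 1"
begin

abbreviation "word_val w \<equiv> prod_list (map (case_gen x y) (letters w))"

lemma \<kappa>_0 [simp]: "\<kappa> 0 = 0"
  using \<kappa>_add[of 0 0] by simp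

lemma \<kappa>_word_val: "\<kappa> c * word_val w = word_val w * \<kappa> c"
proof -
  have "\<kappa> c * prod_list (map (case_gen x y) gs) = prod_list (map (case_gen x y) gs) * \<kappa> c" for gs
  proof (induction gs)
    case (Cons g gs)
    have "\<kappa> c * case_gen x y g = case_gen x y g * \<kappa> c"
      by (cases g) (simp_all add: \<kappa>_x \<kappa>_y)
    then show ?case using Cons by simp (metis mult.assoc)
  qed simp
  then show ?thesis .
qed

lemma free_eval_superset:
  assumes "finite A" "Poly_Mapping.keys p \<subseteq> A"
  shows "free_eval \<kappa> x y p = (\<Sum>w\<in>A. \<kappa> (Poly_Mapping.lookup p w) * word_val w)"
  unfolding free_eval_def using assms
  by (intro sum.mono_neutral_left) (auto simp: in_keys_iff)

lemma free_eval_add: "free_eval \<kappa> x y (p + q) = free_eval \<kappa> x y p + free_eval \<kappa> x y q"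
proof -
  let ?A = "Poly_Mapping.keys p \<union> Poly_Mapping.keys q"
  have "Poly_Mapping.keys (p + q) \<subseteq> ?A"
    by (rule Poly_Mapping.keys_add)
  then show ?thesis
    by (simp add: free_eval_superset[of ?A] lookup_add \<kappa>_add distrib_right sum.distrib)
qed

lemma free_eval_single [simp]: "free_eval \<kappa> x y (Poly_Mapping.single w c) = \<kappa> c * word_val w"
  by (simp add: free_eval_def)

lemma free_eval_diff: "free_eval \<kappa> x y (p - q) = free_eval \<kappa> x y p - free_eval \<kappa> x y q"
  using free_eval_add[of "p - q" q] by simp

lemma free_eval_mult: "free_eval \<kappa> x y (p * q) = free_eval \<kappa> x y p * free_eval \<kappa> x y q"
proof (induction p rule: free_alg_induct)
  case (single v c)
  show ?case
  proof (induction q rule: free_alg_induct)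
    case (single w d)
    have "\<kappa> c * \<kappa> d * (word_val v * word_val w) = \<kappa> c * word_val v * (\<kappa> d * word_val w)"
      by (metis (no_types, lifting) \<kappa>_word_val mult.assoc)
    then show ?case by (simp add: mult_single plus_word_def \<kappa>_mult)
  next
    case (add q r)
    then show ?case by (simp add: distrib_left free_eval_add)
  qed
next
  case (add p r)
  then show ?case by (simp add: distrib_right free_eval_add)
qed

lemma free_eval_weyl_ideal:
  assumes "p \<in> weyl_ideal"
  shows "free_eval \<kappa> x y p = 0"
proof -
  have 0: "free_eval \<kappa> x y 0 = 0" by (simp add: free_eval_def)
  have 1: "free_eval \<kappa> x y 1 = 1"
    using free_eval_single[of 0 1] by (simp add: zero_word_def del: free_eval_single single_one flip: single_one)
  have "two_sided_ideal {p. free_eval \<kappa> x y p = 0}"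
    by (auto simp: two_sided_ideal_def free_eval_diff free_eval_mult 0)
  moreover have "commutator free_Y free_X - 1 \<in> {p. free_eval \<kappa> x y p = 0}"
    by (auto simp: commutator_def free_eval_diff free_eval_mult free_X_def free_Y_def 1 weyl_relation)
  ultimately have "weyl_ideal \<subseteq> {p. free_eval \<kappa> x y p = 0}"
    unfolding weyl_ideal_def by (intro hull_minimal) auto
  then show ?thesis using assms by auto
qed

lemma weyl_hom_abs: "weyl_hom \<kappa> x y (abs_weyl p) = free_eval \<kappa> x y p"
proof -
  have "rep_weyl (abs_weyl p) - p \<in> weyl_ideal"
    by (rule Quotient_rep_abs[OF Quotient_weyl]) (simp add: weyl_ideal_closed)
  then show ?thesis
    using free_eval_weyl_ideal[of "rep_weyl (abs_weyl p) - p"] by (simp add: weyl_hom_def free_eval_diff)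
qed

lemma hom_add: "weyl_hom \<kappa> x y (a + b) = weyl_hom \<kappa> x y a + weyl_hom \<kappa> x y b"
  by (induction a rule: weyl.abs_induct, induction b rule: weyl.abs_induct)
    (simp add: plus_weyl.abs_eq weyl_hom_abs free_eval_add)

lemma hom_mult: "weyl_hom \<kappa> x y (a * b) = weyl_hom \<kappa> x y a * weyl_hom \<kappa> x y b"
  by (induction a rule: weyl.abs_induct, induction b rule: weyl.abs_induct)
    (simp add: times_weyl.abs_eq weyl_hom_abs free_eval_mult)

lemma hom_const [simp]: "weyl_hom \<kappa> x y (weyl_const c) = \<kappa> c"
  by (simp add: weyl_const_def weyl_hom_abs zero_word_def)

lemma hom_X [simp]: "weyl_hom \<kappa> x y weyl_X = x"
  by (simp add: weyl_X_def weyl_hom_abs free_X_def)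

lemma hom_Y [simp]: "weyl_hom \<kappa> x y weyl_Y = y"
  by (simp add: weyl_Y_def weyl_hom_abs free_Y_def)

lemma hom_0 [simp]: "weyl_hom \<kappa> x y 0 = 0"
  using hom_const[of 0] by simp

lemma hom_1 [simp]: "weyl_hom \<kappa> x y 1 = 1"
  using hom_const[of 1] by (simp del: hom_const)

lemma hom_diff: "weyl_hom \<kappa> x y (a - b) = weyl_hom \<kappa> x y a - weyl_hom \<kappa> x y b"
  using hom_add[of "a - b" b] by simp

lemma hom_uminus: "weyl_hom \<kappa> x y (- a) = - weyl_hom \<kappa> x y a"
  using hom_diff[of 0 a] by simp

lemma hom_power: "weyl_hom \<kappa> x y (a ^ n) = weyl_hom \<kappa> x y a ^ n"
  by (induction n) (simp_all add: hom_mult)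

lemma hom_sum: "weyl_hom \<kappa> x y (sum f A) = (\<Sum>i\<in>A. weyl_hom \<kappa> x y (f i))"
  by (induction A rule: infinite_finite_induct) (simp_all add: hom_add)

end

section \<open>Ordered polynomials in two elements\<close>

definition evy :: "('k::zero \<Rightarrow> 'b::ring_1) \<Rightarrow> 'b \<Rightarrow> 'k poly \<Rightarrow> 'b" where
  "evy \<kappa> y q = fold_coeffs (\<lambda>c b. \<kappa> c + y * b) q 0"

text \<open>Powers of x stand to the left of those of y. The same evaluation serves generators with
  [y, x] = 1, where it gives normal forms, and commuting p-th powers, where it is a ring
  homomorphism for central scalars.\<close>

definition ev :: "('k::zero \<Rightarrow> 'b::ring_1) \<Rightarrow> 'b \<Rightarrow> 'b \<Rightarrow> 'k poly poly \<Rightarrow> 'b" where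
  "ev \<kappa> x y f = fold_coeffs (\<lambda>q b. evy \<kappa> y q + x * b) f 0"

lemma evy_0 [simp]: "evy \<kappa> y 0 = 0" and ev_0 [simp]: "ev \<kappa> x y 0 = 0"
  by (simp_all add: evy_def ev_def)

lemma evy_pCons: "\<kappa> 0 = 0 \<Longrightarrow> evy \<kappa> y (pCons c q) = \<kappa> c + y * evy \<kappa> y q"
  by (cases "c = 0 \<and> q = 0") (auto simp: evy_def)

lemma ev_pCons: "ev \<kappa> x y (pCons q f) = evy \<kappa> y q + x * ev \<kappa> x y f"
  by (cases "q = 0 \<and> f = 0") (auto simp: ev_def)

lemma evy_sum:
  assumes "\<kappa> 0 = 0" "\<And>j. j \<ge> N \<Longrightarrow> coeff q j = 0" "\<And>c. \<kappa> c * y = y * \<kappa> c"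
  shows "evy \<kappa> y q = (\<Sum>j<N. \<kappa> (coeff q j) * y ^ j)"
  using assms(2)
proof (induction q arbitrary: N)
  case 0
  then show ?case using assms(1) by simp
next
  case (pCons c q)
  show ?case
  proof (cases N)
    case 0
    then have "pCons c q = 0" using pCons.prems by (intro poly_eqI) auto
    then show ?thesis using pCons.hyps by auto
  next
    case (Suc M)
    have "coeff q j = 0" if "j \<ge> M" for j
      using pCons.prems[of "Suc j"] that Suc by simp
    then have "evy \<kappa> y q = (\<Sum>j<M. \<kappa> (coeff q j) * y ^ j)" by (rule pCons.IH)
    moreover have "y * (\<kappa> d * y ^ j) = \<kappa> d * y ^ Suc j" for d j
      by (simp add: assms(3) mult.assoc[symmetric])
    ultimately show ?thesis
      unfolding Suc sum.lessThan_Suc_shift using assms(1)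
      by (simp add: evy_pCons sum_distrib_left)
  qed
qed

lemma ev_sum:
  assumes "\<kappa> 0 = 0" "\<And>i j. i \<ge> N \<or> j \<ge> M \<Longrightarrow> coeff (coeff f i) j = 0"
    "\<And>c. \<kappa> c * y = y * \<kappa> c" "\<And>c. \<kappa> c * x = x * \<kappa> c"
  shows "ev \<kappa> x y f = (\<Sum>i<N. \<Sum>j<M. \<kappa> (coeff (coeff f i) j) * x ^ i * y ^ j)"
  using assms(2)
proof (induction f arbitrary: N)
  case 0
  then show ?case using assms(1) by simp
next
  case (pCons q f)
  show ?case
  proof (cases N)
    case 0
    then have "pCons q f = 0" using pCons.prems by (intro poly_eqI) auto
    then show ?thesis using pCons.hyps by auto
  next
    case (Suc L)
    have "coeff (coeff f i) j = 0" if "i \<ge> L \<or> j \<ge> M" for i j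
      using pCons.prems[of "Suc i"] that Suc by simp
    then have "ev \<kappa> x y f = (\<Sum>i<L. \<Sum>j<M. \<kappa> (coeff (coeff f i) j) * x ^ i * y ^ j)" by (rule pCons.IH)
    moreover have "evy \<kappa> y q = (\<Sum>j<M. \<kappa> (coeff q j) * y ^ j)"
      using pCons.prems[of 0] by (intro evy_sum) (use assms in auto)
    moreover have "x * (\<kappa> d * x ^ i * y ^ j) = \<kappa> d * x ^ Suc i * y ^ j" for d i j
      by (simp add: assms(4) mult.assoc[symmetric])
    ultimately show ?thesis
      unfolding Suc sum.lessThan_Suc_shift using assms(1)
      by (simp add: ev_pCons sum_distrib_left del: power_Suc)
  qed
qed

lemma poly_poly_bound:
  obtains N where "\<And>i j. i \<ge> N \<or> j \<ge> N \<Longrightarrow> coeff (coeff (f :: 'a :: zero poly poly) i) j = 0"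
proof -
  define N where "N = Suc (degree f + (\<Sum>i\<le>degree f. degree (coeff f i)))"
  have "coeff (coeff f i) j = 0" if "i \<ge> N \<or> j \<ge> N" for i j
  proof (cases "i \<le> degree f")
    case True
    then have "degree (coeff f i) \<le> (\<Sum>i\<le>degree f. degree (coeff f i))"
      by (intro member_le_sum) auto
    with that True show ?thesis by (intro coeff_eq_0) (auto simp: N_def)
  next
    case False
    then show ?thesis by (simp add: coeff_eq_0)
  qed
  then show ?thesis using that by blast
qed

text \<open>A representation needs a ring type as its target; under pointwise addition and
  composition, distributivity holds because the maps are additive.\<close>

typedef (overloaded) 'v endo = "{f :: 'v::ab_group_add \<Rightarrow> 'v. \<forall>u v. f (u + v) = f u + f v}"
  by (rule exI[of _ id]) simp

setup_lifting type_definition_endo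

instantiation endo :: ("{ab_group_add, zero_neq_one}") ring_1
begin
lift_definition zero_endo :: "'a endo" is "\<lambda>_. 0" by simp
lift_definition one_endo :: "'a endo" is "\<lambda>v. v" by simp
lift_definition plus_endo :: "'a endo \<Rightarrow> 'a endo \<Rightarrow> 'a endo" is "\<lambda>f g v. f v + g v" by simp
lift_definition minus_endo :: "'a endo \<Rightarrow> 'a endo \<Rightarrow> 'a endo" is "\<lambda>f g v. f v - g v" by simp
lift_definition uminus_endo :: "'a endo \<Rightarrow> 'a endo" is "\<lambda>f v. - f v" by simp
lift_definition times_endo :: "'a endo \<Rightarrow> 'a endo \<Rightarrow> 'a endo" is "\<lambda>f g v. f (g v)" by simp
instance
proof
  show "(0 :: 'a endo) \<noteq> 1"
    by transfer (metis zero_neq_one)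
qed (transfer; simp add: algebra_simps fun_eq_iff)+
end

text \<open>
  The module \<open>K[t]\<close> is not faithful in positive characteristic, hence the additional variable \<open>w\<close>:
  on \<open>K[w][t]\<close>, the generator \<open>X\<close> acts as \<open>t\<close> and \<open>Y\<close> as \<open>w + d/dt\<close>.  Throughout, the outer
  variable of a polynomial in two variables corresponds to \<open>X\<close> and the inner one to \<open>Y\<close>.
\<close>

definition end_smult :: "'k::field \<Rightarrow> 'k poly poly endo" where "end_smult c = Abs_endo (smult [:c:])"
definition end_X :: "'k::field poly poly endo" where "end_X = Abs_endo (pCons 0)"
definition end_Y :: "'k::field poly poly endo" where "end_Y = Abs_endo (\<lambda>f. smult [:0, 1:] f + pderiv f)"

lemma Rep_end [simp]:
  "Rep_endo (end_smult c) = smult [:c:]" "Rep_endo end_X = pCons 0"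
  "Rep_endo end_Y = (\<lambda>f. smult [:0, 1:] f + pderiv f)"
  by (simp_all add: end_smult_def end_X_def end_Y_def Abs_endo_inverse smult_add_right pderiv_add)

interpretation sym: weyl_representation end_smult end_X end_Y
proof
  fix c d :: "'k::field"
  show "end_smult 1 = (1 :: 'k poly poly endo)"
    by (simp add: Rep_endo_inject[symmetric] one_endo.rep_eq fun_eq_iff flip: one_pCons)
  show "end_smult (c + d) = end_smult c + end_smult d"
    by (simp add: Rep_endo_inject[symmetric] plus_endo.rep_eq fun_eq_iff flip: smult_add_left)
  show "end_smult (c * d) = end_smult c * end_smult d"
    by (simp add: Rep_endo_inject[symmetric] times_endo.rep_eq fun_eq_iff mult.commute)
  show "end_smult c * end_X = end_X * end_smult c"
    by (simp add: Rep_endo_inject[symmetric] times_endo.rep_eq fun_eq_iff)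
  show "end_smult c * end_Y = end_Y * end_smult c"
    by (simp add: Rep_endo_inject[symmetric] times_endo.rep_eq fun_eq_iff smult_add_right pderiv_smult mult.commute)
  show "end_Y * end_X = end_X * end_Y + (1 :: 'k poly poly endo)"
    by (simp add: Rep_endo_inject[symmetric] times_endo.rep_eq plus_endo.rep_eq one_endo.rep_eq fun_eq_iff pderiv_pCons)
qed

text \<open>The orbit of the vector 1: X^i Y^j sends it to t^i w^j, so the resulting polynomial
  lists the coefficients of an element written with X to the left.\<close>

definition sym :: "'k::field weyl \<Rightarrow> 'k poly poly" where
  "sym a = Rep_endo (weyl_hom end_smult end_X end_Y a) 1"

lemma sym_simps [simp]:
  "sym (a + b) = sym a + sym b" "sym (a - b) = sym a - sym b" "sym (- a) = - sym a"
  "sym 0 = 0" "sym (weyl_const c) = [:[:c:]:]" "sym (weyl_const c * a) = smult [:c:] (sym a)"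
  "sym (weyl_X * a) = pCons 0 (sym a)" "sym (weyl_Y * a) = smult [:0, 1:] (sym a) + pderiv (sym a)"
  by (simp_all add: sym_def sym.hom_add sym.hom_diff sym.hom_uminus sym.hom_mult
      plus_endo.rep_eq minus_endo.rep_eq uminus_endo.rep_eq times_endo.rep_eq zero_endo.rep_eq)

abbreviation nf :: "'k::field poly poly \<Rightarrow> 'k weyl" where
  "nf \<equiv> ev weyl_const weyl_X weyl_Y"

lemma sym_nf [simp]: "sym (nf f) = f"
proof -
  have *: "sym (evy weyl_const weyl_Y q) = [:q:]" for q :: "'a poly"
  proof (induction q)
    case (pCons c q)
    then show ?case by (simp add: evy_pCons)
  qed simp
  show ?thesis by (induction f) (simp_all add: ev_pCons *)
qed

lemma evy_add: "\<kappa> 0 = 0 \<Longrightarrow> (\<And>c d. \<kappa> (c + d) = \<kappa> c + \<kappa> d) \<Longrightarrow> evy \<kappa> y (p + q) = evy \<kappa> y p + evy \<kappa> y q"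
  by (induction p q rule: poly_induct2) (simp_all add: evy_pCons algebra_simps)

lemma ev_add: "\<kappa> 0 = 0 \<Longrightarrow> (\<And>c d. \<kappa> (c + d) = \<kappa> c + \<kappa> d) \<Longrightarrow> ev \<kappa> x y (f + g) = ev \<kappa> x y f + ev \<kappa> x y g"
  by (induction f g rule: poly_induct2) (simp_all add: ev_pCons evy_add algebra_simps)

text \<open>Together with \<open>sym_nf\<close> this makes the X^i Y^j a basis. Spanning follows
  from closure under left multiplication by the generators; the only rewriting occurs when Y passes
  X.\<close>

lemma nf_sym [simp]: "nf (sym a) = a"
proof (induction a rule: weyl_induct)
  case (const c)
  then show ?case by (simp add: ev_pCons evy_pCons)
next
  case (add a b)
  then show ?case by (simp add: ev_add weyl_const_add)
next
  case (X a)
  then show ?case by (simp add: ev_pCons)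
next
  case (Y a)
  \<comment> \<open>\<open>nf\<close> intertwines the operator w + d/dt with left multiplication by
    Y.\<close>
  have *: "nf (smult [:0, 1:] f + pderiv f) = weyl_Y * nf f" for f :: "'a poly poly"
  proof (induction f)
    case (pCons q f)
    have "nf (smult [:0, 1:] (pCons q f) + pderiv (pCons q f)) =
      weyl_Y * evy weyl_const weyl_Y q + (nf f + weyl_X * nf (smult [:0, 1:] f + pderiv f))"
      by (simp add: ev_pCons evy_pCons evy_add weyl_const_add pderiv_pCons ev_add algebra_simps)
    also have "\<dots> = weyl_Y * nf (pCons q f)"
      unfolding pCons.IH by (simp add: ev_pCons algebra_simps) (simp add: weyl_Y_X algebra_simps flip: mult.assoc)
    finally show ?case .
  qed simp
  show ?case by (simp add: * Y)
qed

lemma sym_inject: "sym a = sym b \<longleftrightarrow> a = b"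
  by (metis nf_sym)

section \<open>Coefficients of normal forms\<close>

definition cf :: "'k::field weyl \<Rightarrow> nat \<Rightarrow> nat \<Rightarrow> 'k" where
  "cf a i j = coeff (coeff (sym a) i) j"

lemma weyl_eqI: "(\<And>i j. cf a i j = cf b i j) \<Longrightarrow> a = b"
  unfolding cf_def by (metis poly_eqI sym_inject)

lemma cf_simps [simp]:
  "cf (a + b) i j = cf a i j + cf b i j" "cf (a - b) i j = cf a i j - cf b i j"
  "cf (- a) i j = - cf a i j" "cf 0 i j = 0"
  "cf (weyl_const c * a) i j = c * cf a i j"
  by (simp_all add: cf_def)

lemma cf_const: "cf (weyl_const c) i j = (if i = 0 \<and> j = 0 then c else 0)"
  by (auto simp: cf_def coeff_pCons split: nat.splits)

lemma cf_1: "cf 1 i j = (if i = 0 \<and> j = 0 then 1 else 0)"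
  using cf_const[of 1 i j] by simp

lemma cf_X: "cf (weyl_X * a) i j = (if i = 0 then 0 else cf a (i - 1) j)"
  by (auto simp: cf_def coeff_pCons split: nat.splits)

lemma cf_Y: "cf (weyl_Y * a) i j = (if j = 0 then 0 else cf a i (j - 1)) + of_nat (Suc i) * cf a (Suc i) j"
proof -
  have *: "of_nat n * p = smult (of_nat n) p" for n and p :: "'a poly"
    by (simp add: of_nat_poly)
  show ?thesis
    by (auto simp: cf_def coeff_pCons coeff_pderiv * simp del: of_nat_Suc split: nat.splits)
qed

lemma cf_monom: "cf (weyl_X ^ i * weyl_Y ^ j) k l = (if k = i \<and> l = j then 1 else 0)"
proof (induction i arbitrary: k)
  case 0
  have "cf (weyl_Y ^ j) k l = (if k = 0 \<and> l = j then 1 else 0 :: 'a)"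
  proof (induction j arbitrary: k l)
    case 0
    then show ?case using cf_const[of 1 k l] by simp
  next
    case (Suc j)
    show ?case by (auto simp: cf_Y Suc)
  qed
  then show ?case by simp
next
  case (Suc i)
  then show ?case by (auto simp: cf_X mult.assoc)
qed

lemma cf_sum: "cf (sum f A) i j = (\<Sum>n\<in>A. cf (f n) i j)"
  by (induction A rule: infinite_finite_induct) simp_all

lemma cf_mult_Y: "cf (a * weyl_Y) i j = (if j = 0 then 0 else cf a i (j - 1))"
proof (induction a arbitrary: i j rule: weyl_induct)
  case (const c)
  have "cf weyl_Y i j = (if i = 0 \<and> j = 1 then 1 else 0 :: 'a)" for i j
    using cf_monom[of 0 1 i j] by simp
  then show ?case by (auto simp: cf_const)
next
  case (Y a)
  then show ?case by (simp add: cf_Y mult.assoc)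
qed (auto simp: cf_X mult.assoc distrib_right)

lemma cf_mult_X: "cf (a * weyl_X) i j = (if i = 0 then 0 else cf a (i - 1) j) + of_nat (Suc j) * cf a i (Suc j)"
proof (induction a arbitrary: i j rule: weyl_induct)
  case (const c)
  have "cf weyl_X i j = (if i = 1 \<and> j = 0 then 1 else 0 :: 'a)" for i j
    using cf_monom[of 1 0 i j] by simp
  then show ?case by (auto simp: cf_const)
next
  case (Y a)
  have "weyl_Y * a * weyl_X = weyl_Y * (a * weyl_X)" by (simp add: mult.assoc)
  then show ?case by (simp add: cf_Y Y algebra_simps)
qed (auto simp: cf_X mult.assoc distrib_right algebra_simps)

text \<open>Commutators with the generators are partial derivatives; this is how centrality is later
  read off from exponents.\<close>

lemma cf_commutator_X: "cf (commutator a weyl_X) i j = of_nat (Suc j) * cf a i (Suc j)"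
  by (simp add: commutator_def cf_mult_X cf_X del: of_nat_Suc)

lemma cf_commutator_Y: "cf (commutator weyl_Y a) i j = of_nat (Suc i) * cf a (Suc i) j"
  by (simp add: commutator_def cf_mult_Y cf_Y del: of_nat_Suc)

lemma cf_bound: obtains N where "\<And>i j. i \<ge> N \<or> j \<ge> N \<Longrightarrow> cf a i j = 0"
  unfolding cf_def using poly_poly_bound[of "sym a"] by blast

lemma weyl_expand:
  assumes "\<And>i j. i \<ge> N \<or> j \<ge> M \<Longrightarrow> cf a i j = 0"
  shows "a = (\<Sum>i<N. \<Sum>j<M. weyl_const (cf a i j) * weyl_X ^ i * weyl_Y ^ j)"
  using ev_sum[of weyl_const N M "sym a" weyl_Y weyl_X] assms
  by (simp add: cf_def weyl_const_commute)

text \<open>Elimination by cross-multiplication with a nonzero pivot \<open>M k j\<close>, since a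
  domain allows no division. The unknown at \<open>k\<close> is then chosen so as to satisfy
  equation \<open>j\<close>.\<close>

lemma linear_dependence:
  fixes M :: "'i \<Rightarrow> 'j \<Rightarrow> 'a::idom"
  assumes "finite J" "finite I" "card J < card I"
  shows "\<exists>c. (\<exists>i\<in>I. c i \<noteq> 0) \<and> (\<forall>j\<in>J. (\<Sum>i\<in>I. c i * M i j) = 0)"
  using assms
proof (induction J arbitrary: I M rule: finite_induct)
  case empty
  then have "I \<noteq> {}" by auto
  then show ?case by (intro exI[of _ "\<lambda>_. 1"]) auto
next
  case (insert j J)
  show ?case
  proof (cases "\<forall>i\<in>I. M i j = 0")
    case True
    have "card J < card I" using insert by auto
    from insert.IH[OF insert.prems(1) this, of M] True show ?thesis by auto
  next
    case False
    then obtain k where k: "k \<in> I" "M k j \<noteq> 0" by auto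
    define I' where "I' = I - {k}"
    have I': "finite I'" "k \<notin> I'" "I = insert k I'" using insert.prems k by (auto simp: I'_def)
    have "card J < card I'" using insert.prems insert.hyps I' by auto
    from insert.IH[OF I'(1) this, of "\<lambda>i l. M k j * M i l - M i j * M k l"]
    obtain c where c: "\<exists>i\<in>I'. c i \<noteq> 0"
      "\<And>l. l \<in> J \<Longrightarrow> (\<Sum>i\<in>I'. c i * (M k j * M i l - M i j * M k l)) = 0" by auto
    define d where "d i = (if i = k then - (\<Sum>i\<in>I'. c i * M i j) else c i * M k j)" for i
    have "(\<Sum>i\<in>I. d i * M i l) = (\<Sum>i\<in>I'. c i * (M k j * M i l - M i j * M k l))" for l
    proof -
      have "(\<Sum>i\<in>I. d i * M i l) = - (\<Sum>i\<in>I'. c i * M i j) * M k l + (\<Sum>i\<in>I'. c i * M k j * M i l)"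
        unfolding I'(3) using I' by (auto simp: d_def intro!: sum.cong)
      then show ?thesis by (simp add: algebra_simps sum_distrib_left sum_subtractf)
    qed
    moreover have "(\<Sum>i\<in>I'. c i * (M k j * M i j - M i j * M k j)) = 0"
      by (simp add: mult.commute)
    ultimately have "\<forall>l\<in>insert j J. (\<Sum>i\<in>I. d i * M i l) = 0"
      using c(2) by auto
    moreover have "\<exists>i\<in>I. d i \<noteq> 0"
      using c(1) k I' by (metis d_def insertCI mult_eq_0_iff)
    ultimately show ?thesis by blast
  qed
qed

section \<open>Degrees\<close>

definition act :: "'k::field weyl \<Rightarrow> 'k poly poly \<Rightarrow> 'k poly poly" where
  "act a = Rep_endo (weyl_hom end_smult end_X end_Y a)"

lemma sym_mult: "sym (a * b) = act a (sym b)"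
  by (simp add: sym_def act_def sym.hom_mult times_endo.rep_eq)

lemma act_simps [simp]:
  "act (a + b) f = act a f + act b f" "act 0 f = 0" "act (weyl_const c) f = smult [:c:] f"
  "act (weyl_X * a) f = pCons 0 (act a f)"
  "act (weyl_Y * a) f = smult [:0, 1:] (act a f) + pderiv (act a f)"
  by (simp_all add: act_def sym.hom_add sym.hom_mult plus_endo.rep_eq times_endo.rep_eq zero_endo.rep_eq)

text \<open>A polynomial in Y acts as multiplication by the same polynomial in w, up to terms of
  lower degree in t, because d/dt lowers that degree. So leading coefficients in X multiply as in a
  commutative domain.\<close>

lemma coeff_act_nf:
  fixes f g :: "'k::field poly poly"
  shows "degree (act (nf g) f) \<le> degree g + degree f"
    and "coeff (act (nf g) f) (degree g + degree f) = lead_coeff g * lead_coeff f"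
proof -
  have Y: "degree (act (evy weyl_const weyl_Y q) f) \<le> degree f \<and>
      coeff (act (evy weyl_const weyl_Y q) f) (degree f) = q * lead_coeff f" for q :: "'k poly"
  proof (induction q)
    case (pCons c q)
    let ?h = "act (evy weyl_const weyl_Y q) f"
    have eq: "act (evy weyl_const weyl_Y (pCons c q)) f = smult [:c:] f + (smult [:0, 1:] ?h + pderiv ?h)"
      by (simp add: evy_pCons)
    have "degree (pderiv ?h) \<le> degree f"
      using pCons.IH by (intro degree_le) (auto simp: coeff_pderiv intro!: coeff_eq_0)
    moreover have "coeff (pderiv ?h) (degree f) = 0"
      using pCons.IH by (auto simp: coeff_pderiv intro: coeff_eq_0)
    ultimately show ?case unfolding eq using pCons.IH
      by (auto intro!: degree_add_le order.trans[OF degree_smult_le] simp: algebra_simps)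
  qed simp
  have "degree (act (nf g) f) \<le> degree g + degree f \<and>
    coeff (act (nf g) f) (degree g + degree f) = lead_coeff g * lead_coeff f"
  proof (induction g)
    case (pCons q g)
    have eq: "act (nf (pCons q g)) f = act (evy weyl_const weyl_Y q) f + pCons 0 (act (nf g) f)"
      by (simp add: ev_pCons)
    show ?case
    proof (cases "g = 0")
      case True
      then show ?thesis using Y[of q] unfolding eq by simp
    next
      case False
      have "degree (pCons 0 (act (nf g) f)) \<le> Suc (degree g + degree f)"
        using pCons.IH by (auto simp: degree_pCons_eq_if)
      moreover have "coeff (act (evy weyl_const weyl_Y q) f) (Suc (degree g + degree f)) = 0"
        using Y[of q] by (intro coeff_eq_0) auto
      ultimately show ?thesis using False pCons.IH Y[of q] unfolding eq
        by (auto intro!: degree_add_le)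
    qed
  qed simp
  then show "degree (act (nf g) f) \<le> degree g + degree f"
    and "coeff (act (nf g) f) (degree g + degree f) = lead_coeff g * lead_coeff f" by auto
qed

lemma lead_coeff_sym_mult:
  "coeff (sym (a * b)) (degree (sym a) + degree (sym b)) = lead_coeff (sym a) * lead_coeff (sym b)"
  using coeff_act_nf(2)[of "sym a" "sym b"] by (simp add: sym_mult)

lemma degree_sym_mult_ge:
  assumes "a \<noteq> 0" "b \<noteq> 0"
  shows "degree (sym a) \<le> degree (sym (a * b))"
proof -
  have "sym a \<noteq> 0" "sym b \<noteq> 0" using assms sym_inject[of _ 0] by auto
  then have "coeff (sym (a * b)) (degree (sym a) + degree (sym b)) \<noteq> 0"
    by (simp add: lead_coeff_sym_mult)
  then show ?thesis using le_degree by force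
qed

instance weyl :: (field) ring_1_no_zero_divisors
proof
  fix a b :: "'a weyl"
  assume "a \<noteq> 0" "b \<noteq> 0"
  then have "sym a \<noteq> 0" "sym b \<noteq> 0" using sym_inject[of _ 0] by auto
  then have "coeff (sym (a * b)) (degree (sym a) + degree (sym b)) \<noteq> 0"
    by (simp add: lead_coeff_sym_mult)
  then show "a * b \<noteq> 0" by auto
qed

lemma weyl_hom_representation:
  fixes x y :: "'k::field weyl"
  assumes "y * x = x * y + 1"
  shows "weyl_representation weyl_const x y"
  by standard (simp_all add: weyl_const_add weyl_const_mult assms weyl_const_commute[of _ x] weyl_const_commute[of _ y])

lemma weyl_commutes_all:
  assumes "a * weyl_X = weyl_X * a" "a * weyl_Y = weyl_Y * a"
  shows "a * b = b * a"
proof (induction b rule: weyl_induct)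
  case (const c) then show ?case by (simp add: weyl_const_commute)
next
  case (add b c) then show ?case by (simp add: algebra_simps)
next
  case (X b) then show ?case by (metis assms(1) mult.assoc)
next
  case (Y b) then show ?case by (metis assms(2) mult.assoc)
qed

abbreviation weyl_subst :: "'k::field weyl \<Rightarrow> 'k weyl \<Rightarrow> 'k weyl \<Rightarrow> 'k weyl" where
  "weyl_subst \<equiv> weyl_hom weyl_const"

text \<open>The Fourier transform exchanges the roles of the two degrees.\<close>

definition fourier :: "'k::field weyl \<Rightarrow> 'k weyl" where
  "fourier = weyl_subst weyl_Y (- weyl_X)"

interpretation fourier: weyl_representation weyl_const weyl_Y "- weyl_X :: 'k::field weyl"
  by (rule weyl_hom_representation) (simp add: weyl_Y_X)

text \<open>X^i Y^j becomes Y^i (-X)^j, whose part of highest degree in X is (-1)^j X^j Y^i. If E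
  bounds the degree in Y, the coefficients at Y^E therefore reappear, up to sign, at X^E; lower ones
  get mixed.\<close>

lemma cf_fourier:
  assumes "\<And>i j. j > E \<Longrightarrow> cf a i j = 0"
  shows "k > E \<Longrightarrow> cf (fourier a) k l = 0"
    and "cf (fourier a) E l = (- 1) ^ E * cf a l E"
proof -
  have X: "cf ((- weyl_X) ^ j :: 'a weyl) k l = (if k = j \<and> l = 0 then (- 1) ^ j else 0)" for j k l
  proof (induction j arbitrary: k)
    case 0
    then show ?case by (simp add: cf_1)
  next
    case (Suc j)
    then show ?case by (auto simp: cf_X)
  qed
  have Y: "(k > j \<longrightarrow> cf (weyl_Y ^ i * (- weyl_X) ^ j :: 'a weyl) k l = 0) \<and>
    cf (weyl_Y ^ i * (- weyl_X) ^ j :: 'a weyl) j l = (if l = i then (- 1) ^ j else 0)" for i j k l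
  proof (induction i arbitrary: k l)
    case (Suc i)
    then show ?case by (auto simp: cf_Y mult.assoc)
  qed (simp add: X)
  obtain N where N: "\<And>i j. i \<ge> N \<or> j \<ge> N \<Longrightarrow> cf a i j = 0" using cf_bound[of a] by blast
  have *: "fourier a = (\<Sum>i<N. \<Sum>j<Suc E. weyl_const (cf a i j) * (weyl_Y ^ i * (- weyl_X) ^ j))"
    by (subst weyl_expand[of N "Suc E" a])
      (use N assms in \<open>auto simp: fourier_def fourier.hom_sum fourier.hom_mult fourier.hom_power fourier.hom_add mult.assoc\<close>)
  show "cf (fourier a) k l = 0" if "k > E"
    unfolding * using that Y by (auto simp: cf_sum intro!: sum.neutral)
  have "cf (fourier a) E l = (\<Sum>i<N. if l = i then cf a i E * (- 1) ^ E else 0)"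
    unfolding * cf_sum
  proof (intro sum.cong refl)
    fix i
    have "(\<Sum>j<E. cf (weyl_const (cf a i j) * (weyl_Y ^ i * (- weyl_X) ^ j)) E l) = 0"
      using Y by (intro sum.neutral) auto
    then show "(\<Sum>j<Suc E. cf (weyl_const (cf a i j) * (weyl_Y ^ i * (- weyl_X) ^ j)) E l)
      = (if l = i then cf a i E * (- 1) ^ E else 0)"
      using Y by simp
  qed
  also have "\<dots> = (- 1) ^ E * cf a l E"
    using N[of l] by auto
  finally show "cf (fourier a) E l = (- 1) ^ E * cf a l E" .
qed

lemma degree_sym_le_iff: "degree (sym a) \<le> D \<longleftrightarrow> (\<forall>i>D. \<forall>j. cf a i j = 0)"
  unfolding cf_def
  by (metis coeff_0 coeff_eq_0 degree_le le_less_trans poly_eqI)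

lemma degree_sym_fourier_le_iff: "degree (sym (fourier a)) \<le> D \<longleftrightarrow> (\<forall>j>D. \<forall>i. cf a i j = 0)"
proof
  assume R: "\<forall>j>D. \<forall>i. cf a i j = 0"
  then show "degree (sym (fourier a)) \<le> D"
    unfolding degree_sym_le_iff using cf_fourier(1)[of D a] by auto
next
  assume L: "degree (sym (fourier a)) \<le> D"
  show "\<forall>j>D. \<forall>i. cf a i j = 0"
  proof (rule ccontr)
    assume "\<not> ?thesis"
    then obtain i0 j0 where ij: "j0 > D" "cf a i0 j0 \<noteq> 0" by auto
    define S where "S = {j. \<exists>i. cf a i j \<noteq> 0}"
    obtain N where N: "\<And>i j. i \<ge> N \<or> j \<ge> N \<Longrightarrow> cf a i j = 0" using cf_bound[of a] by blast
    have "S \<subseteq> {..<N}" using N by (force simp: S_def not_le)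
    then have fin: "finite S" using finite_subset by blast
    have "j0 \<in> S" using ij by (auto simp: S_def)
    define E where "E = Max S"
    have "E \<in> S" "j0 \<le> E" using fin \<open>j0 \<in> S\<close> by (auto simp: E_def intro: Max_in)
    then obtain i where i: "cf a i E \<noteq> 0" by (auto simp: S_def)
    have "cf a i j = 0" if "j > E" for i j
      using Max_ge[OF fin, of j] that by (force simp: S_def E_def)
    then have "cf (fourier a) E i = (- 1) ^ E * cf a i E" by (rule cf_fourier(2))
    then have "cf (fourier a) E i \<noteq> 0" using i by simp
    then show False using L ij \<open>j0 \<le> E\<close> unfolding degree_sym_le_iff by auto
  qed
qed

lemma fourier_eq_0_iff: "fourier a = 0 \<longleftrightarrow> a = 0"
proof
  assume F: "fourier a = 0"
  show "a = 0"
  proof (rule ccontr)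
    assume "a \<noteq> 0"
    then obtain i j where "cf a i j \<noteq> 0" using weyl_eqI[of a 0] by auto
    have "cf a i j = 0" for i j
    proof (cases j)
      case 0
      have "\<And>i j. j > 0 \<Longrightarrow> cf a i j = 0"
        using degree_sym_fourier_le_iff[of a 0] F by auto
      then have "cf (fourier a) 0 i = (- 1) ^ 0 * cf a i 0" by (rule cf_fourier(2))
      then show ?thesis using F 0 by simp
    next
      case (Suc n)
      then show ?thesis using degree_sym_fourier_le_iff[of a 0] F by auto
    qed
    then show False using \<open>cf a i j \<noteq> 0\<close> by blast
  qed
qed (simp add: fourier_def)

text \<open>The degree in X does not drop on multiplication by a nonzero element, and the Fourier
  transform gives the same for Y. In the reduced situation this confines the quotient of two known
  elements to finitely many monomials.\<close>

lemma cf_factor_bound: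
  assumes "b \<noteq> 0" "\<And>i j. i > D \<or> j > D \<Longrightarrow> cf (a * b) i j = 0" "i > D \<or> j > D"
  shows "cf a i j = 0"
proof (cases "a = 0")
  case False
  have "degree (sym a) \<le> D"
    using degree_sym_mult_ge[OF False assms(1)] degree_sym_le_iff[of "a * b" D] assms(2) by fastforce
  moreover have "degree (sym (fourier a)) \<le> D"
  proof -
    have "degree (sym (fourier (a * b))) \<le> D"
      unfolding degree_sym_fourier_le_iff using assms(2) by auto
    moreover have "fourier (a * b) = fourier a * fourier b" by (simp add: fourier_def fourier.hom_mult)
    ultimately show ?thesis
      using degree_sym_mult_ge[of "fourier a" "fourier b"] False assms(1) by (simp add: fourier_eq_0_iff)
  qed
  then have "\<forall>j>D. \<forall>i. cf a i j = 0" by (simp only: degree_sym_fourier_le_iff)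
  ultimately show ?thesis
    using assms(3) unfolding degree_sym_le_iff by auto
qed simp

section \<open>The Weyl algebra in positive characteristic\<close>

lemma commutator_simps:
  "commutator (a + b) c = commutator a c + commutator b c"
  "commutator a (b + c) = commutator a b + commutator a c"
  "commutator (a - b) c = commutator a c - commutator b c"
  "commutator a (b - c) = commutator a b - commutator a c"
  "commutator (a * b) c = a * commutator b c + commutator a c * b"
  "commutator a (b * c) = commutator a b * c + b * commutator a c"
  "commutator 0 c = 0" "commutator a 0 = 0" "commutator a a = 0" "commutator 1 c = 0" "commutator a 1 = 0"
  by (simp_all add: commutator_def algebra_simps)

lemma commutator_sum_left: "commutator (sum f A) a = (\<Sum>i\<in>A. commutator (f i) a)"
  by (induction A rule: infinite_finite_induct) (simp_all add: commutator_simps)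

section \<open>Commutators as derivations in x and y\<close>

locale weyl_relation =
  fixes x y :: "'a::ring_1"
  assumes yx: "y * x = x * y + 1"
begin

lemma y_x_power: "y * x ^ i = x ^ i * y + of_nat i * x ^ (i - 1)"
proof (induction i)
  case (Suc i)
  have "y * x ^ Suc i = x * (y * x ^ i) + x ^ i"
    by (simp add: yx algebra_simps flip: mult.assoc)
  also have "\<dots> = x ^ Suc i * y + (of_nat i * (x * x ^ (i - 1)) + x ^ i)"
    unfolding Suc by (simp add: algebra_simps mult_of_nat_commute)
  also have "of_nat i * (x * x ^ (i - 1)) = of_nat i * x ^ i"
    by (cases i) simp_all
  finally show ?case by (simp add: algebra_simps)
qed simp

lemma y_power_x: "y ^ j * x = x * y ^ j + of_nat j * y ^ (j - 1)"
proof (induction j)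
  case (Suc j)
  have "y ^ Suc j * x = y * (y ^ j * x)"
    by (simp add: mult.assoc)
  also have "\<dots> = x * y ^ Suc j + (of_nat j * (y * y ^ (j - 1)) + y ^ j)"
    unfolding Suc using yx
    by (simp add: distrib_left distrib_right add_ac flip: mult.assoc)
      (simp add: mult_of_nat_commute mult.assoc)
  also have "of_nat j * (y * y ^ (j - 1)) = of_nat j * y ^ j"
    by (cases j) simp_all
  finally show ?case by (simp add: algebra_simps)
qed simp

text \<open>Both are derivations. On ordered monomials whose coefficients commute with x and y,
  \<open>d1\<close> acts as d/dx and \<open>d2\<close> as d/dy.\<close>

definition d1 :: "'a \<Rightarrow> 'a" where "d1 a = y * a - a * y"
definition d2 :: "'a \<Rightarrow> 'a" where "d2 a = a * x - x * a"

lemma d1_sum: "(d1 ^^ n) (sum f A) = (\<Sum>i\<in>A. (d1 ^^ n) (f i))"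
proof -
  have *: "d1 (sum f A) = (\<Sum>i\<in>A. d1 (f i))" for f
    by (simp add: d1_def sum_distrib_left sum_distrib_right sum_subtractf)
  show ?thesis by (induction n) (simp_all add: *)
qed

lemma d2_sum: "(d2 ^^ n) (sum f A) = (\<Sum>i\<in>A. (d2 ^^ n) (f i))"
proof -
  have *: "d2 (sum f A) = (\<Sum>i\<in>A. d2 (f i))" for f
    by (simp add: d2_def sum_distrib_left sum_distrib_right sum_subtractf)
  show ?thesis by (induction n) (simp_all add: *)
qed

definition centralizes :: "'a \<Rightarrow> bool" where
  "centralizes w \<longleftrightarrow> w * x = x * w \<and> w * y = y * w"

lemma centralizes_power:
  assumes "centralizes w" shows "w * x ^ i = x ^ i * w" "w * y ^ j = y ^ j * w"
proof -
  show "w * x ^ i = x ^ i * w"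
    using assms by (induction i) (simp_all add: centralizes_def, metis mult.assoc)
  show "w * y ^ j = y ^ j * w"
    using assms by (induction j) (simp_all add: centralizes_def, metis mult.assoc)
qed

lemma centralizes_mult: "centralizes v \<Longrightarrow> centralizes w \<Longrightarrow> centralizes (v * w)"
  unfolding centralizes_def by (metis mult.assoc)

text \<open>The product is the falling factorial. For n > i truncated subtraction puts a factor 0
  into it, so the truncated exponent of x is harmless.\<close>

lemma d1_monom:
  assumes "centralizes w"
  shows "(d1 ^^ n) (w * x ^ i * y ^ j) = of_nat (\<Prod>k<n. i - k) * (w * x ^ (i - n) * y ^ j)"
proof (induction n)
  case (Suc n)
  have d1: "d1 (w * x ^ i * y ^ j) = of_nat i * (w * x ^ (i - 1) * y ^ j)" for i
  proof -
    have "y * (w * x ^ i * y ^ j) = w * (y * x ^ i) * y ^ j"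
      using assms by (simp add: centralizes_def flip: mult.assoc)
    also have "\<dots> = w * x ^ i * y ^ j * y + of_nat i * (w * x ^ (i - 1) * y ^ j)"
      unfolding y_x_power
      by (simp add: algebra_simps mult_of_nat_commute power_commutes)
    finally show ?thesis by (simp add: d1_def)
  qed
  have "d1 (of_nat m * a) = of_nat m * d1 a" for m a
    by (simp add: d1_def algebra_simps mult_of_nat_commute)
  then have "(d1 ^^ Suc n) (w * x ^ i * y ^ j) = of_nat (\<Prod>k<n. i - k) * d1 (w * x ^ (i - n) * y ^ j)"
    by (simp add: Suc del: of_nat_prod)
  then show ?case unfolding d1 by (simp add: mult.assoc)
qed simp

lemma d2_monom:
  assumes "centralizes w"
  shows "(d2 ^^ n) (w * y ^ j) = of_nat (\<Prod>k<n. j - k) * (w * y ^ (j - n))"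
proof (induction n)
  case (Suc n)
  have d2: "d2 (w * y ^ j) = of_nat j * (w * y ^ (j - 1))" for j
  proof -
    have "w * y ^ j * x = w * (y ^ j * x)" by (simp add: mult.assoc)
    also have "\<dots> = x * (w * y ^ j) + of_nat j * (w * y ^ (j - 1))"
      unfolding y_power_x using assms
      by (simp add: algebra_simps mult_of_nat_commute centralizes_def) (metis mult.assoc mult_of_nat_commute)
    finally show ?thesis by (simp add: d2_def)
  qed
  have "d2 (of_nat m * a) = of_nat m * d2 a" for m a
    by (simp add: d2_def algebra_simps mult_of_nat_commute)
  then have "(d2 ^^ Suc n) (w * y ^ j) = of_nat (\<Prod>k<n. j - k) * d2 (w * y ^ (j - n))"
    by (simp add: Suc del: of_nat_prod)
  then show ?case unfolding d2 by (simp add: mult.assoc)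
qed simp

lemma prod_diff_eq: "(\<Prod>k<n. n - k) = (fact n :: nat)"
  by (simp add: fact_prod_rev atLeast0LessThan)

lemma prod_diff_eq_0: "i < n \<Longrightarrow> (\<Prod>k<n. i - k) = (0 :: nat)"
  by (auto intro!: bexI[of _ i])

text \<open>A term lexicographically below (i, j) dies: its x-exponent is below i, or it equals i
  and the remaining power of y is below j. The coefficients only have to centralize x and y, so a
  centralizing element not yet known to be central may occur among them.\<close>

lemma top_coefficient:
  assumes S: "finite S" "(i, j) \<in> S"
    and top: "\<And>i' j'. (i', j') \<in> S \<Longrightarrow> i' < i \<or> (i' = i \<and> j' \<le> j)"
    and w: "\<And>s. s \<in> S \<Longrightarrow> centralizes (w s)"
  shows "(d2 ^^ j) ((d1 ^^ i) (\<Sum>s\<in>S. w s * x ^ fst s * y ^ snd s)) = of_nat (fact i * fact j) * w (i, j)"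
proof -
  have "(d2 ^^ j) ((d1 ^^ i) (w s * x ^ fst s * y ^ snd s)) =
      (if s = (i, j) then of_nat (fact i * fact j) * w (i, j) else 0)" if s: "s \<in> S" for s
  proof (cases "fst s < i")
    case True
    then have "(d1 ^^ i) (w s * x ^ fst s * y ^ snd s) = 0"
      by (simp add: d1_monom w s prod_diff_eq_0 del: of_nat_prod)
    moreover have "(d2 ^^ j) 0 = 0"
      using d2_sum[of j "\<lambda>_. 0" "{}"] by simp
    ultimately show ?thesis using True by auto
  next
    case False
    then have s': "fst s = i" "snd s \<le> j" using top[of "fst s" "snd s"] s by auto
    have "centralizes (of_nat (fact i) * w s)"
      using w[OF s] by (intro centralizes_mult) (auto simp: centralizes_def mult_of_nat_commute)
    moreover have "(d1 ^^ i) (w s * x ^ fst s * y ^ snd s) = of_nat (fact i) * w s * y ^ snd s"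
      using s' d1_monom[OF w[OF s], of i i "snd s"]
      by (simp add: prod_diff_eq mult.assoc del: of_nat_prod of_nat_fact)
    ultimately have *: "(d2 ^^ j) ((d1 ^^ i) (w s * x ^ fst s * y ^ snd s)) =
        of_nat (\<Prod>k<j. snd s - k) * (of_nat (fact i) * w s * y ^ (snd s - j))"
      using d2_monom[of "of_nat (fact i) * w s" j "snd s"] by simp
    show ?thesis
    proof (cases "snd s = j")
      case True
      then have "s = (i, j)" using s' by (simp add: prod_eq_iff)
      then show ?thesis unfolding * by (simp add: prod_diff_eq mult.assoc mult.commute[of "fact i"] del: of_nat_fact of_nat_prod)
    next
      case False
      then have "s \<noteq> (i, j)" "snd s < j" using s' False by (metis snd_conv le_neq_implies_less)+
      then show ?thesis unfolding * by (simp add: prod_diff_eq_0 del: of_nat_fact of_nat_prod)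
    qed
  qed
  then show ?thesis using S by (simp add: d1_sum d2_sum del: of_nat_fact of_nat_mult)
qed

end

lemma lex_max:
  fixes S :: "(nat \<times> nat) set"
  assumes "finite S" "S \<noteq> {}"
  obtains i j where "(i, j) \<in> S" "\<And>i' j'. (i', j') \<in> S \<Longrightarrow> i' < i \<or> (i' = i \<and> j' \<le> j)"
proof -
  define i where "i = Max (fst ` S)"
  define j where "j = Max (snd ` (S \<inter> {s. fst s = i}))"
  have "i \<in> fst ` S" unfolding i_def using assms by (intro Max_in) auto
  then have "snd ` (S \<inter> {s. fst s = i}) \<noteq> {}" by auto
  then have "j \<in> snd ` (S \<inter> {s. fst s = i})" unfolding j_def using assms by (intro Max_in) auto
  then have "(i, j) \<in> S" by auto
  moreover have "i' < i \<or> (i' = i \<and> j' \<le> j)" if "(i', j') \<in> S" for i' j'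
  proof -
    have "i' \<le> i" unfolding i_def using assms that by (intro Max_ge) (auto intro: rev_image_eqI)
    moreover have "j' \<le> j" if "i' = i"
      unfolding j_def using assms that \<open>(i', j') \<in> S\<close> by (intro Max_ge) (auto intro: rev_image_eqI)
    ultimately show ?thesis by auto
  qed
  ultimately show ?thesis using that by blast
qed

section \<open>Splitting exponents modulo p\<close>

lemma poly_poly_exists:
  fixes h :: "nat \<Rightarrow> nat \<Rightarrow> 'a::comm_monoid_add"
  assumes "\<And>a b. a \<ge> N \<or> b \<ge> N \<Longrightarrow> h a b = 0"
  shows "\<exists>g. \<forall>a b. coeff (coeff g a) b = h a b"
proof (intro exI allI)
  fix a b
  have "coeff (coeff (\<Sum>a<N. monom (\<Sum>b<N. monom (h a b) b) a) a) b =
      (\<Sum>a'<N. if a' = a then coeff (\<Sum>b<N. monom (h a' b) b) b else 0)"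
    by (simp add: coeff_sum if_distrib[of "\<lambda>q. coeff q b"] cong: if_cong)
  also have "\<dots> = h a b"
    using assms[of a b] by (auto simp: coeff_sum not_less)
  finally show "coeff (coeff (\<Sum>a<N. monom (\<Sum>b<N. monom (h a b) b) a) a) b = h a b" .
qed

text \<open>The monomials of f whose exponents are congruent to \<open>s\<close> modulo p, with the
  quotients as new exponents. The coefficients determine the polynomial, so the choice is
  unique.\<close>

definition sect :: "nat \<Rightarrow> 'a::comm_monoid_add poly poly \<Rightarrow> nat \<times> nat \<Rightarrow> 'a poly poly" where
  "sect p f s = (SOME g. \<forall>a b. coeff (coeff g a) b = coeff (coeff f (a * p + fst s)) (b * p + snd s))"

lemma coeff_sect:
  assumes "p > 0"
  shows "coeff (coeff (sect p f s) a) b = coeff (coeff f (a * p + fst s)) (b * p + snd s)"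
proof -
  obtain N where N: "\<And>i j. i \<ge> N \<or> j \<ge> N \<Longrightarrow> coeff (coeff f i) j = 0"
    using poly_poly_bound[of f] by blast
  have le: "N \<le> a * p + k" if "N \<le> a" for a k
    using that assms by (metis le_add1 le_trans mult_le_mono2 nat_mult_1_right Suc_leI One_nat_def)
  have "\<exists>g. \<forall>a b. coeff (coeff g a) b = coeff (coeff f (a * p + fst s)) (b * p + snd s)"
    by (rule poly_poly_exists[of N]) (use N le in auto)
  from someI_ex[OF this] show ?thesis unfolding sect_def by blast
qed

lemma sum_lessThan_mult: "(\<Sum>m<N * p. F m) = (\<Sum>a<N. \<Sum>i<p. F (a * p + i :: nat))"
proof -
  have *: "(\<Sum>m<n + q. F m) = (\<Sum>m<n. F m) + (\<Sum>i<q. F (n + i))" for n q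
    by (induction q) (simp_all add: add.assoc)
  show ?thesis
    by (induction N) (simp_all add: *[of "_ * p" p] add.commute[of p])
qed

locale central_hom =
  fixes \<kappa> :: "'k::field \<Rightarrow> 'b::ring_1"
  assumes \<kappa>_1 [simp]: "\<kappa> 1 = 1"
    and \<kappa>_add: "\<kappa> (c + d) = \<kappa> c + \<kappa> d"
    and \<kappa>_mult: "\<kappa> (c * d) = \<kappa> c * \<kappa> d"
    and \<kappa>_commute: "\<kappa> c * b = b * \<kappa> c"
begin

lemma \<kappa>_0 [simp]: "\<kappa> 0 = 0"
  using \<kappa>_add[of 0 0] by simp

lemmas ev_simps = ev_pCons evy_pCons[of \<kappa>, OF \<kappa>_0]

lemma ev_plus: "ev \<kappa> x y (f + g) = ev \<kappa> x y f + ev \<kappa> x y g"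
  by (simp add: ev_add \<kappa>_add)

lemma ev_uminus: "ev \<kappa> x y (- f) = - ev \<kappa> x y f"
  using ev_plus[of x y f "- f"] by (simp add: eq_neg_iff_add_eq_0 add.commute)

lemma ev_diff: "ev \<kappa> x y (f - g) = ev \<kappa> x y f - ev \<kappa> x y g"
  using ev_plus[of x y f "- g"] by (simp add: ev_uminus)

lemma ev_setsum: "ev \<kappa> x y (sum f A) = (\<Sum>i\<in>A. ev \<kappa> x y (f i))"
  by (induction A rule: infinite_finite_induct) (simp_all add: ev_plus)

lemma ev_1 [simp]: "ev \<kappa> x y 1 = 1"
  by (simp add: one_pCons ev_simps)

lemma ev_const [simp]: "ev \<kappa> x y [:[:c:]:] = \<kappa> c"
  by (simp add: ev_simps)

lemma evy_commute:
  assumes "z * y = y * z"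
  shows "z * evy \<kappa> y q = evy \<kappa> y q * z"
proof (induction q)
  case (pCons c q)
  have "z * (y * evy \<kappa> y q) = y * evy \<kappa> y q * z"
    by (metis assms pCons.IH mult.assoc)
  then show ?case by (simp add: ev_simps algebra_simps \<kappa>_commute[of c z])
qed simp

lemma ev_commute:
  assumes "z * x = x * z" "z * y = y * z"
  shows "z * ev \<kappa> x y f = ev \<kappa> x y f * z"
proof (induction f)
  case (pCons q f)
  have "z * (x * ev \<kappa> x y f) = x * ev \<kappa> x y f * z"
    by (metis assms(1) pCons.IH mult.assoc)
  then show ?case by (simp add: ev_simps algebra_simps evy_commute[OF assms(2)])
qed simp

lemma evy_smult: "evy \<kappa> y (smult c q) = \<kappa> c * evy \<kappa> y q"
proof (induction q)
  case (pCons d q)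
  have "y * (\<kappa> c * evy \<kappa> y q) = \<kappa> c * (y * evy \<kappa> y q)"
    by (metis \<kappa>_commute mult.assoc)
  then show ?case by (simp add: ev_simps pCons.IH \<kappa>_mult algebra_simps)
qed simp

lemma evy_mult: "evy \<kappa> y (q * r) = evy \<kappa> y q * evy \<kappa> y r"
  by (induction q) (simp_all add: ev_simps evy_add \<kappa>_add evy_smult algebra_simps)

lemma ev_smult:
  assumes "x * y = y * x"
  shows "ev \<kappa> x y (smult q f) = evy \<kappa> y q * ev \<kappa> x y f"
proof (induction f)
  case (pCons r f)
  have "x * (evy \<kappa> y q * ev \<kappa> x y f) = evy \<kappa> y q * (x * ev \<kappa> x y f)"
    by (metis evy_commute[OF assms] mult.assoc)
  then show ?case by (simp add: ev_simps pCons.IH evy_mult algebra_simps)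
qed simp

lemma ev_mult:
  assumes "x * y = y * x"
  shows "ev \<kappa> x y (f * g) = ev \<kappa> x y f * ev \<kappa> x y g"
  by (induction f) (simp_all add: ev_simps ev_plus ev_smult[OF assms] algebra_simps)

end

abbreviation evc :: "'k::field weyl \<Rightarrow> 'k weyl \<Rightarrow> 'k poly poly \<Rightarrow> 'k weyl" where
  "evc \<equiv> ev weyl_const"

interpretation weyl_const: central_hom weyl_const
proof
  show "weyl_const c * b = b * weyl_const c" for c :: 'a and b :: "'a weyl"
    by (rule weyl_const_commute)
qed (simp_all add: weyl_const_add weyl_const_mult)

lemmas evc_simps = weyl_const.ev_simps and evc_add = weyl_const.ev_plus
  and evc_diff = weyl_const.ev_diff and evc_uminus = weyl_const.ev_uminus
  and evc_sum = weyl_const.ev_setsum and evc_commute = weyl_const.ev_commute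
  and evc_mult = weyl_const.ev_mult

text \<open>Moving powers of y^p to the left past x^i is the only commutation needed to regroup x^(a
  p + i) y^(b p + j).\<close>

lemma evc_sections:
  assumes "p > 0" "y ^ p * x = x * y ^ p"
  shows "evc x y f = (\<Sum>s\<in>{..<p} \<times> {..<p}. evc (x ^ p) (y ^ p) (sect p f s) * x ^ fst s * y ^ snd s)"
proof -
  obtain N where N: "\<And>i j. i \<ge> N \<or> j \<ge> N \<Longrightarrow> coeff (coeff f i) j = 0"
    using poly_poly_bound[of f] by blast
  have le: "N \<le> a * p + k" if "N \<le> a" for a k
    using that assms by (metis le_add1 le_trans mult_le_mono2 nat_mult_1_right Suc_leI One_nat_def)
  have pow: "(y ^ p) ^ b * x ^ i = x ^ i * (y ^ p) ^ b" for b i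
    by (metis assms(2) power_commuting_commutes)
  have mon: "weyl_const c * (x ^ p) ^ a * (y ^ p) ^ b * x ^ i * y ^ j =
      weyl_const c * x ^ (a * p + i) * y ^ (b * p + j)" for a b c i j
  proof -
    have "weyl_const c * (x ^ p) ^ a * (y ^ p) ^ b * x ^ i * y ^ j =
      weyl_const c * (x ^ p) ^ a * x ^ i * (y ^ p) ^ b * y ^ j"
      by (simp add: mult.assoc pow)
    also have "\<dots> = weyl_const c * x ^ (a * p + i) * y ^ (b * p + j)"
      by (simp add: power_add mult.assoc mult.commute[of _ p] flip: power_mult)
    finally show ?thesis .
  qed
  have g: "evc (x ^ p) (y ^ p) (sect p f s) =
      (\<Sum>a<N. \<Sum>b<N. weyl_const (coeff (coeff f (a * p + fst s)) (b * p + snd s)) * (x ^ p) ^ a * (y ^ p) ^ b)" for s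
    by (subst ev_sum[where N = N and M = N])
      (use N le in \<open>auto simp: coeff_sect assms(1) weyl_const_commute\<close>)
  have p_le: "N * p \<le> m \<Longrightarrow> N \<le> m" for m
    using assms(1) by (metis le_trans mult_le_mono2 nat_mult_1_right Suc_leI One_nat_def)
  have N': "coeff (coeff f i) j = 0" if "N * p \<le> i \<or> N * p \<le> j" for i j
    using N[of i j] that p_le by auto
  have "evc x y f = (\<Sum>m<N * p. \<Sum>n<N * p. weyl_const (coeff (coeff f m) n) * x ^ m * y ^ n)"
    by (rule ev_sum) (use N' in \<open>auto simp: weyl_const_commute\<close>)
  also have "\<dots> = (\<Sum>a<N. \<Sum>i<p. \<Sum>b<N. \<Sum>j<p.
      weyl_const (coeff (coeff f (a * p + i)) (b * p + j)) * x ^ (a * p + i) * y ^ (b * p + j))"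
    unfolding sum_lessThan_mult ..
  also have "\<dots> = (\<Sum>i<p. \<Sum>j<p. \<Sum>a<N. \<Sum>b<N.
      weyl_const (coeff (coeff f (a * p + i)) (b * p + j)) * x ^ (a * p + i) * y ^ (b * p + j))"
  proof -
    have "(\<Sum>a<N. \<Sum>i<p. \<Sum>b<N. \<Sum>j<p. F a i b j) = (\<Sum>i<p. \<Sum>j<p. \<Sum>a<N. \<Sum>b<N. F a i b j)"
      for F :: "_ \<Rightarrow> _ \<Rightarrow> _ \<Rightarrow> _ \<Rightarrow> 'a weyl"
    proof -
      have "(\<Sum>a<N. \<Sum>i<p. \<Sum>b<N. \<Sum>j<p. F a i b j) = (\<Sum>i<p. \<Sum>a<N. \<Sum>b<N. \<Sum>j<p. F a i b j)"
        by (rule sum.swap)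
      also have "\<dots> = (\<Sum>i<p. \<Sum>a<N. \<Sum>j<p. \<Sum>b<N. F a i b j)"
        by (intro sum.cong refl sum.swap)
      also have "\<dots> = (\<Sum>i<p. \<Sum>j<p. \<Sum>a<N. \<Sum>b<N. F a i b j)"
        by (intro sum.cong refl sum.swap)
      finally show ?thesis .
    qed
    then show ?thesis .
  qed
  also have "\<dots> = (\<Sum>i<p. \<Sum>j<p. evc (x ^ p) (y ^ p) (sect p f (i, j)) * x ^ i * y ^ j)"
    by (simp add: g sum_distrib_right mon)
  also have "\<dots> = (\<Sum>s\<in>{..<p} \<times> {..<p}. evc (x ^ p) (y ^ p) (sect p f s) * x ^ fst s * y ^ snd s)"
    by (simp add: sum.cartesian_product case_prod_unfold)
  finally show ?thesis .
qed

text \<open>Linear algebra over a polynomial ring acting through commuting x and y. The relation is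
  nontrivial in its polynomials \<open>c i\<close>; their values are only known to be nonzero once
  evaluation is injective.\<close>

lemma evc_dependence:
  fixes e :: "'i \<Rightarrow> 'k::field weyl"
  assumes "x * y = y * x" "finite J" "finite I" "card J < card I"
    and "\<And>i. i \<in> I \<Longrightarrow> \<exists>z. e i = (\<Sum>j\<in>J. evc x y (z j) * b j)"
  shows "\<exists>c. (\<exists>i\<in>I. c i \<noteq> 0) \<and> (\<Sum>i\<in>I. evc x y (c i) * e i) = 0"
proof -
  obtain M where M: "\<And>i. i \<in> I \<Longrightarrow> e i = (\<Sum>j\<in>J. evc x y (M i j) * b j)"
    using assms(5) by metis
  obtain c where c: "\<exists>i\<in>I. c i \<noteq> 0" "\<And>j. j \<in> J \<Longrightarrow> (\<Sum>i\<in>I. c i * M i j) = 0"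
    using linear_dependence[OF assms(2-4), of M] by blast
  have "(\<Sum>i\<in>I. evc x y (c i) * e i) = (\<Sum>i\<in>I. \<Sum>j\<in>J. evc x y (c i * M i j) * b j)"
    by (simp add: M sum_distrib_left evc_mult[OF assms(1)] mult.assoc)
  also have "\<dots> = (\<Sum>j\<in>J. evc x y (\<Sum>i\<in>I. c i * M i j) * b j)"
    by (subst sum.swap) (simp add: evc_sum sum_distrib_right)
  also have "\<dots> = 0" using c(2) by simp
  finally show ?thesis using c(1) by blast
qed

section \<open>The Weyl algebra as a module over its centre\<close>

lemma weyl_const_eq_0_iff: "weyl_const c = 0 \<longleftrightarrow> c = 0"
  using cf_const[of c 0 0] by auto

text \<open>In positive characteristic this parametrizes the centre by polynomials in X^p and
  Y^p.\<close>

definition zeta :: "'k::field poly poly \<Rightarrow> 'k weyl" where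
  "zeta = evc (weyl_X ^ CHAR('k)) (weyl_Y ^ CHAR('k))"

locale weyl_pair = weyl_relation x y for x y :: "'k::field weyl" +
  fixes p :: nat
  assumes char: "CHAR('k) = p" and p_pos: "p > 0"
begin

abbreviation "box \<equiv> {..<p} \<times> {..<p}"
abbreviation "box_sum w \<equiv> \<Sum>s\<in>box. w s * x ^ fst s * y ^ snd s"

lemma of_nat_weyl_eq_0_iff: "of_nat n = (0 :: 'k weyl) \<longleftrightarrow> p dvd n"
proof -
  have "of_nat n = (0 :: 'k weyl) \<longleftrightarrow> (of_nat n :: 'k) = 0"
    by (simp only: weyl_const_of_nat[symmetric] weyl_const_eq_0_iff)
  then show ?thesis by (simp add: of_nat_eq_0_iff_char_dvd char)
qed

lemma fact_nonzero: "i < p \<Longrightarrow> j < p \<Longrightarrow> \<not> p dvd fact i * fact j"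
proof -
  have "prime p" using prime_CHAR_semidom[where 'a = 'k] p_pos char by simp
  then show "\<not> p dvd fact i * fact j" if "i < p" "j < p"
    using that by (simp add: prime_dvd_mult_iff prime_dvd_fact_iff)
qed

lemma centralizes_pth_powers: "centralizes (x ^ p)" "centralizes (y ^ p)"
proof -
  have 0: "of_nat p = (0 :: 'k weyl)" by (simp only: of_nat_weyl_eq_0_iff dvd_refl)
  show "centralizes (x ^ p)" "centralizes (y ^ p)"
    using y_x_power[of p] y_power_x[of p] 0
    by (simp_all add: centralizes_def power_commutes)
qed

lemma funpow_0: "(d2 ^^ j) ((d1 ^^ i) 0) = 0"
  using d1_sum[of i "\<lambda>_. 0" "{}"] d2_sum[of j "\<lambda>_. 0" "{}"] by simp

text \<open>\<open>top_coefficient\<close> is applied to the lexicographically largest nonzero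
  coefficient; exponents below p keep the factor i! j! invertible.\<close>

lemma box_independent:
  assumes "\<And>s. s \<in> box \<Longrightarrow> centralizes (w s)"
    and "box_sum (\<lambda>s. w s) = 0" "s \<in> box"
  shows "w s = 0"
proof (rule ccontr)
  assume nz: "w s \<noteq> 0"
  define S where "S = {s\<in>box. w s \<noteq> 0}"
  have S: "finite S" "S \<noteq> {}" "S \<subseteq> box" using nz assms(3) by (auto simp: S_def)
  obtain i j where ij: "(i, j) \<in> S" "\<And>i' j'. (i', j') \<in> S \<Longrightarrow> i' < i \<or> (i' = i \<and> j' \<le> j)"
    using lex_max[OF S(1,2)] by blast
  have "(\<Sum>s\<in>S. w s * x ^ fst s * y ^ snd s) = box_sum (\<lambda>s. w s)"
    by (intro sum.mono_neutral_left) (auto simp: S_def)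
  then have "of_nat (fact i * fact j) * w (i, j) = 0"
    using top_coefficient[OF S(1) ij(1), of w] ij(2) assms(1,2) S(3) funpow_0 by force
  moreover have "\<not> p dvd fact i * fact j" using ij(1) by (intro fact_nonzero) (auto simp: S_def)
  ultimately show False using ij(1) of_nat_weyl_eq_0_iff by (auto simp: S_def simp del: of_nat_mult)
qed

text \<open>The generators are such a pair themselves, so everything shown for x and y is also
  available for X and Y.\<close>

sublocale XY: weyl_pair "weyl_X :: 'k weyl" weyl_Y p
  by standard (simp_all add: weyl_Y_X char p_pos)

lemma zeta_altdef: "zeta = evc (weyl_X ^ p) (weyl_Y ^ p :: 'k weyl)"
  by (simp add: zeta_def char)

lemma commute_XY: "weyl_X ^ p * weyl_Y ^ p = weyl_Y ^ p * (weyl_X ^ p :: 'k weyl)"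
  using XY.centralizes_power(2)[OF XY.centralizes_pth_powers(1)] .

lemma zeta_simps:
  "zeta (f * g) = zeta f * (zeta g :: 'k weyl)" "zeta (f + g) = zeta f + (zeta g :: 'k weyl)"
  "zeta (f - g) = zeta f - (zeta g :: 'k weyl)" "zeta (- f) = - (zeta f :: 'k weyl)"
  "zeta 0 = (0 :: 'k weyl)" "zeta 1 = (1 :: 'k weyl)" "zeta [:[:c:]:] = (weyl_const c :: 'k weyl)"
  by (simp_all add: zeta_altdef evc_add evc_diff evc_uminus evc_mult commute_XY)

lemma zeta_central: "zeta f * a = a * (zeta f :: 'k weyl)"
proof (rule weyl_commutes_all)
  show "zeta f * weyl_X = weyl_X * (zeta f :: 'k weyl)" "zeta f * weyl_Y = weyl_Y * (zeta f :: 'k weyl)"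
    unfolding zeta_altdef using XY.centralizes_pth_powers
    by (auto simp: XY.centralizes_def intro!: evc_commute[symmetric])
qed

lemma centralizes_zeta: "centralizes (zeta f)"
  by (simp add: centralizes_def zeta_central)

lemma XY_basis:
  "\<exists>z. a = (\<Sum>s\<in>box. zeta (z s) * weyl_X ^ fst s * weyl_Y ^ snd s)" for a :: "'k weyl"
proof -
  have "weyl_Y ^ p * weyl_X = weyl_X * (weyl_Y ^ p :: 'k weyl)"
    using XY.centralizes_pth_powers(2) by (simp add: XY.centralizes_def)
  from evc_sections[OF p_pos this, of "sym a"] show ?thesis
    by (intro exI[of _ "sect p (sym a)"]) (simp add: zeta_altdef)
qed

lemma cf_zeta: "cf (zeta f :: 'k weyl) (i * p) (j * p) = coeff (coeff f i) j"
proof -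
  obtain N where N: "\<And>i j. i \<ge> N \<or> j \<ge> N \<Longrightarrow> coeff (coeff f i) j = 0"
    using poly_poly_bound[of f] by blast
  have "zeta f = (\<Sum>a<N. \<Sum>b<N. weyl_const (coeff (coeff f a) b) * (weyl_X ^ p) ^ a * (weyl_Y ^ p) ^ b :: 'k weyl)"
    unfolding zeta_altdef by (rule ev_sum) (use N in \<open>auto simp: weyl_const_commute\<close>)
  also have "\<dots> = (\<Sum>a<N. \<Sum>b<N. weyl_const (coeff (coeff f a) b) * (weyl_X ^ (a * p) * weyl_Y ^ (b * p)))"
    by (simp add: mult.assoc mult.commute[of _ p] flip: power_mult)
  finally have "cf (zeta f :: 'k weyl) (i * p) (j * p) =
      (\<Sum>a<N. \<Sum>b<N. coeff (coeff f a) b * (if i = a \<and> j = b then 1 else 0))"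
    using p_pos by (simp add: cf_sum cf_monom)
  also have "\<dots> = (\<Sum>a<N. \<Sum>b<N. if i = a then (if j = b then coeff (coeff f a) b else 0) else 0)"
    by (intro sum.cong) auto
  also have "\<dots> = (\<Sum>a<N. if i = a then (\<Sum>b<N. if j = b then coeff (coeff f a) b else 0) else 0)"
    by (intro sum.cong) auto
  also have "\<dots> = coeff (coeff f i) j"
    using N[of i j] by (auto simp: not_less)
  finally show ?thesis .
qed

lemma zeta_eq_0_iff: "zeta f = (0 :: 'k weyl) \<longleftrightarrow> f = 0"
proof
  assume "zeta f = (0 :: 'k weyl)"
  then show "f = 0" by (intro poly_eqI) (simp flip: cf_zeta)
qed (simp add: zeta_simps)

lemma zeta_eq_iff: "zeta f = (zeta g :: 'k weyl) \<longleftrightarrow> f = g"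
  using zeta_eq_0_iff[of "f - g"] by (simp add: zeta_simps)

text \<open>In the coordinates with respect to X^i Y^j, multiplication by \<open>zeta d\<close> acts
  on each coordinate separately, so w has none outside (0, 0). Divisibility found in the Weyl
  algebra thus descends to the centre.\<close>

lemma zeta_saturated:
  fixes w :: "'k weyl"
  assumes "d \<noteq> 0" "zeta d * w = zeta e"
  shows "\<exists>e'. w = zeta e' \<and> d * e' = e"
proof -
  obtain z where z: "w = (\<Sum>s\<in>box. zeta (z s) * weyl_X ^ fst s * weyl_Y ^ snd s)"
    using XY_basis by blast
  have box0: "(0, 0) \<in> box" using p_pos by simp
  define v where "v s = zeta (d * z s) - (if s = (0, 0) then zeta e else 0 :: 'k weyl)" for s
  have "(\<Sum>s\<in>box. v s * weyl_X ^ fst s * weyl_Y ^ snd s) = zeta d * w -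
      (\<Sum>s\<in>box. if s = (0, 0) then zeta e * weyl_X ^ fst s * weyl_Y ^ snd s else 0)"
    unfolding z v_def
    by (simp add: sum_distrib_left zeta_simps mult.assoc left_diff_distrib sum_subtractf if_distrib[of "\<lambda>a. a * _"]
        cong: if_cong)
  also have "(\<Sum>s\<in>box. if s = (0, 0) then zeta e * weyl_X ^ fst s * weyl_Y ^ snd s else 0) = zeta e"
    using box0 by (subst sum.delta) auto
  finally have 0: "(\<Sum>s\<in>box. v s * weyl_X ^ fst s * weyl_Y ^ snd s) = 0"
    using assms(2) by simp
  have v0: "v s = 0" if "s \<in> box" for s
    by (rule XY.box_independent[OF _ 0 that])
      (auto simp: v_def XY.centralizes_def zeta_central left_diff_distrib right_diff_distrib)
  have "z s = 0" if "s \<in> box" "s \<noteq> (0, 0)" for s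
    using v0[OF that(1)] that(2) assms(1) by (simp add: v_def zeta_eq_0_iff)
  then have "w = (\<Sum>s\<in>box. if s = (0, 0) then zeta (z (0, 0)) else 0)"
    unfolding z by (intro sum.cong) (auto simp: zeta_simps)
  then have "w = zeta (z (0, 0))" using box0 by (simp add: sum.delta)
  moreover have "d * z (0, 0) = e"
    using v0[OF box0] by (simp add: v_def zeta_eq_iff)
  ultimately show ?thesis by blast
qed

end

context weyl_pair
begin

text \<open>The element w, with index \<open>None\<close>, and the p^2 monomials x^i y^j are p^2 + 1
  elements of a module spanned by p^2 elements over the centre.\<close>

lemma zeta_dependence:
  fixes w :: "'k weyl"
  obtains d z where "d \<noteq> 0 \<or> (\<exists>s\<in>box. z s \<noteq> 0)"
    "zeta d * w = box_sum (\<lambda>s. zeta (z s))"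
proof -
  define e where "e i = (case i of None \<Rightarrow> w | Some s \<Rightarrow> x ^ fst s * y ^ snd s)" for i
  define I where "I = insert None (Some ` box)"
  have I: "finite I" "None \<notin> Some ` box" by (auto simp: I_def)
  have "card I = Suc (card box)"
    unfolding I_def by (simp add: card_image)
  then have card: "card box < card I" by simp
  have bas: "\<exists>z. e i = (\<Sum>s\<in>box. evc (weyl_X ^ p) (weyl_Y ^ p) (z s) * (weyl_X ^ fst s * weyl_Y ^ snd s))" for i
    using XY_basis[of "e i"] by (simp add: zeta_altdef mult.assoc)
  obtain c where c: "\<exists>i\<in>I. c i \<noteq> 0" "(\<Sum>i\<in>I. zeta (c i) * e i) = 0"
    using evc_dependence[OF commute_XY _ I(1) card, of e, OF _ bas] unfolding zeta_altdef by auto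
  have "(\<Sum>i\<in>I. zeta (c i) * e i) = zeta (c None) * w + box_sum (\<lambda>s. zeta (c (Some s)))"
    using I unfolding I_def by (simp add: sum.reindex e_def mult.assoc)
  then have "zeta (c None) * w = box_sum (\<lambda>s. zeta (- c (Some s)))"
    using c(2) by (simp add: eq_neg_iff_add_eq_0 zeta_simps sum_negf)
  moreover have "c None \<noteq> 0 \<or> (\<exists>s\<in>box. - c (Some s) \<noteq> 0)"
    using c(1) unfolding I_def by auto
  ultimately show ?thesis by (intro that[of "c None" "\<lambda>s. - c (Some s)"])
qed

lemma zeta_box_independent:
  assumes "box_sum (\<lambda>s. zeta (z s)) = 0" "s \<in> box"
  shows "z s = 0"
  using box_independent[of "\<lambda>s. zeta (z s)", OF _ assms] by (simp add: centralizes_zeta zeta_eq_0_iff)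

text \<open>
  Over the centre, \<open>A\<^sub>1\<close> is free of rank \<open>p\<^sup>2\<close>, so \<open>w\<close> depends linearly on the \<open>p\<^sup>2\<close> monomials in
  \<open>x\<close> and \<open>y\<close>; but these are independent even over the centralizer of \<open>x\<close> and \<open>y\<close>.
\<close>

lemma centralizer_eq_centre:
  assumes "centralizes w"
  shows "\<exists>f. w = zeta f"
proof -
  obtain d z where dz: "d \<noteq> 0 \<or> (\<exists>s\<in>box. z s \<noteq> 0)"
    "zeta d * w = box_sum (\<lambda>s. zeta (z s))"
    by (rule zeta_dependence)
  have d: "d \<noteq> 0"
    using zeta_box_independent[of z] dz by (auto simp: zeta_simps)
  have box0: "(0, 0) \<in> box" using p_pos by simp
  define v where "v s = zeta (z s) - (if s = (0, 0) then zeta d * w else 0)" for s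
  have "box_sum (\<lambda>s. v s) = zeta d * w -
      (\<Sum>s\<in>box. if s = (0, 0) then zeta d * w * x ^ fst s * y ^ snd s else 0)"
    unfolding v_def dz(2)
    by (simp add: left_diff_distrib sum_subtractf if_distrib[of "\<lambda>a. a * _"] cong: if_cong)
  also have "(\<Sum>s\<in>box. if s = (0, 0) then zeta d * w * x ^ fst s * y ^ snd s else 0) = zeta d * w"
    using box0 by (subst sum.delta) auto
  finally have "box_sum (\<lambda>s. v s) = 0" by simp
  moreover have "centralizes (v s)" for s
    using centralizes_mult[OF centralizes_zeta assms] centralizes_zeta
    by (auto simp: v_def centralizes_def left_diff_distrib right_diff_distrib)
  ultimately have "v (0, 0) = 0" using box_independent[of v] box0 by blast
  then show ?thesis using zeta_saturated[OF d, of w "z (0, 0)"] by (auto simp: v_def)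
qed

text \<open>A nonzero central multiple of a lies in the span. Its lexicographically largest
  coordinate is extracted by derivations, which commute with central factors, so it is divisible by
  d. Subtracting the corresponding term leaves fewer coordinates.\<close>

lemma box_basis: "\<exists>z. a = box_sum (\<lambda>s. zeta (z s))"
proof -
  obtain d z where dz: "d \<noteq> 0 \<or> (\<exists>s\<in>box. z s \<noteq> 0)"
    "zeta d * a = box_sum (\<lambda>s. zeta (z s))"
    by (rule zeta_dependence)
  have d: "d \<noteq> 0"
    using zeta_box_independent[of z] dz by (auto simp: zeta_simps)
  show ?thesis using dz(2)
  proof (induction "card {s\<in>box. z s \<noteq> 0}" arbitrary: a z rule: less_induct)
    case less
    define S where "S = {s\<in>box. z s \<noteq> 0}"
    have S: "finite S" "S \<subseteq> box" by (auto simp: S_def)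
    have eq: "zeta d * a = (\<Sum>s\<in>S. zeta (z s) * x ^ fst s * y ^ snd s)"
      unfolding less.prems by (intro sum.mono_neutral_right) (auto simp: S_def zeta_simps)
    show ?case
    proof (cases "S = {}")
      case True
      then have "zeta d * a = 0" using eq by simp
      then have "a = 0" using d by (simp add: zeta_eq_0_iff)
      then show ?thesis by (intro exI[of _ "\<lambda>_. 0"]) (simp add: zeta_simps)
    next
      case False
      obtain i j where ij: "(i, j) \<in> S" "\<And>i' j'. (i', j') \<in> S \<Longrightarrow> i' < i \<or> (i' = i \<and> j' \<le> j)"
        using lex_max[OF S(1) False] by blast
      have zl: "v * (zeta d * b) = zeta d * (v * b)" for v b
        by (metis mult.assoc zeta_central)
      have D1: "(d1 ^^ n) (zeta d * b) = zeta d * (d1 ^^ n) b" for n b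
        by (induction n) (simp_all add: d1_def right_diff_distrib zl mult.assoc)
      have D2: "(d2 ^^ n) (zeta d * b) = zeta d * (d2 ^^ n) b" for n b
        by (induction n) (simp_all add: d2_def right_diff_distrib zl mult.assoc)
      define n where "n = (fact i * fact j :: nat)"
      have n: "\<not> p dvd n" using ij(1) unfolding n_def by (intro fact_nonzero) (auto simp: S_def)
      then have n0: "(of_nat n :: 'k) \<noteq> 0" by (simp add: of_nat_eq_0_iff_char_dvd char)
      \<comment> \<open>The inverse of i! j! as a central constant, to remove the factor left by
        differentiation.\<close>
      define e where "e = [:[:inverse (of_nat n :: 'k):]:]"
      have ne: "zeta e * of_nat n = (1 :: 'k weyl)"
        using n0 by (simp add: e_def zeta_simps flip: weyl_const_of_nat weyl_const_mult)
      have "(d2 ^^ j) ((d1 ^^ i) (\<Sum>s\<in>S. zeta (z s) * x ^ fst s * y ^ snd s)) = of_nat n * zeta (z (i, j))"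
        unfolding n_def by (rule top_coefficient[OF S(1) ij(1) _ centralizes_zeta]) (rule ij(2))
      then have "zeta d * (d2 ^^ j) ((d1 ^^ i) a) = of_nat n * zeta (z (i, j))"
        by (simp only: eq[symmetric] D1 D2)
      then have "zeta d * (zeta e * (d2 ^^ j) ((d1 ^^ i) a)) = zeta e * (of_nat n * zeta (z (i, j)))"
        by (simp only: zl[symmetric])
      also have "\<dots> = zeta (z (i, j))"
        by (simp only: mult.assoc[symmetric] ne mult_1_left)
      finally have "zeta d * (zeta e * (d2 ^^ j) ((d1 ^^ i) a)) = zeta (z (i, j))" .
      then obtain e' where e': "d * e' = z (i, j)"
        using zeta_saturated[OF d] by blast
      define b where "b = a - zeta e' * x ^ i * y ^ j"
      define z' where "z' = z((i, j) := 0)"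
      have ijbox: "(i, j) \<in> box" using ij(1) S(2) by blast
      have zb: "zeta d * b = box_sum (\<lambda>s. zeta (z' s))"
      proof -
        have "box_sum (\<lambda>s. zeta (z s)) =
            zeta (z (i, j)) * x ^ i * y ^ j + box_sum (\<lambda>s. zeta (z' s))"
          using ijbox by (simp add: sum.remove[of _ "(i, j)"] z'_def zeta_simps cong: sum.cong_simp)
        then show ?thesis unfolding b_def
          by (simp add: right_diff_distrib less.prems zeta_simps mult.assoc flip: e')
      qed
      have "{s\<in>box. z' s \<noteq> 0} = S - {(i, j)}"
        by (auto simp: z'_def S_def)
      then have "card {s\<in>box. z' s \<noteq> 0} < card {s\<in>box. z s \<noteq> 0}"
        using card_Diff1_less[OF S(1) ij(1)] unfolding S_def by simp
      from less.hyps[OF this zb] obtain w where w: "b = box_sum (\<lambda>s. zeta (w s))" by blast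
      have "(\<Sum>s\<in>box. if s = (i, j) then zeta e' * x ^ fst s * y ^ snd s else 0) = zeta e' * x ^ i * y ^ j"
        using ijbox by (subst sum.delta) auto
      then have "a = box_sum (\<lambda>s. zeta (w s)) +
          (\<Sum>s\<in>box. if s = (i, j) then zeta e' * x ^ fst s * y ^ snd s else 0)"
        using w by (simp add: b_def algebra_simps)
      also have "\<dots> = box_sum (\<lambda>s. zeta (w s + (if s = (i, j) then e' else 0)))"
        unfolding sum.distrib[symmetric] by (intro sum.cong refl) (auto simp: zeta_simps distrib_right)
      finally show ?thesis by (intro exI)
    qed
  qed
qed

end

section \<open>Subalgebras of a polynomial ring in two variables\<close>

abbreviation cst :: "'k::field \<Rightarrow> 'k poly poly" where
  "cst c \<equiv> [:[:c:]:]"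

interpretation cst: central_hom cst
  by standard (simp_all add: one_pCons)

text \<open>By pseudo-division, an element H of least degree in the ideal (G, F) divides multiples
  of both by nonzero constants of the coefficient ring. If H has positive degree, then the prime G
  divides H and hence a constant multiple of F; so G divides a constant and is itself
  constant.\<close>

lemma eliminate:
  fixes F G :: "'r::{factorial_ring_gcd, semiring_gcd_mult_normalize} poly"
  assumes G: "prime_elem G" and F: "\<not> G dvd F"
  obtains a A B where "a \<noteq> 0" "[:a:] = A * G + B * F"
proof -
  note result = that
  define I where "I = {H. H \<noteq> 0 \<and> (\<exists>A B. H = A * G + B * F)}"
  have G0: "G \<noteq> 0" using G by auto
  have I: "A * G + B * F \<in> I" if "A * G + B * F \<noteq> 0" for A B
    using that by (auto simp: I_def)
  have GI: "G \<in> I" using I[of 1 0] G0 by simp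
  have FI: "F \<in> I" using I[of 0 1] F by auto
  define H where "H = arg_min degree (\<lambda>H. H \<in> I)"
  have HI: "H \<in> I" and min: "\<And>H'. H' \<in> I \<Longrightarrow> degree H \<le> degree H'"
    unfolding H_def using arg_min_nat_lemma[of "\<lambda>H. H \<in> I" G degree] GI by auto
  then obtain A0 B0 where H: "H = A0 * G + B0 * F" "H \<noteq> 0" by (auto simp: I_def)
  have dvd: "\<exists>l Q. l \<noteq> 0 \<and> smult l K = H * Q" if K: "K \<in> I" for K
  proof -
    obtain l Q where lQ: "l \<noteq> 0" "smult l K = H * Q + pseudo_mod K H"
      using pseudo_mod(1)[OF H(2)] by blast
    obtain A B where K: "K = A * G + B * F" using K by (auto simp: I_def)
    have "pseudo_mod K H = 0"
    proof (rule ccontr)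
      assume nz: "pseudo_mod K H \<noteq> 0"
      have "pseudo_mod K H = smult l K - H * Q" using lQ(2) by simp
      also have "\<dots> = (smult l A - A0 * Q) * G + (smult l B - B0 * Q) * F"
        unfolding K H(1) by (simp add: algebra_simps smult_add_right)
      finally have "pseudo_mod K H \<in> I" using nz I by metis
      then show False using min[of "pseudo_mod K H"] pseudo_mod(2)[OF H(2), of K] nz by auto
    qed
    then show ?thesis using lQ by auto
  qed
  have const: ?thesis if K: "K \<in> I" "degree K = 0" for K
  proof -
    obtain a where a: "K = [:a:]" using K(2) by (rule degree_eq_zeroE)
    then obtain A B where "a \<noteq> 0" "[:a:] = A * G + B * F" using K(1) by (auto simp: I_def)
    then show ?thesis by (rule result)
  qed
  show ?thesis
  proof (cases "degree H = 0")
    case True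
    then show ?thesis using const[OF HI] by simp
  next
    case False
    obtain l Q where lQ: "l \<noteq> 0" "smult l G = H * Q" using dvd[OF GI] by blast
    have "G dvd H * Q" by (metis dvd_smult dvd_refl lQ(2))
    moreover have "\<not> G dvd Q"
    proof
      assume "G dvd Q"
      then obtain Q' where "Q = G * Q'" ..
      then have "G * [:l:] = G * (H * Q')" using lQ(2) by (simp add: algebra_simps)
      then have HQ: "[:l:] = H * Q'" using G0 by (metis mult_left_cancel)
      then have "H \<noteq> 0" "Q' \<noteq> 0" using lQ(1) by auto
      then have "degree [:l:] = degree H + degree Q'" unfolding HQ by (rule degree_mult_eq)
      then show False using False by simp
    qed
    ultimately have "G dvd H" using G by (simp add: prime_elem_dvd_mult_iff)
    obtain m R where mR: "m \<noteq> 0" "smult m F = H * R" using dvd[OF FI] by blast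
    then have "G dvd [:m:] * F" using \<open>G dvd H\<close> by simp
    then have "G dvd [:m:]" using G F prime_elem_dvd_mult_iff by blast
    then have "degree G \<le> degree [:m:]" using mR(1) by (intro dvd_imp_degree_le) auto
    then have "degree G = 0" by simp
    then show ?thesis using const[OF GI] by simp
  qed
qed

text \<open>Division by w - \<mu> in the inner variable w: the remainder has its coefficients in the
  field and is a polynomial in the outer variable alone.\<close>

lemma reduce_inner:
  "\<exists>g G'. G = map_poly (\<lambda>c. [:c:]) g + smult [:- \<mu>, 1:] (G' :: 'k::field poly poly)"
proof (induction G)
  case 0
  show ?case by (intro exI[of _ 0]) simp
next
  case (pCons q G)
  then obtain g G' where G: "G = map_poly (\<lambda>c. [:c:]) g + smult [:- \<mu>, 1:] G'" by blast
  have "q = [:poly q \<mu>:] + [:- \<mu>, 1:] * synthetic_div q \<mu>"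
    using synthetic_div_correct'[of \<mu> q] by (simp add: add.commute)
  moreover have "map_poly (\<lambda>c. [:c:]) (pCons (poly q \<mu>) g) = pCons [:poly q \<mu>:] (map_poly (\<lambda>c. [:c:]) g)"
    by (simp add: map_poly_pCons)
  ultimately have "pCons q G = map_poly (\<lambda>c. [:c:]) (pCons (poly q \<mu>) g) +
      smult [:- \<mu>, 1:] (pCons (synthetic_div q \<mu>) G')"
    using G by simp
  then show ?case by blast
qed

lemma is_unit_poly_polyE:
  fixes f :: "'k::field poly poly"
  assumes "is_unit f"
  obtains c where "c \<noteq> 0" "f = cst c"
proof -
  obtain c where c: "f = cst c" "c dvd 1" using assms by (auto simp: is_unit_poly_iff)
  then have "c \<noteq> 0" by auto
  then show ?thesis using that c(1) by blast
qed

text \<open>Geometrically, the plane map (u, v) contracts no curve to a point.\<close>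

locale no_critical_prime =
  fixes u v :: "'k::{field_gcd, alg_closed_field} poly poly"
  assumes no_critical: "prime_elem \<pi> \<Longrightarrow> \<pi> dvd u - cst \<xi> \<Longrightarrow> \<pi> dvd v - cst \<mu> \<Longrightarrow> False"
begin

abbreviation E :: "'k poly poly \<Rightarrow> 'k poly poly" where
  "E \<equiv> ev cst u v"

lemmas E_mult = cst.ev_mult[of u v, OF mult.commute]

text \<open>Over an algebraically closed field \<open>evy cst w q\<close> is a nonzero constant
  times a product of factors \<open>w - cst \<mu>\<close>, and a prime divides one of the
  factors.\<close>

lemma prime_dvd_evy:
  fixes q :: "'k poly"
  assumes "prime_elem \<pi>" "q \<noteq> 0" "\<pi> dvd evy cst w q"
  shows "\<exists>\<mu>. \<pi> dvd w - cst \<mu>"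
  using assms(2,3)
proof (induction "degree q" arbitrary: q)
  case 0
  then obtain c where "q = [:c:]" "c \<noteq> 0" by (metis degree_eq_zeroE pCons_0_0)
  then have "is_unit (evy cst w q)" by (simp add: cst.ev_simps is_unit_poly_iff is_unit_const_poly_iff dvd_field_iff)
  then show ?case using assms(1) 0 by (meson dvd_unit_imp_unit prime_elem_not_unit)
next
  case (Suc n)
  then obtain \<mu> where "poly q \<mu> = 0" using alg_closed_imp_poly_has_root[of q] by auto
  then obtain q' where q: "q = [:- \<mu>, 1:] * q'" by (auto simp: poly_eq_0_iff_dvd)
  have q'0: "q' \<noteq> 0" using q Suc.prems by auto
  then have "degree q = Suc (degree q')" unfolding q by (subst degree_mult_eq) auto
  then have n: "n = degree q'" using Suc.hyps by simp
  have "evy cst w q = (w - cst \<mu>) * evy cst w q'"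
    unfolding q cst.evy_mult by (simp add: cst.ev_simps)
  then have "\<pi> dvd w - cst \<mu> \<or> \<pi> dvd evy cst w q'"
    using Suc.prems assms(1) by (simp add: prime_elem_dvd_mult_iff)
  then show ?case using Suc.hyps(1)[OF n q'0] by auto
qed

lemma prime_divisor:
  fixes f :: "'k poly poly"
  assumes "\<not> is_unit f"
  obtains \<pi> where "prime_elem \<pi>" "\<pi> dvd f"
proof (cases "f = 0")
  case True
  have "[:0, 1:] \<noteq> (0 :: 'k poly poly)" "\<not> is_unit ([:0, 1:] :: 'k poly poly)"
    by (auto simp: is_unit_poly_iff)
  then obtain \<pi> :: "'k poly poly" where "prime \<pi>"
    using prime_divisor_exists by blast
  then show ?thesis using True that by auto
next
  case False
  then show ?thesis using assms prime_divisor_exists[of f] that by auto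
qed

text \<open>If u were the constant \<xi>, every prime would divide u - \<xi> = 0, so a prime divisor
  of some nonunit \<open>v - cst \<mu>\<close> would be critical.\<close>

lemma u_nonconst: "u \<noteq> cst \<xi>"
proof
  assume u: "u = cst \<xi>"
  have "\<exists>\<mu>. \<not> is_unit (v - cst \<mu>)"
  proof (cases "is_unit v")
    case True
    then obtain c where "v = cst c" by (rule is_unit_poly_polyE)
    then show ?thesis by (intro exI[of _ c]) simp
  next
    case False
    then show ?thesis by (intro exI[of _ 0]) simp
  qed
  then obtain \<mu> \<pi> where "prime_elem \<pi>" "\<pi> dvd v - cst \<mu>" using prime_divisor by metis
  then show False using no_critical[of \<pi> \<xi> \<mu>] u by simp
qed

text \<open>In a relation, the term free of u is a polynomial in v which u divides. If it is zero, u
  cancels; otherwise a prime divisor of u also divides some \<open>v - cst \<mu>\<close>.\<close>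

lemma E_eq_0: "E q = 0 \<Longrightarrow> q = 0"
proof (induction q)
  case (pCons a q)
  show ?case
  proof (cases "a = 0")
    case True
    then have "u * E q = 0" using pCons.prems by (simp add: ev_pCons)
    moreover have "u \<noteq> 0" using u_nonconst[of 0] by auto
    ultimately show ?thesis using pCons.IH True by simp
  next
    case False
    have "\<not> is_unit u" using u_nonconst is_unit_poly_polyE by metis
    then obtain \<pi> where \<pi>: "prime_elem \<pi>" "\<pi> dvd u" by (rule prime_divisor)
    have "evy cst v a = - (u * E q)" using pCons.prems by (simp add: ev_pCons eq_neg_iff_add_eq_0)
    then have "\<pi> dvd evy cst v a" using \<pi>(2) by simp
    then obtain \<mu> where "\<pi> dvd v - cst \<mu>" using prime_dvd_evy[OF \<pi>(1) False] by blast
    then show ?thesis using no_critical[of \<pi> 0 \<mu>] \<pi> by simp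
  qed
qed simp

lemma E_inject: "E f = E g \<longleftrightarrow> f = g"
  using E_eq_0[of "f - g"] by (auto simp: cst.ev_diff)

lemma E_unit:
  assumes "is_unit (E G)"
  shows "is_unit G"
proof -
  obtain c where c: "c \<noteq> 0" "E G = cst c" using assms by (rule is_unit_poly_polyE)
  then have "E G = E (cst c)" by simp
  then have "G = cst c" by (simp only: E_inject)
  then show ?thesis using c(1) by (simp add: is_unit_const_poly_iff dvd_field_iff)
qed

text \<open>
  Elimination yields a nonzero polynomial in \<open>v\<close> alone which is divisible by \<open>\<pi>\<close>, and then one in
  \<open>u\<close> alone; so \<open>\<pi>\<close> divides linear factors of both.
\<close>

lemma no_common_prime:
  assumes G: "prime_elem G" and F: "\<not> G dvd F"
    and \<pi>: "prime_elem \<pi>" "\<pi> dvd E G" "\<pi> dvd E F"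
  shows False
proof -
  obtain a A B where a: "a \<noteq> 0" "[:a:] = A * G + B * F" using eliminate[OF G F] .
  have "evy cst v a = E [:a:]" by (simp add: ev_pCons)
  also have "\<dots> = E A * E G + E B * E F" unfolding a(2) by (simp add: cst.ev_plus E_mult)
  finally have "\<pi> dvd evy cst v a" using \<pi> by simp
  then obtain \<mu> where \<mu>: "\<pi> dvd v - cst \<mu>" using prime_dvd_evy[OF \<pi>(1) a(1)] by blast
  have E_inner: "E (map_poly (\<lambda>c. [:c:]) g) = evy cst u g" for g
    by (induction g) (simp_all add: map_poly_pCons cst.ev_simps)
  have key: "[:[:- \<mu>, 1:]:] dvd K" if "\<pi> dvd E K" for K
  proof -
    obtain g K' where K: "K = map_poly (\<lambda>c. [:c:]) g + smult [:- \<mu>, 1:] K'"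
      using reduce_inner by blast
    have "E K = evy cst u g + (v - cst \<mu>) * E K'"
      unfolding K by (simp add: cst.ev_plus E_inner cst.ev_smult mult.commute cst.ev_simps)
    then have "\<pi> dvd evy cst u g" using that \<mu> by (simp add: dvd_add_left_iff)
    then have "g = 0" using prime_dvd_evy[OF \<pi>(1), of g] no_critical[OF \<pi>(1) _ \<mu>] by blast
    then have "K = [:[:- \<mu>, 1:]:] * K'" using K by simp
    then show ?thesis by (rule dvdI)
  qed
  obtain Q where Q: "G = [:[:- \<mu>, 1:]:] * Q" using key[OF \<pi>(2)] ..
  have "\<not> is_unit [:[:- \<mu>, 1:]:]" by (auto simp: is_unit_poly_iff)
  then have "is_unit Q" using Q Factorial_Ring.irreducibleD[OF prime_elem_imp_irreducible[OF G] Q] by auto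
  then have "[:[:- \<mu>, 1:]:] * Q dvd [:[:- \<mu>, 1:]:] * 1" by (intro mult_dvd_mono) auto
  then have "G dvd [:[:- \<mu>, 1:]:]" unfolding Q by simp
  then show False using key[OF \<pi>(3)] F dvd_trans by blast
qed

text \<open>G is cancelled one prime factor \<open>p\<close> at a time. As \<open>E p\<close> is no
  unit, it has a prime divisor, which also divides \<open>E F\<close>; by
  \<open>no_common_prime\<close> this forces \<open>p\<close> to divide F.\<close>

lemma E_saturated:
  assumes "G \<noteq> 0" "E G * z = E F"
  shows "\<exists>H. z = E H"
  using assms
proof (induction G arbitrary: F z rule: prime_divisors_induct)
  case (unit G)
  then obtain c where c: "c \<noteq> 0" "G = cst c" by (auto elim: is_unit_poly_polyE)
  have "z = E (cst (inverse c) * F)"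
    using unit(3) c by (simp only: E_mult flip: unit(3)) (simp add: pCons_one)
  then show ?case by blast
next
  case (factor p G)
  have p: "prime_elem p" using factor.hyps by auto
  have eq: "E p * (E G * z) = E F" using factor.prems by (simp add: E_mult mult.assoc)
  have "p dvd F"
  proof (rule ccontr)
    assume nd: "\<not> p dvd F"
    have "\<not> is_unit (E p)" using E_unit p prime_elem_not_unit by blast
    then obtain \<pi> where \<pi>: "prime_elem \<pi>" "\<pi> dvd E p" by (rule prime_divisor)
    then have "\<pi> dvd E F" by (simp flip: eq)
    then show False using no_common_prime[OF p nd \<pi>] by simp
  qed
  then obtain F' where F': "F = p * F'" ..
  have "E p \<noteq> 0" using E_eq_0[of p] p by auto
  then have "E G * z = E F'" using eq unfolding F' E_mult by simp
  then show ?case using factor.IH[of z F'] factor.prems by auto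
qed simp

end

section \<open>Fractions in positive characteristic\<close>

lemma weyl_hom_ev:
  assumes "weyl_representation weyl_const x y"
  shows "weyl_subst x y (evc a b f) =
    evc (weyl_subst x y a) (weyl_subst x y b) f"
proof -
  interpret weyl_representation weyl_const x y by fact
  have "weyl_subst x y (evy weyl_const b q) = evy weyl_const (weyl_subst x y b) q" for q
    by (induction q) (simp_all add: evc_simps hom_add hom_mult)
  then show ?thesis by (induction f) (simp_all add: evc_simps hom_add hom_mult)
qed

text \<open>The preimages of x^p and y^p are only constructed inside the locale, hence the
  assumption speaks of arbitrary ones.\<close>

locale weyl_pair_closed = weyl_pair x y p
  for x y :: "'k::{field_gcd, alg_closed_field} weyl" and p +
  assumes no_critical: "zeta u = x ^ p \<Longrightarrow> zeta v = y ^ p \<Longrightarrow> prime_elem \<pi> \<Longrightarrow>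
    \<pi> dvd u - cst \<xi> \<Longrightarrow> \<pi> dvd v - cst \<mu> \<Longrightarrow> False"
begin

definition u :: "'k poly poly" where "u = (SOME f. zeta f = x ^ p)"
definition v :: "'k poly poly" where "v = (SOME f. zeta f = y ^ p)"

lemma zeta_u: "zeta u = x ^ p" and zeta_v: "zeta v = y ^ p"
proof -
  have "\<exists>f. zeta f = x ^ p" "\<exists>f. zeta f = y ^ p"
    using centralizes_pth_powers[THEN centralizer_eq_centre] by metis+
  then show "zeta u = x ^ p" "zeta v = y ^ p"
    unfolding u_def v_def by (auto intro: someI_ex)
qed

sublocale no_critical_prime u v
  by standard (rule no_critical[OF zeta_u zeta_v])

lemma zeta_E: "zeta (E G) = evc (x ^ p) (y ^ p) G"
proof -
  have "zeta (evy cst v q) = evy weyl_const (y ^ p) q" for q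
    by (induction q) (simp_all add: cst.ev_simps evc_simps zeta_simps zeta_v)
  then show ?thesis
    by (induction G) (simp_all add: ev_pCons zeta_simps zeta_u)
qed

sublocale \<psi>: weyl_representation weyl_const x y
  by (rule weyl_hom_representation) (rule yx)

abbreviation \<psi> where "\<psi> \<equiv> weyl_subst x y"

text \<open>The coordinates of an image are obtained by sorting the exponents of b modulo p.
  Injectivity of \<psi> becomes independence of the box monomials together with injectivity of
  \<open>E\<close>.\<close>

lemma \<psi>_sections: "\<psi> b = box_sum (\<lambda>s. zeta (E (sect p (sym b) s)))"
proof -
  have "\<psi> b = \<psi> (nf (sym b))" by simp
  also have "\<dots> = evc x y (sym b)"
    by (subst weyl_hom_ev[OF \<psi>.weyl_representation_axioms]) simp
  also have "\<dots> = box_sum (\<lambda>s. zeta (E (sect p (sym b) s)))"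
    unfolding zeta_E using centralizes_pth_powers(2)
    by (intro evc_sections p_pos) (simp add: centralizes_def)
  finally show ?thesis .
qed

lemma \<psi>_eq_0: "\<psi> b = 0 \<Longrightarrow> b = 0"
proof -
  assume "\<psi> b = 0"
  then have sect0: "sect p (sym b) s = 0" if "s \<in> box" for s
    using zeta_box_independent[of "\<lambda>s. E (sect p (sym b) s)" s] that E_eq_0
    unfolding \<psi>_sections by blast
  have "cf b i j = 0" for i j
  proof -
    have "cf b i j = coeff (coeff (sect p (sym b) (i mod p, j mod p)) (i div p)) (j div p)"
      by (simp add: coeff_sect[OF p_pos] cf_def)
    then show ?thesis using p_pos by (simp add: sect0)
  qed
  then show "b = 0" by (intro weyl_eqI) simp
qed

lemma \<psi>_inject: "\<psi> a = \<psi> b \<longleftrightarrow> a = b"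
  using \<psi>_eq_0[of "a - b"] by (auto simp: \<psi>.hom_diff)

lemma evc_range: "evc (x ^ p) (y ^ p) f = \<psi> (zeta f)"
  unfolding zeta_altdef by (simp add: weyl_hom_ev[OF \<psi>.weyl_representation_axioms] \<psi>.hom_power)

lemma box_range: "\<exists>b. box_sum (\<lambda>s. zeta (E (z s))) = \<psi> b"
  by (rule exI[of _ "\<Sum>s\<in>box. zeta (z s) * weyl_X ^ fst s * weyl_Y ^ snd s"])
    (simp add: \<psi>.hom_sum \<psi>.hom_mult \<psi>.hom_power zeta_E evc_range)

text \<open>The images of 1 and of the b X^i Y^j are p^2 + 1 elements of a module spanned by p^2
  elements over k[x^p, y^p]. In a relation the coefficient of 1 cannot vanish, because \<psi> b is
  no zero divisor.\<close>

lemma multiple_in_centre: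
  assumes "b \<noteq> 0"
  obtains d t where "d \<noteq> 0" "\<psi> b * \<psi> t = zeta (E d)"
proof -
  define e where "e i = (case i of None \<Rightarrow> 1 | Some s \<Rightarrow> b * weyl_X ^ fst s * weyl_Y ^ snd s)" for i
  define I where "I = insert None (Some ` box)"
  have I: "finite I" "None \<notin> Some ` box" by (auto simp: I_def)
  have "card I = Suc (card box)"
    unfolding I_def by (simp add: card_image)
  then have card: "card box < card I" by simp
  have comm: "x ^ p * y ^ p = y ^ p * x ^ p"
    by (metis zeta_u zeta_central)
  have bas: "\<exists>z. \<psi> (e i) = (\<Sum>s\<in>box. evc (x ^ p) (y ^ p) (z s) * (x ^ fst s * y ^ snd s))" for i
    by (rule exI[of _ "sect p (sym (e i))"], subst \<psi>_sections) (simp add: zeta_E mult.assoc)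
  obtain c where c: "\<exists>i\<in>I. c i \<noteq> 0" "(\<Sum>i\<in>I. evc (x ^ p) (y ^ p) (c i) * \<psi> (e i)) = 0"
    using evc_dependence[OF comm _ I(1) card, of "\<lambda>i. \<psi> (e i)", OF _ bas] by auto
  obtain t where t: "box_sum (\<lambda>s. zeta (E (c (Some s)))) = \<psi> t"
    using box_range[of "\<lambda>s. c (Some s)"] by blast
  have z: "zeta (E f) * (\<psi> b * w) = \<psi> b * (zeta (E f) * w)" for f w
    by (simp only: mult.assoc[symmetric] zeta_central[of "E f" "\<psi> b"])
  have "(\<Sum>i\<in>I. evc (x ^ p) (y ^ p) (c i) * \<psi> (e i)) = zeta (E (c None)) +
      (\<Sum>s\<in>box. zeta (E (c (Some s))) * (\<psi> b * (x ^ fst s * y ^ snd s)))"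
    using I unfolding I_def
    by (simp add: sum.reindex e_def mult.assoc zeta_E \<psi>.hom_mult \<psi>.hom_power)
  also have "(\<Sum>s\<in>box. zeta (E (c (Some s))) * (\<psi> b * (x ^ fst s * y ^ snd s))) = \<psi> b * \<psi> t"
    unfolding t[symmetric] z by (simp add: sum_distrib_left mult.assoc)
  finally have rel: "zeta (E (c None)) + \<psi> b * \<psi> t = 0" using c(2) by simp
  have d: "c None \<noteq> 0"
  proof
    assume 0: "c None = 0"
    then have "\<psi> b * \<psi> t = 0" using rel by (simp add: zeta_simps)
    then have "\<psi> t = 0" using assms \<psi>_eq_0 by auto
    then have "c (Some s) = 0" if "s \<in> box" for s
      using zeta_box_independent[of "\<lambda>s. E (c (Some s))" s] that E_eq_0 unfolding t by blast
    then show False using c(1) 0 unfolding I_def by auto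
  qed
  have "\<psi> b * \<psi> t = zeta (E (- c None))"
    using rel by (simp add: cst.ev_uminus zeta_simps add_eq_0_iff)
  then show ?thesis using d that[of "- c None" t] by simp
qed

text \<open>The equation \<open>b * s = a\<close> is recorded besides membership, because it bounds
  the degrees of b.\<close>

theorem fraction_in_range:
  assumes "s \<noteq> 0" "c * \<psi> s = \<psi> a"
  shows "\<exists>b. c = \<psi> b \<and> b * s = a"
proof -
  obtain d t where dt: "d \<noteq> 0" "\<psi> s * \<psi> t = zeta (E d)" using multiple_in_centre[OF assms(1)] .
  obtain z where z: "c = box_sum (\<lambda>s. zeta (z s))"
    using box_basis by blast
  define h where "h = sect p (sym (a * t))"
  have "zeta (E d) * c = c * \<psi> s * \<psi> t" by (simp only: dt(2) mult.assoc zeta_central)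
  also have "\<dots> = \<psi> (a * t)" by (simp only: assms(2) \<psi>.hom_mult)
  also have "\<dots> = box_sum (\<lambda>s. zeta (E (h s)))"
    unfolding h_def by (rule \<psi>_sections)
  finally have "box_sum (\<lambda>s. zeta (E d * z s - E (h s))) = 0"
    unfolding z by (simp add: zeta_simps left_diff_distrib sum_subtractf sum_distrib_left mult.assoc)
  then have "E d * z r - E (h r) = 0" if "r \<in> box" for r
    using zeta_box_independent[of "\<lambda>s. E d * z s - E (h s)"] that by blast
  then have "\<exists>H. z r = E H" if "r \<in> box" for r
    using E_saturated[OF dt(1)] that by auto
  then obtain H where H: "z r = E (H r)" if "r \<in> box" for r by metis
  have "c = box_sum (\<lambda>s. zeta (E (H s)))"
    unfolding z by (intro sum.cong refl) (simp add: H)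
  then obtain b where b: "c = \<psi> b" using box_range by metis
  then have "\<psi> (b * s) = \<psi> a" using assms(2) by (simp add: \<psi>.hom_mult)
  then show ?thesis using b by (auto simp: \<psi>_inject)
qed

end

section \<open>Valued fields and residue fields\<close>

definition (in Fields.field) valuation_subring :: "'a set \<Rightarrow> bool" where
  "valuation_subring V \<longleftrightarrow> 1 \<in> V \<and> (\<forall>a\<in>V. \<forall>b\<in>V. a - b \<in> V \<and> a * b \<in> V) \<and> (\<forall>a. a \<in> V \<or> inverse a \<in> V)"

text \<open>A class, because the residue field must become a type over which Weyl algebras can be
  formed. That 1/p is outside the ring means that p lies in the maximal ideal.\<close>

class valued_field = field_char_0 +
  fixes vring :: "'a set"
  assumes valuation_vring: "valuation_subring vring"
    and residue_char_pos: "\<exists>p. prime p \<and> inverse (of_nat p) \<notin> vring"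
begin

definition vmax :: "'a set" where
  "vmax = {a \<in> vring. a = 0 \<or> inverse a \<notin> vring}"

lemma vring_1 [simp]: "1 \<in> vring"
  and vring_diff: "a \<in> vring \<Longrightarrow> b \<in> vring \<Longrightarrow> a - b \<in> vring"
  and vring_mult: "a \<in> vring \<Longrightarrow> b \<in> vring \<Longrightarrow> a * b \<in> vring"
  and vring_total: "a \<in> vring \<or> inverse a \<in> vring"
  using valuation_vring unfolding valuation_subring_def by blast+

lemma vring_0 [simp]: "0 \<in> vring"
  using vring_diff[of 1 1] by simp

lemma vring_uminus: "a \<in> vring \<Longrightarrow> - a \<in> vring"
  using vring_diff[of 0 a] by simp

lemma vring_add: "a \<in> vring \<Longrightarrow> b \<in> vring \<Longrightarrow> a + b \<in> vring"
  using vring_diff[of a "- b"] vring_uminus[of b] by simp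

lemma vring_of_nat [simp]: "of_nat n \<in> vring"
  by (induction n) (simp_all add: vring_add)

lemma vring_power: "a \<in> vring \<Longrightarrow> a ^ n \<in> vring"
  by (induction n) (simp_all add: vring_mult)

lemma vring_sum: "(\<And>i. i \<in> A \<Longrightarrow> f i \<in> vring) \<Longrightarrow> sum f A \<in> vring"
  by (induction A rule: infinite_finite_induct) (simp_all add: vring_add)

lemma vmax_imp_vring: "a \<in> vmax \<Longrightarrow> a \<in> vring"
  by (simp add: vmax_def)

lemma vmax_0 [simp]: "0 \<in> vmax" and one_notin_vmax [simp]: "1 \<notin> vmax"
  by (simp_all add: vmax_def)

lemma vmax_mult: "a \<in> vmax \<Longrightarrow> b \<in> vring \<Longrightarrow> a * b \<in> vmax"
proof -
  assume a: "a \<in> vmax" and b: "b \<in> vring"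
  have "inverse a \<in> vring" if "a * b \<noteq> 0" "inverse (a * b) \<in> vring"
    using vring_mult[OF b that(2)] that(1) by (simp add: field_simps)
  then show ?thesis using a b by (auto simp: vmax_def vring_mult)
qed

lemma vmax_mult': "b \<in> vring \<Longrightarrow> a \<in> vmax \<Longrightarrow> b * a \<in> vmax"
  using vmax_mult[of a b] by (simp add: mult.commute)

lemma vmax_uminus: "a \<in> vmax \<Longrightarrow> - a \<in> vmax"
  using vmax_mult[of a "- 1"] by (simp add: vring_uminus)

lemma vmax_add: "a \<in> vmax \<Longrightarrow> b \<in> vmax \<Longrightarrow> a + b \<in> vmax"
proof -
  have *: "a + b \<in> vmax" if "a \<in> vmax" "b \<in> vmax" "b \<noteq> 0" "a * inverse b \<in> vring" for a b
  proof -
    have "b * (1 + a * inverse b) \<in> vmax" using that by (intro vmax_mult vring_add) auto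
    also have "b * (1 + a * inverse b) = a + b" using that(3) by (simp add: field_simps)
    finally show ?thesis .
  qed
  assume ab: "a \<in> vmax" "b \<in> vmax"
  show ?thesis
  proof (cases "a = 0 \<or> b = 0")
    case False
    have "a * inverse b \<in> vring \<or> b * inverse a \<in> vring"
      using vring_total[of "a * inverse b"] False by (simp add: mult.commute)
    then show ?thesis using *[OF ab] *[OF ab(2,1)] False by (auto simp: add.commute)
  qed (use ab in auto)
qed

lemma vmax_diff: "a \<in> vmax \<Longrightarrow> b \<in> vmax \<Longrightarrow> a - b \<in> vmax"
  using vmax_add[of a "- b"] vmax_uminus[of b] by simp

lemma vmax_sum: "(\<And>i. i \<in> A \<Longrightarrow> f i \<in> vmax) \<Longrightarrow> sum f A \<in> vmax"
  by (induction A rule: infinite_finite_induct) (simp_all add: vmax_add)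

lemma inverse_vring: "a \<in> vring \<Longrightarrow> a \<notin> vmax \<Longrightarrow> inverse a \<in> vring"
  by (auto simp: vmax_def)

lemma notin_vring_imp: "a \<notin> vring \<Longrightarrow> inverse a \<in> vmax"
  using vring_total[of a] by (auto simp: vmax_def)

definition resid_rel :: "'a \<Rightarrow> 'a \<Rightarrow> bool" where
  "resid_rel a b \<longleftrightarrow> a \<in> vring \<and> b \<in> vring \<and> a - b \<in> vmax"

lemma part_equivp_resid_rel: "part_equivp resid_rel"
proof (rule part_equivpI)
  show "\<exists>x. resid_rel x x" by (auto simp: resid_rel_def intro!: exI[of _ 0])
  show "symp resid_rel"
    by (rule sympI) (metis resid_rel_def minus_diff_eq vmax_uminus)
  show "transp resid_rel"
  proof (rule transpI)
    fix a b c assume "resid_rel a b" "resid_rel b c"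
    then show "resid_rel a c" using vmax_add[of "a - b" "b - c"] by (simp add: resid_rel_def algebra_simps)
  qed
qed

lemma resid_rel_vmax: "resid_rel a b \<Longrightarrow> a \<in> vmax \<longleftrightarrow> b \<in> vmax"
  unfolding resid_rel_def using vmax_add[of "a - b" b] vmax_diff[of a "a - b"] by (auto simp: algebra_simps)

end

quotient_type (overloaded) 'a resid = "'a::valued_field" / partial: "resid_rel :: 'a \<Rightarrow> 'a \<Rightarrow> bool"
  by (rule part_equivp_resid_rel)

instantiation resid :: (valued_field) field
begin

lift_definition zero_resid :: "'a resid" is 0 by (simp add: resid_rel_def)
lift_definition one_resid :: "'a resid" is 1 by (simp add: resid_rel_def)

lift_definition plus_resid :: "'a resid \<Rightarrow> 'a resid \<Rightarrow> 'a resid" is "(+)"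
  unfolding resid_rel_def by (metis add_diff_add vmax_add vring_add)

lift_definition uminus_resid :: "'a resid \<Rightarrow> 'a resid" is uminus
  unfolding resid_rel_def using vmax_uminus vring_uminus by fastforce

lift_definition minus_resid :: "'a resid \<Rightarrow> 'a resid \<Rightarrow> 'a resid" is "(-)"
proof -
  fix a b c d :: 'a
  assume "resid_rel a b" "resid_rel c d"
  then have "a - c \<in> vring" "b - d \<in> vring" "(a - b) - (c - d) \<in> vmax"
    unfolding resid_rel_def by (auto intro: vring_diff vmax_diff)
  then show "resid_rel (a - c) (b - d)" by (simp add: resid_rel_def algebra_simps)
qed

lift_definition times_resid :: "'a resid \<Rightarrow> 'a resid \<Rightarrow> 'a resid" is "(*)"
proof -
  fix a b c d :: 'a
  assume "resid_rel a b" "resid_rel c d"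
  then have "a * c \<in> vring" "b * d \<in> vring" "(a - b) * c + b * (c - d) \<in> vmax"
    unfolding resid_rel_def by (auto intro: vring_mult vmax_add vmax_mult vmax_mult')
  then show "resid_rel (a * c) (b * d)" by (simp add: resid_rel_def algebra_simps)
qed

lift_definition inverse_resid :: "'a resid \<Rightarrow> 'a resid" is "\<lambda>a. if a \<in> vmax then 0 else inverse a"
proof -
  fix a b :: 'a
  assume ab: "resid_rel a b"
  show "resid_rel (if a \<in> vmax then 0 else inverse a) (if b \<in> vmax then 0 else inverse b)"
  proof (cases "a \<in> vmax")
    case True
    then show ?thesis using resid_rel_vmax[OF ab] by (simp add: resid_rel_def)
  next
    case False
    then have b: "b \<notin> vmax" using resid_rel_vmax[OF ab] by simp
    have nz: "a \<noteq> 0" "b \<noteq> 0" using False b by auto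
    have inv: "inverse a \<in> vring" "inverse b \<in> vring"
      using False b ab by (auto simp: resid_rel_def intro: inverse_vring)
    have "- ((a - b) * (inverse a * inverse b)) \<in> vmax"
      using ab inv by (intro vmax_uminus vmax_mult vring_mult) (auto simp: resid_rel_def)
    also have "- ((a - b) * (inverse a * inverse b)) = inverse a - inverse b"
      using nz by (simp add: field_simps)
    finally show ?thesis using False b inv by (simp add: resid_rel_def)
  qed
qed

definition divide_resid :: "'a resid \<Rightarrow> 'a resid \<Rightarrow> 'a resid" where
  "divide_resid a b = a * inverse b"

instance
proof
  fix a b c :: "'a resid"
  show "a * b * c = a * (b * c)"
    by transfer (auto simp: resid_rel_def mult.assoc intro: vring_mult)
  show "a * b = b * a"
    by transfer (auto simp: resid_rel_def mult.commute intro: vring_mult)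
  show "1 * a = a"
    by transfer (auto simp: resid_rel_def)
  show "a + b + c = a + (b + c)"
    by transfer (auto simp: resid_rel_def add.assoc intro: vring_add)
  show "a + b = b + a"
    by transfer (auto simp: resid_rel_def add.commute intro: vring_add)
  show "0 + a = a"
    by transfer (auto simp: resid_rel_def)
  show "- a + a = 0"
    by transfer (auto simp: resid_rel_def)
  show "a - b = a + - b"
    by transfer (auto simp: resid_rel_def intro: vring_diff)
  show "(a + b) * c = a * c + b * c"
    by transfer (auto simp: resid_rel_def algebra_simps intro: vring_add vring_mult)
  show "(0 :: 'a resid) \<noteq> 1"
    by transfer (auto simp: resid_rel_def dest: vmax_uminus)
  show "a \<noteq> 0 \<Longrightarrow> inverse a * a = 1"
  proof transfer
    fix a :: 'a
    assume a: "resid_rel a a" "\<not> resid_rel a 0"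
    then have "a \<noteq> 0" "a \<notin> vmax" by (auto simp: resid_rel_def)
    then show "resid_rel ((if a \<in> vmax then 0 else inverse a) * a) 1" by (simp add: resid_rel_def)
  qed
  show "a div b = a * inverse b"
    by (rule divide_resid_def)
  show "inverse (0 :: 'a resid) = 0"
    by transfer (simp add: resid_rel_def)
qed

end

text \<open>Meaningful on \<open>vring\<close> only: the quotient is partial.\<close>

definition res :: "'a::valued_field \<Rightarrow> 'a resid" where
  "res = abs_resid"

lemma res_add: "a \<in> vring \<Longrightarrow> b \<in> vring \<Longrightarrow> res (a + b) = res a + res b"
  and res_mult: "a \<in> vring \<Longrightarrow> b \<in> vring \<Longrightarrow> res (a * b) = res a * res b"
  and res_diff: "a \<in> vring \<Longrightarrow> b \<in> vring \<Longrightarrow> res (a - b) = res a - res b"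
  unfolding res_def by (simp_all add: plus_resid.abs_eq times_resid.abs_eq minus_resid.abs_eq resid_rel_def)

lemma res_0 [simp]: "res 0 = 0" and res_1 [simp]: "res 1 = 1"
  by (simp_all add: res_def zero_resid_def one_resid_def)

lemma res_of_nat [simp]: "res (of_nat n) = of_nat n"
  by (induction n) (simp_all add: res_add)

lemma res_eq_iff: "a \<in> vring \<Longrightarrow> b \<in> vring \<Longrightarrow> res a = res b \<longleftrightarrow> a - b \<in> vmax"
  using Quotient_rel[OF Quotient_resid, of a b] by (auto simp: res_def resid_rel_def)

lemma res_eq_0_iff: "a \<in> vring \<Longrightarrow> res a = 0 \<longleftrightarrow> a \<in> vmax"
  using res_eq_iff[of a 0] by simp

lemma res_surj: obtains a where "a \<in> vring" "res a = k"
proof -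
  have "resid_rel (rep_resid k) (rep_resid k)" "abs_resid (rep_resid k) = k"
    using Quotient_rep_reflp[OF Quotient_resid] Quotient_abs_rep[OF Quotient_resid] by blast+
  then show ?thesis using that[of "rep_resid k"] by (auto simp: res_def resid_rel_def)
qed

lemma res_sum: "(\<And>i. i \<in> A \<Longrightarrow> f i \<in> vring) \<Longrightarrow> res (sum f A) = (\<Sum>i\<in>A. res (f i))"
  by (induction A rule: infinite_finite_induct) (simp_all add: res_add vring_sum)

lemma res_power: "a \<in> vring \<Longrightarrow> res (a ^ n) = res a ^ n"
  by (induction n) (simp_all add: res_mult vring_power)

text \<open>Through these instances polynomial rings over the residue field become factorial with
  gcd, as elimination and prime factorization require.\<close>

instantiation resid :: (valued_field)
  "{unique_euclidean_ring, normalization_euclidean_semiring, normalization_semidom_multiplicative}"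
begin

definition [simp]: "normalize_resid = (normalize_field :: 'a resid \<Rightarrow> _)"
definition [simp]: "unit_factor_resid = (unit_factor_field :: 'a resid \<Rightarrow> _)"
definition [simp]: "modulo_resid = (mod_field :: 'a resid \<Rightarrow> _)"
definition [simp]: "euclidean_size_resid = (euclidean_size_field :: 'a resid \<Rightarrow> _)"
definition [simp]: "division_segment (x :: 'a resid) = 1"

instance
  by standard
    (simp_all add: dvd_field_iff field_split_simps split: if_splits)

end

instantiation resid :: (valued_field) euclidean_ring_gcd
begin

definition gcd_resid :: "'a resid \<Rightarrow> 'a resid \<Rightarrow> 'a resid" where
  "gcd_resid = Euclidean_Algorithm.gcd"
definition lcm_resid :: "'a resid \<Rightarrow> 'a resid \<Rightarrow> 'a resid" where
  "lcm_resid = Euclidean_Algorithm.lcm"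
definition Gcd_resid :: "'a resid set \<Rightarrow> 'a resid" where
  "Gcd_resid = Euclidean_Algorithm.Gcd"
definition Lcm_resid :: "'a resid set \<Rightarrow> 'a resid" where
  "Lcm_resid = Euclidean_Algorithm.Lcm"

instance by standard (simp_all add: gcd_resid_def lcm_resid_def Gcd_resid_def Lcm_resid_def)

end

instance resid :: (valued_field) field_gcd ..

class closed_valued_field = valued_field + alg_closed_field

text \<open>A monic lift has a root r upstairs. Were r outside \<open>vring\<close>, dividing the
  equation by r^n would put 1 into \<open>vmax\<close>; so r can be reduced.\<close>

instance resid :: (closed_valued_field) alg_closed_field
proof
  fix q :: "'a resid poly"
  assume q: "degree q > 0" "lead_coeff q = 1"
  define n where "n = degree q"
  have "\<forall>i. \<exists>a. a \<in> vring \<and> res a = coeff q i" using res_surj by metis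
  then obtain f where f: "\<And>i. f i \<in> vring" "\<And>i. res (f i) = coeff q i" by metis
  \<comment> \<open>The top coefficient is lifted to exactly 1: both \<open>alg_closed\<close> and
    the integrality of r need a monic polynomial.\<close>
  define g where "g i = (if i = n then 1 else f i)" for i
  have g: "g i \<in> vring" "res (g i) = coeff q i" for i
    using f q(2) by (auto simp: g_def n_def)
  obtain r where r: "(\<Sum>k\<le>n. g k * r ^ k) = 0"
    using alg_closed[of n g] q(1) by (auto simp: n_def g_def)
  have rV: "r \<in> vring"
  proof (rule ccontr)
    assume "r \<notin> vring"
    then have s: "inverse r \<in> vmax" "r \<noteq> 0" by (auto intro: notin_vring_imp)
    have "(\<Sum>k\<le>n. g k * r ^ k) * inverse r ^ n = (\<Sum>k\<le>n. g k * inverse r ^ (n - k))"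
      unfolding sum_distrib_right
    proof (intro sum.cong refl)
      fix k assume "k \<in> {..n}"
      then have "inverse r ^ n = inverse r ^ k * inverse r ^ (n - k)" by (simp flip: power_add)
      then show "g k * r ^ k * inverse r ^ n = g k * inverse r ^ (n - k)"
        using s(2) by (simp add: field_simps)
    qed
    then have "0 = (\<Sum>k<n. g k * inverse r ^ (n - k)) + 1"
      using r by (simp add: g_def flip: lessThan_Suc_atMost)
    moreover have "(\<Sum>k<n. g k * inverse r ^ (n - k)) \<in> vmax"
    proof (intro vmax_sum vmax_mult' g)
      fix k assume "k \<in> {..<n}"
      then have "inverse r ^ (n - k) = inverse r * inverse r ^ (n - k - 1)"
        by (cases "n - k") auto
      then show "inverse r ^ (n - k) \<in> vmax"
        using s(1) by (auto intro: vmax_mult vring_power vmax_imp_vring)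
    qed
    ultimately have "1 \<in> (vmax :: 'a set)"
      by (metis add.commute add.right_inverse add_left_cancel vmax_uminus)
    then show False by simp
  qed
  have "poly q (res r) = (\<Sum>k\<le>n. res (g k) * res r ^ k)"
    by (simp add: poly_altdef n_def g)
  also have "\<dots> = res (\<Sum>k\<le>n. g k * r ^ k)"
    using g rV by (simp add: res_sum res_mult res_power vring_mult vring_power)
  also have "\<dots> = 0" using r by simp
  finally show "\<exists>x. poly q x = 0" by blast
qed

lemma CHAR_resid: "prime CHAR('a::valued_field resid)"
proof -
  obtain p where p: "prime p" "inverse (of_nat p) \<notin> (vring :: 'a set)"
    using residue_char_pos by blast
  then have "of_nat p \<in> (vmax :: 'a set)" by (simp add: vmax_def)
  then have "(of_nat p :: 'a resid) = 0" using res_eq_0_iff[of "of_nat p :: 'a"] by simp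
  then have "CHAR('a resid) dvd p" by (simp add: of_nat_eq_0_iff_char_dvd)
  then have "CHAR('a resid) > 0" using p(1) by (auto intro!: Nat.gr0I)
  then show ?thesis by (rule prime_CHAR_semidom)
qed

lemma of_nat_in_vmax_iff: "of_nat n \<in> (vmax :: 'a::valued_field set) \<longleftrightarrow> CHAR('a resid) dvd n"
  using res_eq_0_iff[of "of_nat n :: 'a"] by (simp add: of_nat_eq_0_iff_char_dvd)

section \<open>Integral elements and their reduction\<close>

definition intg :: "'a::valued_field weyl set" where
  "intg = {a. \<forall>i j. cf a i j \<in> vring}"

definition intg_max :: "'a::valued_field weyl set" where
  "intg_max = {a. \<forall>i j. cf a i j \<in> vmax}"

definition red :: "'a::valued_field weyl \<Rightarrow> 'a resid weyl" where
  "red a = nf (map_poly (map_poly res) (sym a))"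

lemma cf_red: "cf (red a) i j = res (cf a i j)"
  by (simp add: red_def cf_def coeff_map_poly)

lemma intg_add: "a \<in> intg \<Longrightarrow> b \<in> intg \<Longrightarrow> a + b \<in> intg"
  and intg_diff: "a \<in> intg \<Longrightarrow> b \<in> intg \<Longrightarrow> a - b \<in> intg"
  and intg_uminus: "a \<in> intg \<Longrightarrow> - a \<in> intg"
  and intg_const: "c \<in> vring \<Longrightarrow> weyl_const c \<in> intg"
  and intg_const_mult: "c \<in> vring \<Longrightarrow> a \<in> intg \<Longrightarrow> weyl_const c * a \<in> intg"
  and intg_X_mult: "a \<in> intg \<Longrightarrow> weyl_X * a \<in> intg"
  and intg_Y_mult: "a \<in> intg \<Longrightarrow> weyl_Y * a \<in> intg"
  by (auto simp: intg_def cf_const cf_X cf_Y intro!: vring_add vring_diff vring_uminus vring_mult simp del: of_nat_Suc)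

lemma intg_0 [simp]: "0 \<in> intg"
  by (simp add: intg_def)

lemma intg_sum: "(\<And>i. i \<in> A \<Longrightarrow> f i \<in> intg) \<Longrightarrow> sum f A \<in> intg"
  by (induction A rule: infinite_finite_induct) (simp_all add: intg_add)

lemma intg_X_power_mult: "a \<in> intg \<Longrightarrow> weyl_X ^ i * a \<in> intg"
  by (induction i) (simp_all add: intg_X_mult mult.assoc)

lemma intg_Y_power_mult: "a \<in> intg \<Longrightarrow> weyl_Y ^ i * a \<in> intg"
  by (induction i) (simp_all add: intg_Y_mult mult.assoc)

text \<open>Integral normal forms arise from integral constants by sums and left multiplication by X
  and Y. So products and their reductions only have to be checked on generators.\<close>

lemma intg_induct [consumes 1, case_names const add X Y]:
  assumes "a \<in> intg"
    and const: "\<And>c. c \<in> vring \<Longrightarrow> P (weyl_const c)"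
    and add: "\<And>a b. a \<in> intg \<Longrightarrow> b \<in> intg \<Longrightarrow> P a \<Longrightarrow> P b \<Longrightarrow> P (a + b)"
    and X: "\<And>a. a \<in> intg \<Longrightarrow> P a \<Longrightarrow> P (weyl_X * a)"
    and Y: "\<And>a. a \<in> intg \<Longrightarrow> P a \<Longrightarrow> P (weyl_Y * a)"
  shows "P a"
proof -
  have Yp: "P (weyl_Y ^ j * weyl_const c)" if "c \<in> vring" for c j
    using that by (induction j) (simp_all add: const Y intg_Y_power_mult intg_const mult.assoc)
  have Xp: "P (weyl_X ^ i * (weyl_Y ^ j * weyl_const c))" if "c \<in> vring" for c i j
    using that by (induction i) (simp_all add: Yp X intg_Y_power_mult intg_X_power_mult intg_const mult.assoc)
  have sum: "sum f A \<in> intg \<and> P (sum f A)" if "\<And>i. i \<in> A \<Longrightarrow> f i \<in> intg \<and> P (f i)" for f :: "nat \<Rightarrow> 'a weyl" and A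
    using that
  proof (induction A rule: infinite_finite_induct)
    case (insert i A)
    then show ?case using add[of "f i" "sum f A"] intg_add[of "f i" "sum f A"] by simp
  qed (use const[of 0] in simp_all)
  obtain N where N: "\<And>i j. i \<ge> N \<or> j \<ge> N \<Longrightarrow> cf a i j = 0" using cf_bound[of a] by blast
  have eq: "weyl_const c * weyl_X ^ i * weyl_Y ^ j = weyl_X ^ i * (weyl_Y ^ j * weyl_const c)" for c :: 'a and i j
    by (simp add: mult.assoc weyl_const_commute)
  have "P (\<Sum>i<N. \<Sum>j<N. weyl_const (cf a i j) * weyl_X ^ i * weyl_Y ^ j)"
    unfolding eq using assms(1)
    by (intro conjunct2[OF sum] sum conjI Xp intg_X_power_mult intg_Y_power_mult intg_const) (auto simp: intg_def)
  then show ?thesis using weyl_expand[of N N a] N by simp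
qed

lemma intg_mult:
  assumes "a \<in> intg" "b \<in> intg"
  shows "a * b \<in> intg"
  using assms(1)
proof (induction rule: intg_induct)
  case (add a c) then show ?case by (simp add: distrib_right intg_add)
qed (simp_all add: intg_const_mult assms intg_X_mult intg_Y_mult mult.assoc)

lemma intg_1: "1 \<in> intg" using intg_const[of 1] by simp
lemma intg_X: "weyl_X \<in> intg" using intg_X_mult[OF intg_1] by simp
lemma intg_Y: "weyl_Y \<in> intg" using intg_Y_mult[OF intg_1] by simp
lemma intg_of_nat: "of_nat n \<in> intg"
  using intg_const[of "of_nat n"] by (simp add: weyl_const_of_nat)
lemma intg_power: "a \<in> intg \<Longrightarrow> a ^ n \<in> intg"
  by (induction n) (simp_all add: intg_1 intg_mult)

lemma red_add: "a \<in> intg \<Longrightarrow> b \<in> intg \<Longrightarrow> red (a + b) = red a + red b"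
  and red_diff: "a \<in> intg \<Longrightarrow> b \<in> intg \<Longrightarrow> red (a - b) = red a - red b"
  and red_const: "red (weyl_const c) = weyl_const (res c)"
  and red_const_mult: "c \<in> vring \<Longrightarrow> a \<in> intg \<Longrightarrow> red (weyl_const c * a) = weyl_const (res c) * red a"
  and red_X_mult: "red (weyl_X * a) = weyl_X * red a"
  and red_Y_mult: "a \<in> intg \<Longrightarrow> red (weyl_Y * a) = weyl_Y * red a"
  by (rule weyl_eqI; auto simp: cf_red intg_def cf_const cf_X cf_Y res_add res_diff res_mult vring_mult simp del: of_nat_Suc)+

lemma red_mult:
  assumes "a \<in> intg" "b \<in> intg"
  shows "red (a * b) = red a * red b"
  using assms(1)
proof (induction rule: intg_induct)
  case (add a c) then show ?case by (simp add: distrib_right red_add intg_mult assms)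
qed (simp_all add: red_const red_const_mult assms red_X_mult red_Y_mult mult.assoc intg_mult)

lemma red_0 [simp]: "red 0 = 0" using red_const[of 0] by simp
lemma red_1 [simp]: "red 1 = 1" using red_const[of 1] by simp
lemma red_of_nat: "red (of_nat n) = of_nat n"
  using red_const[of "of_nat n"] by (simp add: weyl_const_of_nat)
lemma red_X: "red weyl_X = weyl_X" using red_X_mult[of 1] by simp
lemma red_Y: "red weyl_Y = weyl_Y" using red_Y_mult[OF intg_1] by simp

lemma red_power: "a \<in> intg \<Longrightarrow> red (a ^ n) = red a ^ n"
  by (induction n) (simp_all add: red_mult intg_power)

lemma red_commutator: "a \<in> intg \<Longrightarrow> b \<in> intg \<Longrightarrow> red (commutator a b) = commutator (red a) (red b)"
  by (simp add: commutator_def red_diff red_mult intg_mult)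

lemma red_eq_0_iff: "a \<in> intg \<Longrightarrow> red a = 0 \<longleftrightarrow> a \<in> intg_max"
  unfolding intg_def intg_max_def
  by (auto simp: res_eq_0_iff[symmetric] simp flip: cf_red intro: weyl_eqI)

lemma intg_max_add: "a \<in> intg_max \<Longrightarrow> b \<in> intg_max \<Longrightarrow> a + b \<in> intg_max"
  and intg_max_uminus: "a \<in> intg_max \<Longrightarrow> - a \<in> intg_max"
  and intg_max_const_mult: "c \<in> vmax \<Longrightarrow> a \<in> intg \<Longrightarrow> weyl_const c * a \<in> intg_max"
  and intg_max_imp_intg: "a \<in> intg_max \<Longrightarrow> a \<in> intg"
  by (auto simp: intg_max_def intg_def intro: vmax_add vmax_uminus vmax_mult vmax_imp_vring)

lemma cf_of_nat_mult: "cf (of_nat n * a) i j = of_nat n * cf a i j"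
  using cf_simps(5)[of "of_nat n" a] by (simp add: weyl_const_of_nat)

lemma commutator_mult_of_nat: "commutator (of_nat n * a) b = of_nat n * commutator a b"
  by (simp add: commutator_def right_diff_distrib mult.assoc mult_of_nat_commute)

lemma commutator_const: "commutator (weyl_const c) a = 0" "commutator a (weyl_const c) = 0"
  by (simp_all add: commutator_def weyl_const_commute)

lemma commutator_const_mult:
  "commutator (weyl_const c * a) b = weyl_const c * commutator a b"
  by (simp add: commutator_simps commutator_const)

section \<open>The commutator of two p-th powers\<close>

context weyl_relation
begin

text \<open>Left multiplication by y is right multiplication by y plus \<open>d1\<close>, and these
  two operators commute, so the binomial formula applies.\<close>

lemma leibniz: "y ^ n * a = (\<Sum>i\<le>n. of_nat (n choose i) * ((d1 ^^ i) a * y ^ (n - i)))"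
proof (induction n arbitrary: a)
  case (Suc n)
  have ya: "y * a = a * y + d1 a" by (simp add: d1_def)
  define T where "T i = (d1 ^^ i) a * y ^ (Suc n - i)" for i
  have "y ^ Suc n * a = y ^ n * (a * y) + y ^ n * d1 a"
    by (simp only: power_Suc2 mult.assoc ya distrib_left)
  also have "y ^ n * d1 a = (\<Sum>i\<le>n. of_nat (n choose i) * T (Suc i))"
    unfolding Suc[of "d1 a"] T_def by (simp add: funpow_swap1)
  also have "y ^ n * (a * y) = (\<Sum>i\<le>n. of_nat (n choose i) * T i)"
    unfolding mult.assoc[symmetric] Suc[of a] sum_distrib_right T_def
    by (intro sum.cong refl) (simp add: mult.assoc Suc_diff_le power_commutes)
  also have "(\<Sum>i\<le>n. of_nat (n choose i) * T i) = (\<Sum>i\<le>Suc n. of_nat (n choose i) * T i)"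
    by (simp add: binomial_eq_0)
  also have "\<dots> = T 0 + (\<Sum>i\<le>n. of_nat (n choose Suc i) * T (Suc i))"
    by (subst sum.atMost_Suc_shift) simp
  also have "T 0 + (\<Sum>i\<le>n. of_nat (n choose Suc i) * T (Suc i)) + (\<Sum>i\<le>n. of_nat (n choose i) * T (Suc i)) =
      T 0 + (\<Sum>i\<le>n. of_nat (Suc n choose Suc i) * T (Suc i))"
    by (simp add: sum.distrib distrib_right add_ac)
  also have "\<dots> = (\<Sum>i\<le>Suc n. of_nat (Suc n choose i) * T i)"
    using sum.atMost_Suc_shift[of "\<lambda>i. of_nat (Suc n choose i) * T i" n]
    by (simp del: binomial_Suc_Suc sum.atMost_Suc)
  finally show ?case by (simp add: T_def)
qed simp

text \<open>In the Leibniz sum the term i = 0 cancels against x^p y^p, the term i = p is p!, and all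
  others are divisible by p^2. The remainder has natural coefficients, hence is integral when x and
  y are.\<close>

lemma commutator_powers:
  assumes "prime p"
  obtains F where "commutator (y ^ p) (x ^ p) = of_nat p * (of_nat (fact (p - 1)) + of_nat p * (\<Sum>i<p. of_nat (F i) * (x ^ (p - i) * y ^ (p - i))))"
proof -
  have p0: "p > 0" using assms prime_gt_0_nat by blast
  have d1x: "(d1 ^^ i) (x ^ p) = of_nat (\<Prod>k<i. p - k) * x ^ (p - i)" for i
    using d1_monom[of 1 i p 0] by (simp add: centralizes_def)
  \<comment> \<open>One factor p comes from the binomial coefficient, the other is the factor k = 0
    of the falling factorial.\<close>
  have ex: "\<exists>f. i > 0 \<longrightarrow> (p choose i) * (\<Prod>k<i. p - k) = p * (p * f)" if "i < p" for i
  proof (cases "i = 0")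
    case False
    then have "p dvd (p choose i)" using that assms by (intro dvd_choose_prime) auto
    moreover have "p dvd (\<Prod>k<i. p - k)"
      using False by (intro dvd_prod_eqI[of _ 0]) auto
    ultimately have "p * p dvd (p choose i) * (\<Prod>k<i. p - k)" by (rule mult_dvd_mono)
    then show ?thesis by (auto simp: mult.assoc elim!: dvdE)
  qed simp
  then obtain f where f: "\<And>i. i < p \<Longrightarrow> i > 0 \<Longrightarrow> (p choose i) * (\<Prod>k<i. p - k) = p * (p * f i)"
    by metis
  define F where "F i = (if i = 0 then 0 else f i)" for i
  have pp: "of_nat (p * (p * m)) * w = of_nat p * (of_nat p * (of_nat m * w))" for m and w :: 'a
    by (simp add: mult.assoc)
  have "y ^ p * x ^ p = (\<Sum>i\<le>p. of_nat ((p choose i) * (\<Prod>k<i. p - k)) * (x ^ (p - i) * y ^ (p - i)))"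
    unfolding leibniz[of p "x ^ p"] d1x by (simp add: mult.assoc del: of_nat_prod)
  also have "\<dots> = (\<Sum>i<p. of_nat ((p choose i) * (\<Prod>k<i. p - k)) * (x ^ (p - i) * y ^ (p - i))) + of_nat (fact p)"
    by (simp add: prod_diff_eq flip: lessThan_Suc_atMost del: of_nat_prod of_nat_fact of_nat_mult)
  also have "(\<Sum>i<p. of_nat ((p choose i) * (\<Prod>k<i. p - k)) * (x ^ (p - i) * y ^ (p - i))) =
      (\<Sum>i<p. (if i = 0 then x ^ p * y ^ p else 0) + of_nat p * (of_nat p * (of_nat (F i) * (x ^ (p - i) * y ^ (p - i)))))"
    by (intro sum.cong refl) (auto simp: f F_def pp simp del: of_nat_prod of_nat_mult)
  also have "\<dots> = x ^ p * y ^ p + of_nat p * (of_nat p * (\<Sum>i<p. of_nat (F i) * (x ^ (p - i) * y ^ (p - i))))"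
    using p0 by (simp add: sum.distrib sum_distrib_left)
  also have "fact p = p * fact (p - 1)" using p0 by (simp add: fact_reduce)
  finally have "y ^ p * x ^ p = x ^ p * y ^ p + of_nat p * (of_nat p * (\<Sum>i<p. of_nat (F i) * (x ^ (p - i) * y ^ (p - i))))
      + of_nat p * of_nat (fact (p - 1))"
    by (simp del: of_nat_fact)
  then show ?thesis by (intro that[of F]) (simp add: commutator_def distrib_left add_ac del: of_nat_fact)
qed

end

section \<open>Centrality and brackets modulo p\<close>

definition p_intg :: "'a::valued_field weyl set" where
  "p_intg = (\<lambda>a. of_nat CHAR('a resid) * a) ` intg"

definition p_intg_max :: "'a::valued_field weyl set" where
  "p_intg_max = (\<lambda>a. of_nat CHAR('a resid) * a) ` intg_max"

text \<open>Lifts of elements that are central modulo p, not only modulo \<open>vmax\<close>: the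
  bracket divides commutators by p, and \<open>vmax\<close> may be larger than the ideal generated
  by p.\<close>

definition pcentre :: "'a::valued_field weyl set" where
  "pcentre = {a \<in> intg. commutator a weyl_X \<in> p_intg \<and> commutator a weyl_Y \<in> p_intg}"

lemma p_intgI: "a \<in> intg \<Longrightarrow> of_nat CHAR('a resid) * a \<in> (p_intg :: 'a::valued_field weyl set)"
  unfolding p_intg_def by (rule imageI)

lemma p_intg_maxI: "a \<in> intg_max \<Longrightarrow> of_nat CHAR('a resid) * a \<in> (p_intg_max :: 'a::valued_field weyl set)"
  unfolding p_intg_max_def by (rule imageI)

lemma p_intg_add: "a \<in> p_intg \<Longrightarrow> b \<in> p_intg \<Longrightarrow> a + b \<in> p_intg"
  unfolding p_intg_def by (auto simp: intg_add simp flip: distrib_left)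

lemma p_intg_diff: "a \<in> p_intg \<Longrightarrow> b \<in> p_intg \<Longrightarrow> a - b \<in> p_intg"
  unfolding p_intg_def by (auto simp: intg_diff simp flip: right_diff_distrib)

lemma p_intg_mult_right: "a \<in> p_intg \<Longrightarrow> b \<in> intg \<Longrightarrow> a * b \<in> p_intg"
  unfolding p_intg_def by (auto simp: intg_mult mult.assoc)

lemma p_intg_mult_left: "b \<in> intg \<Longrightarrow> a \<in> p_intg \<Longrightarrow> b * a \<in> p_intg"
proof -
  assume b: "b \<in> intg" and "a \<in> p_intg"
  then obtain c where c: "a = of_nat CHAR('a resid) * c" "c \<in> intg" by (auto simp: p_intg_def)
  have "b * a = of_nat CHAR('a resid) * (b * c)"
    unfolding c(1) by (metis mult.assoc mult_of_nat_commute)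
  then show ?thesis using b c by (simp add: p_intgI intg_mult)
qed

lemma p_intg_0 [simp]: "0 \<in> p_intg"
  using p_intgI[OF intg_0] by simp

lemma p_intg_uminus: "a \<in> p_intg \<Longrightarrow> - a \<in> p_intg"
  using p_intg_diff[OF p_intg_0] by fastforce

lemma p_intg_max_add: "a \<in> p_intg_max \<Longrightarrow> b \<in> p_intg_max \<Longrightarrow> a + b \<in> p_intg_max"
  unfolding p_intg_max_def by (auto simp: intg_max_add simp flip: distrib_left)

lemma p_intg_max_uminus: "a \<in> p_intg_max \<Longrightarrow> - a \<in> p_intg_max"
  unfolding p_intg_max_def by (auto intro!: image_eqI[of _ _ "- _"] intg_max_uminus)

lemma p_intg_max_0 [simp]: "0 \<in> p_intg_max"
  unfolding p_intg_max_def by (rule image_eqI[of _ _ 0]) (auto simp: intg_max_def)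

lemma p_intg_max_sum: "(\<And>i. i \<in> A \<Longrightarrow> f i \<in> p_intg_max) \<Longrightarrow> sum f A \<in> p_intg_max"
  by (induction A rule: infinite_finite_induct) (simp_all add: p_intg_max_add)

lemma resid_char_gt_0: "CHAR('a::valued_field resid) > 0"
  using CHAR_resid prime_gt_0_nat by blast

lemma of_nat_resid_char_nonzero: "of_nat CHAR('a resid) \<noteq> (0 :: 'a::valued_field)"
  using resid_char_gt_0 by simp

lemma p_intg_iff: "a \<in> p_intg \<longleftrightarrow> (\<forall>i j. cf a i j / of_nat CHAR('a resid) \<in> vring)"
  for a :: "'a::valued_field weyl"
proof
  assume "a \<in> p_intg"
  then show "\<forall>i j. cf a i j / of_nat CHAR('a resid) \<in> vring"
    using of_nat_resid_char_nonzero[where 'a = 'a]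
    by (auto simp: p_intg_def intg_def cf_of_nat_mult simp del: of_nat_eq_0_iff)
next
  assume R: "\<forall>i j. cf a i j / of_nat CHAR('a resid) \<in> vring"
  define c where "c = weyl_const (inverse (of_nat CHAR('a resid))) * a"
  have "a = of_nat CHAR('a resid) * c"
    using of_nat_resid_char_nonzero[where 'a = 'a]
    by (intro weyl_eqI) (simp add: c_def cf_of_nat_mult)
  moreover have "c \<in> intg" using R by (simp add: intg_def c_def divide_inverse mult.commute)
  ultimately show "a \<in> p_intg" by (simp add: p_intgI)
qed

lemma pcentre_imp_intg: "a \<in> pcentre \<Longrightarrow> a \<in> intg"
  by (simp add: pcentre_def)

lemma pcentre_commutator:
  assumes "a \<in> pcentre" "b \<in> intg"
  shows "commutator a b \<in> p_intg"
  using assms(2)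
proof (induction rule: intg_induct)
  case (X b)
  then show ?case unfolding commutator_simps using assms(1)
    by (intro p_intg_add p_intg_mult_left p_intg_mult_right) (auto simp: pcentre_def intg_X)
next
  case (Y b)
  then show ?case unfolding commutator_simps using assms(1)
    by (intro p_intg_add p_intg_mult_left p_intg_mult_right) (auto simp: pcentre_def intg_Y)
qed (simp_all add: commutator_const commutator_simps p_intg_add)

lemma pcentre_add: "a \<in> pcentre \<Longrightarrow> b \<in> pcentre \<Longrightarrow> a + b \<in> pcentre"
  by (simp add: pcentre_def intg_add commutator_simps p_intg_add)

lemma pcentre_diff: "a \<in> pcentre \<Longrightarrow> b \<in> pcentre \<Longrightarrow> a - b \<in> pcentre"
  by (simp add: pcentre_def intg_diff commutator_simps p_intg_diff)

lemma pcentre_mult: "a \<in> pcentre \<Longrightarrow> b \<in> pcentre \<Longrightarrow> a * b \<in> pcentre"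
  by (simp add: pcentre_def intg_mult commutator_simps p_intg_add p_intg_mult_left p_intg_mult_right)

lemma pcentre_const: "c \<in> vring \<Longrightarrow> weyl_const c \<in> pcentre"
  by (simp add: pcentre_def intg_const commutator_const)

lemma of_nat_unit:
  assumes "\<not> CHAR('a resid) dvd n" "of_nat n * c / of_nat CHAR('a resid) \<in> vring"
  shows "c / of_nat CHAR('a resid) \<in> (vring :: 'a::valued_field set)"
proof -
  have "inverse (of_nat n) \<in> (vring :: 'a set)"
    using assms(1) by (intro inverse_vring) (auto simp: of_nat_in_vmax_iff)
  from vring_mult[OF this assms(2)] show ?thesis
    using assms(1) by (cases "n = 0") (simp_all add: field_simps)
qed

text \<open>Commutators with X and Y multiply coefficients by exponents. An exponent prime to p is a
  unit of \<open>vring\<close>, so divisibility by p passes to the coefficient.\<close>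

lemma pcentre_iff:
  fixes a :: "'a::valued_field weyl"
  defines "p \<equiv> CHAR('a resid)"
  shows "a \<in> pcentre \<longleftrightarrow> a \<in> intg \<and>
    (\<forall>i j. \<not> (p dvd i \<and> p dvd j) \<longrightarrow> cf a i j / of_nat p \<in> vring)"
proof -
  have YX: "commutator a weyl_Y \<in> p_intg \<longleftrightarrow> commutator weyl_Y a \<in> p_intg"
    using p_intg_uminus[of "commutator a weyl_Y"] p_intg_uminus[of "commutator weyl_Y a"]
    by (auto simp: commutator_def)
  show ?thesis
  proof
    assume a: "a \<in> pcentre"
    have "cf a i j / of_nat p \<in> vring" if ij: "\<not> (p dvd i \<and> p dvd j)" for i j
    proof (cases "p dvd j")
      case False
      then obtain k where k: "j = Suc k" by (cases j) auto
      have "of_nat j * cf a i j / of_nat p \<in> vring"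
        using a unfolding pcentre_def p_intg_iff p_def k by (auto simp flip: cf_commutator_X simp del: of_nat_Suc)
      then show ?thesis using False unfolding p_def by (rule of_nat_unit[rotated])
    next
      case True
      then obtain k where k: "i = Suc k" using ij by (cases i) auto
      have "of_nat i * cf a i j / of_nat p \<in> vring"
        using a unfolding pcentre_def mem_Collect_eq YX unfolding p_intg_iff p_def k
        by (auto simp flip: cf_commutator_Y simp del: of_nat_Suc)
      moreover have "\<not> p dvd i" using True ij by simp
      ultimately show ?thesis unfolding p_def by (rule of_nat_unit[rotated])
    qed
    then show "a \<in> intg \<and> (\<forall>i j. \<not> (p dvd i \<and> p dvd j) \<longrightarrow> cf a i j / of_nat p \<in> vring)"
      using a by (simp add: pcentre_imp_intg)
  next
    assume R: "a \<in> intg \<and> (\<forall>i j. \<not> (p dvd i \<and> p dvd j) \<longrightarrow> cf a i j / of_nat p \<in> vring)"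
    have key: "of_nat n * cf a i j / of_nat p \<in> vring" if "n = i \<or> n = j" for n i j
    proof (cases "p dvd i \<and> p dvd j")
      case True
      then have "p dvd n" using that by auto
      then obtain m where "n = p * m" ..
      then have "of_nat n * cf a i j / of_nat p = of_nat m * cf a i j"
        using of_nat_resid_char_nonzero[where 'a = 'a] by (simp add: p_def)
      then show ?thesis using R by (simp add: intg_def vring_mult)
    next
      case False
      then have "of_nat n * (cf a i j / of_nat p) \<in> vring" using R by (intro vring_mult) auto
      then show ?thesis by simp
    qed
    show "a \<in> pcentre"
      unfolding pcentre_def mem_Collect_eq YX unfolding p_intg_iff cf_commutator_X cf_commutator_Y
      using R key unfolding p_def by blast
  qed
qed

lemma weyl_exists:
  assumes "\<And>i j. i \<ge> N \<or> j \<ge> N \<Longrightarrow> h i j = 0"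
  obtains a :: "'a::field weyl" where "\<And>i j. cf a i j = h i j"
proof -
  obtain g where "\<And>i j. coeff (coeff g i) j = h i j" using poly_poly_exists[of N h] assms by blast
  then show ?thesis using that[of "nf g"] by (simp add: cf_def)
qed

lemma p_part:
  obtains b :: "'a::field weyl" where "\<And>i j. cf b i j = (if P i j then cf a i j else 0)"
proof -
  obtain N where N: "\<And>i j. i \<ge> N \<or> j \<ge> N \<Longrightarrow> cf a i j = 0" using cf_bound[of a] by blast
  obtain b where "\<And>i j. cf b i j = (if P i j then cf a i j else 0)"
    by (rule weyl_exists[of N "\<lambda>i j. if P i j then cf a i j else 0"]) (use N in auto)
  then show ?thesis by (rule that)
qed

text \<open>
  Hence \<open>[a, b] / p\<close> only depends on the reductions of \<open>a\<close> and \<open>b\<close>: it is the Poisson bracket on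
  the centre of the reduced Weyl algebra.
\<close>

lemma pcentre_bracket:
  fixes a b :: "'a::valued_field weyl"
  assumes a: "a \<in> pcentre" "a \<in> intg_max" and b: "b \<in> pcentre"
  shows "commutator a b \<in> p_intg_max"
proof -
  define p where "p = CHAR('a resid)"
  obtain a1 where a1: "\<And>i j. cf a1 i j = (if p dvd i \<and> p dvd j then cf a i j else 0)"
    using p_part[of "\<lambda>i j. p dvd i \<and> p dvd j" a] by blast
  \<comment> \<open>a is split into its monomials in X^p and Y^p and p times an integral element
    \<open>a2\<close>.\<close>
  have "a - a1 \<in> p_intg"
    using a(1) unfolding pcentre_iff p_intg_iff by (auto simp: a1 p_def)
  then obtain a2 where a2: "a - a1 = of_nat p * a2" "a2 \<in> intg"
    by (auto simp: p_intg_def p_def)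
  \<comment> \<open>b is central modulo p, so its commutator with p \<open>a2\<close> has a factor
    p^2; one of the two factors p lies in \<open>vmax\<close>.\<close>
  obtain t where t: "commutator b a2 = of_nat p * t" "t \<in> intg"
    using pcentre_commutator[OF b a2(2)] by (auto simp: p_intg_def p_def)
  have "of_nat p * t \<in> intg_max"
    using intg_max_const_mult[OF _ t(2), of "of_nat p"] by (simp add: p_def of_nat_in_vmax_iff weyl_const_of_nat)
  then have "of_nat p * (- (of_nat p * t)) \<in> p_intg_max"
    unfolding p_def by (intro p_intg_maxI intg_max_uminus)
  also have "of_nat p * (- (of_nat p * t)) = commutator (a - a1) b"
    unfolding a2(1) commutator_mult_of_nat t(1)[symmetric] by (simp add: commutator_def)
  finally have 2: "commutator (a - a1) b \<in> p_intg_max" .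
  obtain N where N: "\<And>i j. i \<ge> N \<or> j \<ge> N \<Longrightarrow> cf a1 i j = 0" using cf_bound[of a1] by blast
  \<comment> \<open>The monomials occurring in \<open>a1\<close> are central modulo p, and their
    coefficients are in \<open>vmax\<close> because a reduces to zero.\<close>
  have mon: "commutator (weyl_const (cf a1 i j) * weyl_X ^ i * weyl_Y ^ j) b \<in> p_intg_max" for i j
  proof (cases "p dvd i \<and> p dvd j")
    case False
    then have "cf a1 i j = 0" by (auto simp: a1)
    then show ?thesis by (simp add: commutator_simps(7))
  next
    case True
    have "weyl_X ^ i * weyl_Y ^ j \<in> (pcentre :: 'a weyl set)"
      unfolding pcentre_iff using True by (auto simp: p_def cf_monom intg_def)
    then obtain s where s: "commutator (weyl_X ^ i * weyl_Y ^ j) b = of_nat p * s" "s \<in> intg"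
      using pcentre_commutator[OF _ pcentre_imp_intg[OF b]] by (auto simp: p_intg_def p_def)
    have "commutator (weyl_const (cf a1 i j) * weyl_X ^ i * weyl_Y ^ j) b =
        of_nat p * (weyl_const (cf a1 i j) * s)"
      by (simp only: mult.assoc commutator_const_mult s(1)) (metis mult.assoc mult_of_nat_commute)
    moreover have "cf a1 i j \<in> vmax" using a(2) by (auto simp: a1 intg_max_def)
    ultimately show ?thesis using s(2) unfolding p_def by (auto intro!: p_intg_maxI intg_max_const_mult)
  qed
  have "commutator a1 b \<in> p_intg_max"
    by (subst weyl_expand[of N N a1]) (use N mon in \<open>auto simp: commutator_sum_left intro!: p_intg_max_sum\<close>)
  then have "commutator a1 b + commutator (a - a1) b \<in> p_intg_max" using 2 by (rule p_intg_max_add)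
  then show ?thesis by (simp add: commutator_simps)
qed

lemma exists_dominant:
  fixes f :: "'i \<Rightarrow> 'a::valued_field"
  assumes "finite S" "S \<noteq> {}" "\<And>s. s \<in> S \<Longrightarrow> f s \<noteq> 0"
  shows "\<exists>t\<in>S. \<forall>s\<in>S. f s / f t \<in> vring"
  using assms
proof (induction S rule: finite_ne_induct)
  case (insert i S)
  then obtain t where t: "t \<in> S" "\<And>s. s \<in> S \<Longrightarrow> f s / f t \<in> vring" by auto
  have nz: "f t \<noteq> 0" "f i \<noteq> 0" using insert.prems t by auto
  show ?case
  proof (cases "f i / f t \<in> vring")
    case True
    then show ?thesis using t by auto
  next
    case False
    then have *: "f t / f i \<in> vring" using vring_total[of "f i / f t"] by simp
    have "f s / f i \<in> vring" if "s \<in> S" for s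
      using vring_mult[OF t(2)[OF that] *] nz by simp
    then show ?thesis using nz by auto
  qed
qed auto

section \<open>Integral pairs and the bracket of their p-th powers\<close>

locale integral_pair = weyl_relation x y for x y :: "'a::closed_valued_field weyl" +
  fixes p :: nat
  assumes x: "x \<in> intg" and y: "y \<in> intg" and p: "p = CHAR('a resid)"
begin

lemma prime_p: "prime p"
  unfolding p by (rule CHAR_resid)

sublocale R: weyl_pair "red x" "red y" p
proof
  have "red (y * x) = red (x * y + 1)" by (simp only: yx)
  then show "red y * red x = red x * red y + 1"
    using x y by (simp add: red_add red_mult intg_mult intg_1)
qed (use prime_p prime_gt_0_nat in \<open>auto simp: p\<close>)

text \<open>
  If \<open>w\<close> is not central modulo \<open>p\<close>, divide its part without \<open>p\<close>-th powers by a coefficient of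
  largest absolute value.  The reduction of the quotient centralizes \<open>x\<close> and \<open>y\<close>, so it is central,
  which contradicts that it has no monomials in \<open>X\<^sup>p\<close> and \<open>Y\<^sup>p\<close>.
\<close>

lemma pcentreI:
  assumes w: "w \<in> intg" and wx: "commutator w x \<in> p_intg" and wy: "commutator w y \<in> p_intg"
  shows "w \<in> pcentre"
proof (rule ccontr)
  assume nw: "w \<notin> pcentre"
  obtain z where z: "\<And>i j. cf z i j = (if p dvd i \<and> p dvd j then cf w i j else 0)"
    using p_part[of "\<lambda>i j. p dvd i \<and> p dvd j" w] by blast
  have zp: "z \<in> pcentre"
    unfolding pcentre_iff using w by (auto simp: z p[symmetric] intg_def)
  define b where "b = w - z"
  have b: "cf b i j = (if p dvd i \<and> p dvd j then 0 else cf w i j)" for i j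
    by (simp add: b_def z)
  define S where "S = {s. cf b (fst s) (snd s) \<noteq> 0}"
  obtain N where N: "\<And>i j. i \<ge> N \<or> j \<ge> N \<Longrightarrow> cf b i j = 0" using cf_bound[of b] by blast
  have "S \<subseteq> {..<N} \<times> {..<N}" using N by (force simp: S_def not_le)
  then have "finite S" by (rule finite_subset) simp
  moreover have "S \<noteq> {}"
  proof
    assume "S = {}"
    then have "cf w i j = 0" if "\<not> (p dvd i \<and> p dvd j)" for i j
      using that b[of i j] by (force simp: S_def)
    then show False using nw w unfolding pcentre_iff p[symmetric] by auto
  qed
  ultimately obtain s where s: "s \<in> S" "\<And>r. r \<in> S \<Longrightarrow> cf b (fst r) (snd r) / cf b (fst s) (snd s) \<in> vring"
    using exists_dominant[of S "\<lambda>r. cf b (fst r) (snd r)"] unfolding S_def by blast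
  define c where "c = cf b (fst s) (snd s)"
  have c0: "c \<noteq> 0" using s(1) by (simp add: c_def S_def)
  have div: "cf b i j / c \<in> vring" for i j
    using s(2)[of "(i, j)"] by (cases "cf b i j = 0") (auto simp: S_def c_def)
  \<comment> \<open>Otherwise c/p is integral and, c being dominant, every coefficient of
    \<open>b\<close> is divisible by p, which makes w central modulo p.\<close>
  have pc: "of_nat p / c \<in> vmax"
  proof (rule ccontr)
    assume "of_nat p / c \<notin> vmax"
    moreover have "of_nat p \<noteq> (0 :: 'a)" using p prime_p prime_gt_0_nat by auto
    ultimately have "c / of_nat p \<in> vring"
      using inverse_vring[of "of_nat p / c"] vring_total[of "c / of_nat p"] by auto
    then have "cf b i j / of_nat p \<in> vring" for i j
      using vring_mult[OF div[of i j]] c0 by fastforce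
    then have "w \<in> pcentre" using w b unfolding pcentre_iff p[symmetric] by metis
    then show False using nw by simp
  qed
  define b' where "b' = weyl_const (inverse c) * b"
  have b': "b' \<in> intg" using div by (simp add: b'_def intg_def divide_inverse mult.commute)
  have comm: "commutator b' t \<in> intg_max" if "t \<in> intg" "commutator w t \<in> p_intg" for t
  proof -
    have "commutator b t \<in> p_intg"
      unfolding b_def commutator_simps using that pcentre_commutator[OF zp] by (intro p_intg_diff)
    then obtain r where r: "commutator b t = of_nat p * r" "r \<in> intg" by (auto simp: p_intg_def p)
    have "commutator b' t = weyl_const (inverse c) * weyl_const (of_nat p) * r"
      unfolding b'_def commutator_const_mult r(1) by (simp add: weyl_const_of_nat mult.assoc)
    also have "\<dots> = weyl_const (of_nat p / c) * r"
      by (simp only: weyl_const_mult[symmetric] divide_inverse mult.commute)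
    finally have "commutator b' t = weyl_const (of_nat p / c) * r" .
    then show ?thesis using pc r(2) by (simp add: intg_max_const_mult)
  qed
  have "commutator (red b') (red t) = 0" if "t \<in> intg" "commutator w t \<in> p_intg" for t
    using comm[OF that] red_eq_0_iff[OF intg_max_imp_intg[OF comm[OF that]]]
    by (simp add: red_commutator b' that)
  then have "R.centralizes (red b')"
    using x y wx wy by (simp add: R.centralizes_def commutator_def)
  then obtain f where f: "red b' = zeta f" using R.centralizer_eq_centre by blast
  have "commutator (red b') a = 0" for a
    unfolding f by (simp add: commutator_def R.zeta_central)
  \<comment> \<open>A central element has zero derivatives, yet \<open>s\<close> has an exponent
    prime to p and the coefficient there was normalized to 1.\<close>
  then have 0: "of_nat (Suc j) * cf (red b') i (Suc j) = 0" "of_nat (Suc i) * cf (red b') (Suc i) j = 0" for i j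
    using cf_commutator_X[of "red b'" i j] cf_commutator_Y[of "red b'" i j] by (simp_all add: commutator_def)
  obtain i j where ij: "s = (i, j)" by (cases s)
  have nd: "\<not> (p dvd i \<and> p dvd j)" using s(1) b[of i j] by (auto simp: S_def ij)
  have "cf b' i j = 1" using c0 by (simp add: b'_def c_def ij)
  then have 1: "cf (red b') i j = 1" by (simp add: cf_red)
  have of0: "of_nat n = (0 :: 'a resid) \<longleftrightarrow> p dvd n" for n
    by (simp add: of_nat_eq_0_iff_char_dvd p)
  show False
  proof (cases "p dvd j")
    case True
    then obtain k where "i = Suc k" using nd by (cases i) auto
    then show False using 0(2)[of k j] 1 of0[of i] True nd by auto
  next
    case False
    then obtain k where "j = Suc k" by (cases j) auto
    then show False using 0(1)[of k i] 1 of0[of j] False by auto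
  qed
qed

text \<open>Only the commutators with x and y are explicit multiples of p; \<open>pcentreI\<close>
  transfers this to the generators X and Y.\<close>

lemma pth_powers_pcentre: "x ^ p \<in> pcentre" "y ^ p \<in> pcentre"
proof -
  have "commutator (x ^ p) x = 0" "commutator (y ^ p) y = 0"
    by (simp_all add: commutator_def power_commutes)
  moreover have "commutator (x ^ p) y = - (of_nat p * x ^ (p - 1))" "commutator (y ^ p) x = of_nat p * y ^ (p - 1)"
    using y_x_power[of p] y_power_x[of p] by (simp_all add: commutator_def)
  moreover have "of_nat p * x ^ (p - 1) \<in> p_intg" "of_nat p * y ^ (p - 1) \<in> p_intg"
    using x y unfolding p by (auto intro!: p_intgI intg_power)
  ultimately show "x ^ p \<in> pcentre" "y ^ p \<in> pcentre"
    using x y by (auto intro!: pcentreI intg_power p_intg_uminus simp del: One_nat_def)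
qed

lemma zeta_lift: "\<exists>a\<in>pcentre. red a = zeta (f :: 'a resid poly poly)"
proof -
  have XY: "weyl_X ^ p \<in> (pcentre :: 'a weyl set)" "weyl_Y ^ p \<in> (pcentre :: 'a weyl set)"
    using cf_monom[of p 0, where 'a = 'a] cf_monom[of 0 p, where 'a = 'a]
    unfolding pcentre_iff by (auto simp: p intg_def)
  have Y: "\<exists>a\<in>pcentre. red a = evy weyl_const (weyl_Y ^ p) q" for q :: "'a resid poly"
  proof (induction q)
    case 0
    then show ?case using pcentre_const[of 0] by (intro bexI[of _ 0]) auto
  next
    case (pCons c q)
    then obtain a where a: "a \<in> pcentre" "red a = evy weyl_const (weyl_Y ^ p) q" by blast
    obtain d where d: "d \<in> vring" "res d = c" using res_surj by blast
    have "weyl_const d + weyl_Y ^ p * a \<in> pcentre"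
      by (intro pcentre_add pcentre_const pcentre_mult d a XY)
    moreover have "red (weyl_const d + weyl_Y ^ p * a) = evy weyl_const (weyl_Y ^ p) (pCons c q)"
      using a d by (simp add: evc_simps red_add red_mult red_power red_const red_Y intg_Y intg_power intg_const
        intg_mult pcentre_imp_intg)
    ultimately show ?case by blast
  qed
  show ?thesis
  proof (induction f)
    case 0
    then show ?case using pcentre_const[of 0] by (intro bexI[of _ 0]) (auto simp: R.zeta_simps)
  next
    case (pCons q f)
    then obtain a where a: "a \<in> pcentre" "red a = zeta f" by blast
    obtain b where b: "b \<in> pcentre" "red b = evy weyl_const (weyl_Y ^ p) q" using Y by blast
    have "b + weyl_X ^ p * a \<in> pcentre"
      by (intro pcentre_add pcentre_mult a b XY)
    moreover have "red (b + weyl_X ^ p * a) = zeta (pCons q f)"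
      using a b by (simp add: R.zeta_altdef evc_simps red_add red_mult red_power red_X intg_X intg_power
        intg_mult pcentre_imp_intg)
    ultimately show ?case by blast
  qed
qed

text \<open>With lifts of the factors, x^p = l + P Z + a and y^p = m + P W + b, where a and b reduce
  to 0 and hence do not contribute to the reduced bracket. The bracket of P W and P Z is a multiple
  of P, so \<pi> divides the unit (p - 1)!.\<close>

lemma no_critical:
  assumes u: "zeta u = red x ^ p" and v: "zeta v = red y ^ p" and "prime_elem \<pi>"
    and "\<pi> dvd u - cst \<xi>" "\<pi> dvd v - cst \<mu>"
  shows False
proof -
  obtain f g where f: "u - cst \<xi> = \<pi> * f" and g: "v - cst \<mu> = \<pi> * g"
    using assms(4,5) by (auto elim!: dvdE)
  obtain P Z W where P: "P \<in> pcentre" "red P = zeta \<pi>" and Z: "Z \<in> pcentre" "red Z = zeta f"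
    and W: "W \<in> pcentre" "red W = zeta g"
    using zeta_lift by metis
  obtain l m where l: "l \<in> vring" "res l = \<xi>" and m: "m \<in> vring" "res m = \<mu>"
    using res_surj by metis
  define a where "a = x ^ p - weyl_const l - P * Z"
  define b where "b = y ^ p - weyl_const m - P * W"
  have PZ: "P * Z \<in> pcentre" and PW: "P * W \<in> pcentre" using P Z W by (auto intro: pcentre_mult)
  have a: "a \<in> pcentre" and b: "b \<in> pcentre"
    unfolding a_def b_def by (intro pcentre_diff pth_powers_pcentre pcentre_const l m PZ PW)+
  note [simp] = pcentre_imp_intg intg_const intg_power intg_diff intg_mult x y l m P Z W
    red_diff red_mult red_power red_const
  have "red a = red x ^ p - weyl_const \<xi> - zeta \<pi> * zeta f"
    unfolding a_def by simp
  also have "\<dots> = zeta (u - cst \<xi> - \<pi> * f)" by (simp only: R.zeta_simps u)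
  finally have "a \<in> intg_max" using a f by (simp add: red_eq_0_iff[symmetric] R.zeta_simps)
  have "red b = red y ^ p - weyl_const \<mu> - zeta \<pi> * zeta g"
    unfolding b_def by simp
  also have "\<dots> = zeta (v - cst \<mu> - \<pi> * g)" by (simp only: R.zeta_simps v)
  finally have "b \<in> intg_max" using b g by (simp add: red_eq_0_iff[symmetric] R.zeta_simps)
  have "commutator (y ^ p) (x ^ p) = commutator (P * W + b) (P * Z + a)"
  proof -
    have "y ^ p = weyl_const m + (P * W + b)" "x ^ p = weyl_const l + (P * Z + a)"
      by (simp_all add: a_def b_def)
    then show ?thesis by (simp only: commutator_simps commutator_const) simp
  qed
  also have "\<dots> = commutator (P * W) (P * Z) + (commutator (P * W) a + commutator b (P * Z + a))"
    by (simp only: commutator_simps(1) commutator_simps(2)[of "P * W"] add.assoc)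
  finally have c: "commutator (y ^ p) (x ^ p) =
      commutator (P * W) (P * Z) + (commutator (P * W) a + commutator b (P * Z + a))" .
  have "commutator (P * W) a = - commutator a (P * W)" by (simp add: commutator_def)
  then have "commutator (P * W) a + commutator b (P * Z + a) \<in> p_intg_max"
    using pcentre_bracket[OF a \<open>a \<in> intg_max\<close> PW]
      pcentre_bracket[OF b \<open>b \<in> intg_max\<close> pcentre_add[OF PZ a]]
    by (metis p_intg_max_add p_intg_max_uminus)
  then obtain r where r: "r \<in> intg_max" "commutator (P * W) a + commutator b (P * Z + a) = of_nat p * r"
    by (auto simp: p_intg_max_def p)
  obtain t1 where t1: "t1 \<in> intg" "commutator W (P * Z) = of_nat p * t1"
    using pcentre_commutator[OF W(1), of "P * Z"] by (auto simp: p_intg_def p)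
  obtain t2 where t2: "t2 \<in> intg" "commutator P Z = of_nat p * t2"
    using pcentre_commutator[OF P(1), of "Z"] by (auto simp: p_intg_def p)
  have Pp: "P * (of_nat p * s) = of_nat p * (P * s)" for s
    by (metis mult.assoc mult_of_nat_commute)
  \<comment> \<open>By the Leibniz rule and [P, P] = 0 a factor P remains in every term.\<close>
  have "commutator (P * W) (P * Z) = P * commutator W (P * Z) + P * commutator P Z * W"
    by (simp only: commutator_simps(5)[of P W "P * Z"] commutator_simps(6)[of P P Z] commutator_simps(9)
        mult_zero_left add_0)
  also have "\<dots> = of_nat p * (P * (t1 + t2 * W))"
    unfolding t1(2) t2(2)
    by (simp add: distrib_left mult.assoc Pp)
  finally have c': "commutator (y ^ p) (x ^ p) = of_nat p * (P * (t1 + t2 * W) + r)"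
    unfolding c r(2) by (simp add: distrib_left)
  obtain F where F: "commutator (y ^ p) (x ^ p) = of_nat p * (of_nat (fact (p - 1)) +
      of_nat p * (\<Sum>i<p. of_nat (F i) * (x ^ (p - i) * y ^ (p - i))))"
    using commutator_powers[OF prime_p] by blast
  define S where "S = (\<Sum>i<p. of_nat (F i) * (x ^ (p - i) * y ^ (p - i)))"
  have S: "S \<in> intg" unfolding S_def by (intro intg_sum intg_mult intg_of_nat intg_power x y)
  have "(of_nat p :: 'a weyl) = weyl_const (of_nat p)" by (simp add: weyl_const_of_nat)
  moreover have "(of_nat p :: 'a) \<noteq> 0" using prime_p prime_gt_0_nat by auto
  ultimately have p0: "(of_nat p :: 'a weyl) \<noteq> 0" by (simp only: weyl_const_eq_0_iff not_False_eq_True)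
  \<comment> \<open>p is cancelled in characteristic zero, before the equation is reduced;
    afterwards it would be zero.\<close>
  have "of_nat (fact (p - 1)) + of_nat p * S = P * (t1 + t2 * W) + r"
    using c' p0 unfolding F S_def[symmetric] by (simp only: mult_cancel_left) simp
  then have "red (of_nat (fact (p - 1)) + of_nat p * S) = red (P * (t1 + t2 * W) + r)" by simp
  moreover have "red (of_nat (fact (p - 1)) + of_nat p * S) = of_nat (fact (p - 1))"
  proof -
    have "of_nat p = (0 :: 'a resid weyl)" by (simp only: R.of_nat_weyl_eq_0_iff dvd_refl)
    then show ?thesis using S by (simp add: red_add intg_of_nat red_of_nat del: of_nat_fact)
  qed
  moreover have "red (P * (t1 + t2 * W) + r) = zeta \<pi> * red (t1 + t2 * W)"
  proof -
    have "red r = 0" using r(1) by (simp add: red_eq_0_iff intg_max_imp_intg)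
    then show ?thesis using t1(1) t2(1) r(1) by (simp add: red_add intg_add intg_max_imp_intg)
  qed
  ultimately have "zeta \<pi> * red (t1 + t2 * W) = of_nat (fact (p - 1))" by simp
  also have "\<dots> = zeta (cst (of_nat (fact (p - 1))))"
    by (simp only: R.zeta_simps weyl_const_of_nat)
  finally obtain e where e: "\<pi> * e = cst (of_nat (fact (p - 1)))"
    using R.zeta_saturated[of \<pi>] \<open>prime_elem \<pi>\<close> by force
  have "\<not> p dvd fact (p - 1)"
    using prime_p prime_gt_0_nat[OF prime_p] by (subst prime_dvd_fact_iff) auto
  then have "of_nat (fact (p - 1)) \<noteq> (0 :: 'a resid)" by (simp only: of_nat_eq_0_iff_char_dvd p[symmetric] not_False_eq_True)
  then have "is_unit (\<pi> * e)" unfolding e by (simp add: is_unit_const_poly_iff dvd_field_iff del: of_nat_fact)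
  then show False using \<open>prime_elem \<pi>\<close> by (simp add: is_unit_mult_iff prime_elem_not_unit)
qed

sublocale R: weyl_pair_closed "red x" "red y" p
  by standard (rule no_critical)

end

section \<open>Existence of valuation rings\<close>

definition subring_set :: "'a::comm_ring_1 set \<Rightarrow> bool" where
  "subring_set A \<longleftrightarrow> 1 \<in> A \<and> (\<forall>a\<in>A. \<forall>b\<in>A. a - b \<in> A \<and> a * b \<in> A)"

definition coeffs_in :: "'a::zero set \<Rightarrow> 'a poly \<Rightarrow> bool" where
  "coeffs_in A f \<longleftrightarrow> (\<forall>i. coeff f i \<in> A)"

definition adjoin :: "'a::comm_ring_1 set \<Rightarrow> 'a \<Rightarrow> 'a set" where
  "adjoin A b = {poly f b | f. coeffs_in A f}"

locale subring_locale =
  fixes A :: "'a::comm_ring_1 set"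
  assumes subring_set: "subring_set A"
begin

lemma one_mem: "1 \<in> A" and diff_mem: "a \<in> A \<Longrightarrow> b \<in> A \<Longrightarrow> a - b \<in> A"
  and mult_mem: "a \<in> A \<Longrightarrow> b \<in> A \<Longrightarrow> a * b \<in> A"
  using subring_set by (auto simp: subring_set_def)

lemma zero_mem: "0 \<in> A" using diff_mem[OF one_mem one_mem] by simp
lemma uminus_mem: "a \<in> A \<Longrightarrow> - a \<in> A" using diff_mem[OF zero_mem, of a] by simp
lemma add_mem: "a \<in> A \<Longrightarrow> b \<in> A \<Longrightarrow> a + b \<in> A" using diff_mem[OF _ uminus_mem[of b], of a] by simp
lemma power_mem: "a \<in> A \<Longrightarrow> a ^ n \<in> A" by (induction n) (simp_all add: one_mem mult_mem)
lemma of_nat_mem: "of_nat n \<in> A" by (induction n) (simp_all add: zero_mem one_mem add_mem)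
lemma sum_mem: "(\<And>i. i \<in> I \<Longrightarrow> f i \<in> A) \<Longrightarrow> sum f I \<in> A"
  by (induction I rule: infinite_finite_induct) (simp_all add: zero_mem add_mem)
lemma prod_mem: "(\<And>i. i \<in> I \<Longrightarrow> f i \<in> A) \<Longrightarrow> prod f I \<in> A"
  by (induction I rule: infinite_finite_induct) (simp_all add: one_mem mult_mem)

lemma coeffs_in_diff: "coeffs_in A f \<Longrightarrow> coeffs_in A g \<Longrightarrow> coeffs_in A (f - g)"
  and coeffs_in_add: "coeffs_in A f \<Longrightarrow> coeffs_in A g \<Longrightarrow> coeffs_in A (f + g)"
  and coeffs_in_smult: "c \<in> A \<Longrightarrow> coeffs_in A f \<Longrightarrow> coeffs_in A (smult c f)"
  and coeffs_in_mult: "coeffs_in A f \<Longrightarrow> coeffs_in A g \<Longrightarrow> coeffs_in A (f * g)"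
  and coeffs_in_monom: "c \<in> A \<Longrightarrow> coeffs_in A (monom c n)"
  and coeffs_in_const: "c \<in> A \<Longrightarrow> coeffs_in A [:c:]"
  by (auto simp: coeffs_in_def diff_mem add_mem mult_mem coeff_mult zero_mem coeff_pCons split: nat.split intro!: sum_mem)

lemma coeffs_in_sum: "(\<And>i. i \<in> I \<Longrightarrow> coeffs_in A (f i)) \<Longrightarrow> coeffs_in A (sum f I)"
  by (induction I rule: infinite_finite_induct) (simp_all add: coeffs_in_add coeffs_in_const[OF zero_mem, simplified])

lemma coeffs_in_power: "coeffs_in A f \<Longrightarrow> coeffs_in A (f ^ n)"
  using coeffs_in_const[OF one_mem] by (induction n) (simp_all add: coeffs_in_mult one_pCons)

lemma subring_adjoin: "subring_set (adjoin A b)"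
  unfolding subring_set_def
proof (intro conjI ballI)
  show "1 \<in> adjoin A b" unfolding adjoin_def using coeffs_in_const[OF one_mem] by (intro CollectI exI[of _ "[:1:]"]) auto
next
  fix u v assume "u \<in> adjoin A b" "v \<in> adjoin A b"
  then obtain f g where "u = poly f b" "coeffs_in A f" "v = poly g b" "coeffs_in A g" by (auto simp: adjoin_def)
  then have "u - v = poly (f - g) b \<and> coeffs_in A (f - g)" "u * v = poly (f * g) b \<and> coeffs_in A (f * g)"
    by (simp_all add: coeffs_in_diff coeffs_in_mult)
  then show "u - v \<in> adjoin A b" "u * v \<in> adjoin A b"
    unfolding adjoin_def by blast+
qed

lemma subset_adjoin: "A \<subseteq> adjoin A b"
  unfolding adjoin_def
proof
  fix a assume "a \<in> A"
  then show "a \<in> {poly f b |f. coeffs_in A f}" by (intro CollectI exI[of _ "[:a:]"]) (simp add: coeffs_in_const)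
qed

lemma mem_adjoin: "b \<in> adjoin A b"
  unfolding adjoin_def using coeffs_in_monom[OF one_mem, of 1]
  by (intro CollectI exI[of _ "monom 1 1"]) (simp add: poly_monom)

end

lemma coeffs_in_mono: "A \<subseteq> B \<Longrightarrow> coeffs_in A f \<Longrightarrow> coeffs_in B f"
  by (auto simp: coeffs_in_def)

lemma clear_denominator:
  fixes h :: "'a::field"
  assumes "subring_set A" "h \<in> A" "h \<noteq> 0" "c \<in> adjoin A (inverse h)"
  shows "\<exists>n. h ^ n * c \<in> A"
proof -
  interpret subring_locale A by standard fact
  obtain f where f: "c = poly f (inverse h)" "coeffs_in A f" using assms(4) by (auto simp: adjoin_def)
  have "h ^ degree f * c = (\<Sum>i\<le>degree f. coeff f i * h ^ (degree f - i))"
    unfolding f(1) poly_altdef sum_distrib_left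
  proof (intro sum.cong refl)
    fix i assume "i \<in> {..degree f}"
    then have "h ^ degree f = h ^ (degree f - i) * h ^ i" by (simp flip: power_add)
    then show "h ^ degree f * (coeff f i * inverse h ^ i) = coeff f i * h ^ (degree f - i)"
      using assms(3) by (simp add: field_simps)
  qed
  moreover have "(\<Sum>i\<le>degree f. coeff f i * h ^ (degree f - i)) \<in> A"
    using f(2) assms(2) by (intro sum_mem mult_mem power_mem) (auto simp: coeffs_in_def)
  ultimately show ?thesis by (intro exI[of _ "degree f"]) simp
qed

text \<open>The relation for 1/x, multiplied by t, expresses the unit 1 - t g_0 through negative
  powers of x. Multiplied by x^n it writes x^n in lower powers with coefficients in V, and this
  replaces the leading term of f.\<close>

lemma reduce_degree:
  fixes t x :: "'a::field"
  assumes V: "subring_set V" and t: "t \<in> V" "t \<noteq> 0" "inverse t \<notin> V"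
    and unit: "\<And>c. c \<in> V \<Longrightarrow> inverse (1 - t * c) \<in> V"
    and x0: "x \<noteq> 0"
    and f: "coeffs_in V f" "poly f x = inverse t"
    and g: "coeffs_in V g" "poly g (inverse x) = inverse t" "degree g \<le> degree f"
  shows "\<exists>f'. coeffs_in V f' \<and> poly f' x = inverse t \<and> degree f' < degree f"
proof -
  interpret subring_locale V by standard fact
  define n where "n = degree f"
  define m where "m = degree g"
  define w where "w = inverse (1 - t * coeff g 0)"
  have fV: "coeff f i \<in> V" and gV: "coeff g i \<in> V" for i using f g by (auto simp: coeffs_in_def)
  have wV: "w \<in> V" unfolding w_def by (intro unit gV)
  have ne: "1 - t * coeff g 0 \<noteq> 0"
  proof
    assume "1 - t * coeff g 0 = 0"
    then have "coeff g 0 = inverse t" using t(2) by (simp add: field_simps)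
    then show False using gV[of 0] t(3) by simp
  qed
  have n0: "n > 0"
  proof (rule ccontr)
    assume "\<not> n > 0"
    then obtain c where "f = [:c:]" unfolding n_def by (metis degree_eq_zeroE gr0I)
    then show False using f fV[of 0] t(3) by simp
  qed
  have "1 = t * poly g (inverse x)" using g(2) t(2) by simp
  also have "poly g (inverse x) = coeff g 0 + (\<Sum>i=1..m. coeff g i * inverse x ^ i)"
    unfolding poly_altdef m_def by (simp add: sum.atMost_shift sum.atLeast1_atMost_eq lessThan_Suc_atMost)
  finally have "1 - t * coeff g 0 = t * (\<Sum>i=1..m. coeff g i * inverse x ^ i)" by (simp add: algebra_simps)
  then have one: "1 = w * t * (\<Sum>i=1..m. coeff g i * inverse x ^ i)"
    unfolding w_def using ne by (simp add: field_simps)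
  define h where "h i = w * t * coeff g i" for i
  have hV: "h i \<in> V" for i unfolding h_def by (intro mult_mem wV t gV)
  have "x ^ n = (\<Sum>i=1..m. h i * inverse x ^ i) * x ^ n"
    using one unfolding h_def by (simp add: sum_distrib_left mult.assoc)
  also have "\<dots> = (\<Sum>i=1..m. h i * x ^ (n - i))"
    unfolding sum_distrib_right
  proof (intro sum.cong refl)
    fix i assume "i \<in> {1..m}"
    then have "x ^ n = x ^ (n - i) * x ^ i" using g(3) by (simp add: n_def m_def flip: power_add)
    then show "h i * inverse x ^ i * x ^ n = h i * x ^ (n - i)" using x0 by (simp add: field_simps)
  qed
  finally have xn: "x ^ n = (\<Sum>i=1..m. h i * x ^ (n - i))" .
  define f' where "f' = (\<Sum>i<n. monom (coeff f i) i) + (\<Sum>i=1..m. monom (coeff f n * h i) (n - i))"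
  have "coeffs_in V f'" unfolding f'_def by (intro coeffs_in_add coeffs_in_sum coeffs_in_monom mult_mem fV hV)
  moreover have "poly f' x = poly f x"
  proof -
    have "poly f x = (\<Sum>i<n. coeff f i * x ^ i) + coeff f n * x ^ n"
      unfolding poly_altdef n_def by (simp flip: lessThan_Suc_atMost)
    also have "\<dots> = poly f' x" unfolding xn f'_def
      by (simp add: poly_sum poly_monom sum_distrib_left mult.assoc)
    finally show ?thesis ..
  qed
  moreover have "degree f' \<le> n - 1"
    unfolding f'_def by (intro degree_add_le degree_sum_le) (auto intro!: order.trans[OF degree_monom_le])
  ultimately show ?thesis using f(2) n0 unfolding n_def by (intro exI[of _ f']) auto
qed

text \<open>A maximal subring among those which do not contain \<open>1/t\<close> is a valuation ring.\<close>

lemma chevalley: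
  fixes t :: "'a::field"
  assumes A: "subring_set A" and t: "t \<in> A" "inverse t \<notin> A"
  obtains V where "valuation_subring V" "A \<subseteq> V" "inverse t \<notin> V"
proof -
  define \<A> where "\<A> = {B. subring_set B \<and> A \<subseteq> B \<and> inverse t \<notin> B}"
  have "\<exists>M\<in>\<A>. \<forall>B\<in>\<A>. M \<subseteq> B \<longrightarrow> B = M"
  proof (rule subset_Zorn_nonempty)
    show "\<A> \<noteq> {}" using A t by (auto simp: \<A>_def)
  next
    fix C assume C: "C \<noteq> {}" "subset.chain \<A> C"
    have "subring_set (\<Union>C)" unfolding subring_set_def
    proof (intro conjI ballI)
      show "1 \<in> \<Union>C" using C by (auto simp: subset_chain_def \<A>_def subring_set_def)
    next
      fix a b assume "a \<in> \<Union>C" "b \<in> \<Union>C"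
      then obtain B where "B \<in> C" "a \<in> B" "b \<in> B" using C(2) unfolding subset_chain_def by blast
      then show "a - b \<in> \<Union>C" "a * b \<in> \<Union>C"
        using C(2) unfolding subset_chain_def \<A>_def subring_set_def by blast+
    qed
    then show "\<Union>C \<in> \<A>" using C unfolding subset_chain_def \<A>_def by blast
  qed
  then obtain V where V: "subring_set V" "A \<subseteq> V" "inverse t \<notin> V"
    and max: "\<And>B. subring_set B \<Longrightarrow> V \<subseteq> B \<Longrightarrow> inverse t \<notin> B \<Longrightarrow> B = V"
    by (auto simp: \<A>_def)
  interpret subring_locale V by standard fact
  have t0: "t \<noteq> 0" using V(3) zero_mem by auto
  have tV: "t \<in> V" using V t by auto
  have adj: "inverse t \<in> adjoin V b" if "b \<notin> V" for b
    using max[OF subring_adjoin subset_adjoin] mem_adjoin that by metis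
  \<comment> \<open>Clearing denominators turns 1/t in V[1/(1 - t c)] into (1 - t d)/t in V for some
    d in V, which would put 1/t into V.\<close>
  have unit: "inverse (1 - t * c) \<in> V" if c: "c \<in> V" for c
  proof (rule ccontr)
    assume "inverse (1 - t * c) \<notin> V"
    then have *: "inverse t \<in> adjoin V (inverse (1 - t * c))" by (rule adj)
    have "1 - t * c \<noteq> 0"
    proof
      assume "1 - t * c = 0"
      then have "c = inverse t" using t0 by (simp add: field_simps)
      then show False using c V(3) by simp
    qed
    moreover have "1 - t * c \<in> V" by (intro diff_mem one_mem mult_mem tV c)
    ultimately obtain n where n: "(1 - t * c) ^ n * inverse t \<in> V" using clear_denominator[OF V(1) _ _ *] by blast
    have "\<exists>d\<in>V. (1 - t * c) ^ n = 1 - t * d"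
    proof (induction n)
      case 0
      then show ?case using zero_mem by (intro bexI[of _ 0]) auto
    next
      case (Suc n)
      then obtain d where d: "d \<in> V" "(1 - t * c) ^ n = 1 - t * d" by blast
      have "(1 - t * c) ^ Suc n = (1 - t * c) * (1 - t * d)" by (simp add: d(2))
      also have "\<dots> = 1 - t * (c + d - t * c * d)" by (simp add: algebra_simps)
      finally show ?case using c tV d(1)
        by (intro bexI[of _ "c + d - t * c * d"] diff_mem add_mem mult_mem)
    qed
    then obtain d where d: "d \<in> V" "(1 - t * c) ^ n = 1 - t * d" by blast
    have "(1 - t * c) ^ n * inverse t + d \<in> V" using n d(1) by (rule add_mem)
    also have "(1 - t * c) ^ n * inverse t + d = inverse t" unfolding d(2) using t0 by (simp add: field_simps)
    finally show False using V(3) by simp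
  qed
  have "x \<in> V \<or> inverse x \<in> V" for x
  proof (rule ccontr)
    assume "\<not> (x \<in> V \<or> inverse x \<in> V)"
    then have x: "x \<notin> V" "inverse x \<notin> V" by auto
    then have x0: "x \<noteq> 0" using zero_mem by auto
    define Q where "Q z f \<longleftrightarrow> coeffs_in V f \<and> poly f z = inverse t" for z f
    \<comment> \<open>Both V[x] and V[1/x] contain 1/t. Expressions of least degree are taken;
      \<open>reduce_degree\<close> shortens the one whose degree is not smaller.\<close>
    have min: "\<exists>f. Q z f \<and> (\<forall>g. Q z g \<longrightarrow> degree f \<le> degree g)" if "z \<notin> V" for z
    proof -
      have "\<exists>f. Q z f" using adj[OF that] by (auto simp: adjoin_def Q_def)
      then show ?thesis using ex_has_least_nat[of "Q z" _ degree] by blast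
    qed
    obtain f where f: "Q x f" "\<And>g. Q x g \<Longrightarrow> degree f \<le> degree g" using min[OF x(1)] by blast
    obtain g where g: "Q (inverse x) g" "\<And>f. Q (inverse x) f \<Longrightarrow> degree g \<le> degree f" using min[OF x(2)] by blast
    show False
    proof (cases "degree g \<le> degree f")
      case True
      then obtain f' where "coeffs_in V f'" "poly f' x = inverse t" "degree f' < degree f"
        using reduce_degree[OF V(1) tV t0 V(3) unit x0, of f g] f(1) g(1) unfolding Q_def by blast
      then show False using f(2)[of f'] by (simp add: Q_def)
    next
      case False
      then obtain g' where "coeffs_in V g'" "poly g' (inverse x) = inverse t" "degree g' < degree g"
        using reduce_degree[OF V(1) tV t0 V(3) unit, of "inverse x" g f] f(1) g(1) x0 unfolding Q_def by auto
      then show False using g(2)[of g'] by (simp add: Q_def)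
    qed
  qed
  then have "valuation_subring V"
    using V(1) unfolding valuation_subring_def subring_set_def by blast
  then show ?thesis using that V by blast
qed

lemma valuation_subring_imp_subring: "valuation_subring V \<Longrightarrow> subring_set V"
  by (simp add: valuation_subring_def subring_set_def)

text \<open>If b is not in V, then 1/b is, and dividing the equation by b^(n-1) expresses b through
  powers of 1/b with coefficients in V.\<close>

lemma valuation_subring_integral:
  fixes b :: "'a::field"
  assumes V: "valuation_subring V" and q: "coeffs_in V q" "q \<noteq> 0" "poly q b = 0" "inverse (lead_coeff q) \<in> V"
  shows "b \<in> V"
proof (rule ccontr)
  assume b: "b \<notin> V"
  interpret subring_locale V by standard (rule valuation_subring_imp_subring[OF V])
  have ib: "inverse b \<in> V" "b \<noteq> 0" using V b zero_mem by (auto simp: valuation_subring_def)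
  define n where "n = degree q"
  have n0: "n > 0"
  proof (rule ccontr)
    assume "\<not> n > 0"
    then obtain c where "q = [:c:]" unfolding n_def by (metis degree_eq_zeroE gr0I)
    then show False using q by simp
  qed
  have "0 = (\<Sum>i<n. coeff q i * b ^ i) + lead_coeff q * b ^ n"
    using q(3) unfolding poly_altdef n_def by (simp flip: lessThan_Suc_atMost)
  then have "lead_coeff q * b ^ n = - (\<Sum>i<n. coeff q i * b ^ i)" by (simp add: eq_neg_iff_add_eq_0 add.commute)
  then have "b ^ n = - (inverse (lead_coeff q) * (\<Sum>i<n. coeff q i * b ^ i))"
    using q(2) by (simp add: field_simps)
  then have "b ^ n * inverse b ^ (n - 1) = - (inverse (lead_coeff q) * (\<Sum>i<n. coeff q i * b ^ i * inverse b ^ (n - 1)))"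
    by (simp add: sum_distrib_right mult.assoc)
  also have "b ^ n * inverse b ^ (n - 1) = b"
    using ib(2) n0 by (cases n) (simp_all add: field_simps)
  also have "(\<Sum>i<n. coeff q i * b ^ i * inverse b ^ (n - 1)) = (\<Sum>i<n. coeff q i * inverse b ^ (n - 1 - i))"
  proof (intro sum.cong refl)
    fix i assume "i \<in> {..<n}"
    then have "inverse b ^ (n - 1) = inverse b ^ i * inverse b ^ (n - 1 - i)" by (simp flip: power_add)
    then show "coeff q i * b ^ i * inverse b ^ (n - 1) = coeff q i * inverse b ^ (n - 1 - i)"
      using ib(2) by (simp add: field_simps)
  qed
  finally have "b = - (inverse (lead_coeff q) * (\<Sum>i<n. coeff q i * inverse b ^ (n - 1 - i)))" .
  moreover have "- (inverse (lead_coeff q) * (\<Sum>i<n. coeff q i * inverse b ^ (n - 1 - i))) \<in> V"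
    using q ib by (intro uminus_mem mult_mem sum_mem power_mem) (auto simp: coeffs_in_def)
  ultimately show False using b by simp
qed

section \<open>Residue characteristics of valuation rings above a given ring\<close>

definition bad_primes :: "'a::field_char_0 set \<Rightarrow> 'a \<Rightarrow> nat set" where
  "bad_primes A h = {p. prime p \<and> \<not> (\<exists>V. valuation_subring V \<and> A \<subseteq> V \<and> inverse h \<in> V \<and> inverse (of_nat p) \<notin> V)}"

text \<open>The invariant which is preserved when a transcendental element is adjoined: inverting
  any nonzero h costs only finitely many residue characteristics.\<close>

definition specializable :: "'a::field_char_0 set \<Rightarrow> bool" where
  "specializable A \<longleftrightarrow> subring_set A \<and> (\<forall>h\<in>A. h \<noteq> 0 \<longrightarrow> finite (bad_primes A h))"

text \<open>By \<open>chevalley\<close> a prime p can be bad only if 1/p lies in Z[1/h], that is, if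
  p divides h.\<close>

lemma specializable_Ints: "specializable (\<int> :: 'a::field_char_0 set)"
proof -
  have sub: "subring_set (\<int> :: 'a set)" by (auto simp: subring_set_def)
  interpret subring_locale "\<int> :: 'a set" by standard fact
  have "finite (bad_primes \<int> h)"
    if h: "h \<in> \<int>" "h \<noteq> 0" for h :: 'a
  proof -
    obtain k where k: "h = of_int k" "k \<noteq> 0" using h by (auto elim!: Ints_cases)
    have "bad_primes \<int> h \<subseteq> {p. p dvd nat \<bar>k\<bar>}"
      unfolding bad_primes_def
    proof safe
      fix p :: nat assume p: "prime p" "\<not> (\<exists>V. valuation_subring V \<and> \<int> \<subseteq> V \<and> inverse h \<in> V \<and> inverse (of_nat p) \<notin> V)"
      interpret C: subring_locale "adjoin \<int> (inverse h)" by standard (rule subring_adjoin)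
      have "inverse (of_nat p) \<in> adjoin \<int> (inverse h)"
      proof (rule ccontr)
        assume "inverse (of_nat p) \<notin> adjoin \<int> (inverse h)"
        then obtain V where "valuation_subring V" "adjoin \<int> (inverse h) \<subseteq> V" "inverse (of_nat p) \<notin> V"
          using chevalley[OF C.subring_set C.of_nat_mem] by blast
        then show False using p(2) subset_adjoin[of "inverse h"] mem_adjoin[of "inverse h"] by blast
      qed
      then obtain n where "h ^ n * inverse (of_nat p) \<in> \<int>" using clear_denominator[OF sub h] by blast
      then obtain m where "h ^ n * inverse (of_nat p) = of_int m" by (auto elim!: Ints_cases)
      then have "h ^ n = of_int m * of_nat p" using p(1) prime_gt_0_nat by (simp add: field_simps)
      then have "(of_int (k ^ n) :: 'a) = of_int (m * int p)" by (simp add: k(1))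
      then have "k ^ n = m * int p" by (simp only: of_int_eq_iff)
      then have "int p dvd k ^ n" by simp
      then have "int p dvd k" using p(1) by (meson prime_dvd_power prime_nat_int_transfer)
      then show "p dvd nat \<bar>k\<bar>" using nat_abs_dvd_iff int_dvd_int_iff by (metis dvd_abs_iff int_nat_eq abs_ge_zero)
    qed
    moreover have "finite {p. p dvd nat \<bar>k\<bar>}" using k(2) by (intro finite_divisors_nat) auto
    ultimately show ?thesis by (rule finite_subset)
  qed
  then show ?thesis using sub by (simp add: specializable_def)
qed

text \<open>
  The bad primes of \<open>h = f(b)\<close> are among those of the leading coefficient of \<open>f\<close>: as \<open>b\<close> is
  transcendental, an equation \<open>h\<^sup>n = p r(b)\<close> can be compared in the leading coefficients.
\<close>

lemma specializable_adjoin: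
  fixes b :: "'a::field_char_0"
  assumes A: "specializable A" and b: "\<And>q. coeffs_in A q \<Longrightarrow> poly q b = 0 \<Longrightarrow> q = 0"
  shows "specializable (adjoin A b)"
proof -
  interpret subring_locale A using A by unfold_locales (simp add: specializable_def)
  have "finite (bad_primes (adjoin A b) h)"
    if h: "h \<in> adjoin A b" "h \<noteq> 0" for h
  proof -
    obtain f where f: "h = poly f b" "coeffs_in A f" using h by (auto simp: adjoin_def)
    define h0 where "h0 = lead_coeff f"
    have h0: "h0 \<in> A" "h0 \<noteq> 0" using f h by (auto simp: h0_def coeffs_in_def)
    have "bad_primes (adjoin A b) h \<subseteq> bad_primes A h0"
      unfolding bad_primes_def
    proof safe
      fix p :: nat and V1 assume p: "prime p"
        "\<not> (\<exists>V. valuation_subring V \<and> adjoin A b \<subseteq> V \<and> inverse h \<in> V \<and> inverse (of_nat p) \<notin> V)"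
        and V1: "valuation_subring V1" "A \<subseteq> V1" "inverse h0 \<in> V1" "inverse (of_nat p) \<notin> V1"
      interpret V1: subring_locale V1 by standard (rule valuation_subring_imp_subring[OF V1(1)])
      \<comment> \<open>\<open>B\<close> is V1 intersected with the quotient field of A: h0 is
        invertible in it and p is not, while b remains transcendental over it.\<close>
      define B where "B = {c\<in>V1. \<exists>d\<in>A. d \<noteq> 0 \<and> c * d \<in> A}"
      have subB: "subring_set B" unfolding subring_set_def
      proof (intro conjI ballI)
        show "1 \<in> B" using one_mem V1.one_mem by (auto simp: B_def intro!: bexI[of _ 1])
      next
        fix u v assume "u \<in> B" "v \<in> B"
        then obtain d e where de: "u \<in> V1" "d \<in> A" "d \<noteq> 0" "u * d \<in> A" "v \<in> V1" "e \<in> A" "e \<noteq> 0" "v * e \<in> A"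
          by (auto simp: B_def)
        have eqs: "(u - v) * (d * e) = u * d * e - v * e * d" "(u * v) * (d * e) = (u * d) * (v * e)"
          by (simp_all add: algebra_simps)
        have "(u - v) * (d * e) \<in> A" "(u * v) * (d * e) \<in> A"
          unfolding eqs by (intro diff_mem mult_mem de)+
        moreover have "d * e \<in> A" "d * e \<noteq> 0" using de by (simp_all add: mult_mem)
        moreover have "u - v \<in> V1" "u * v \<in> V1" using de by (simp_all add: V1.diff_mem V1.mult_mem)
        ultimately show "u - v \<in> B" "u * v \<in> B"
          unfolding B_def by blast+
      qed
      interpret B: subring_locale B by standard (rule subB)
      have AB: "A \<subseteq> B" using V1(2) one_mem by (auto simp: B_def intro!: bexI[of _ 1])
      have h0B: "inverse h0 \<in> B" using V1(3) h0 one_mem by (auto simp: B_def intro!: bexI[of _ h0])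
      have bB: "q = 0" if q: "coeffs_in B q" "poly q b = 0" for q
      proof -
        have "\<forall>i. \<exists>d\<in>A. d \<noteq> 0 \<and> coeff q i * d \<in> A" using q(1) by (auto simp: coeffs_in_def B_def)
        then obtain D where D: "\<And>i. D i \<in> A" "\<And>i. D i \<noteq> 0" "\<And>i. coeff q i * D i \<in> A" by metis
        define d where "d = (\<Prod>i\<le>degree q. D i)"
        have d0: "d \<noteq> 0" using D(2) by (simp add: d_def)
        have "coeffs_in A (smult d q)" unfolding coeffs_in_def
        proof
          fix i
          show "coeff (smult d q) i \<in> A"
          proof (cases "i \<le> degree q")
            case True
            have "d = D i * (\<Prod>j\<in>{..degree q} - {i}. D j)" using True by (simp add: d_def prod.remove)
            then have eq: "coeff (smult d q) i = coeff q i * D i * (\<Prod>j\<in>{..degree q} - {i}. D j)"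
              by (simp add: algebra_simps)
            show ?thesis unfolding eq by (intro mult_mem prod_mem D)
          next
            case False
            then show ?thesis by (simp add: coeff_eq_0 zero_mem)
          qed
        qed
        moreover have "poly (smult d q) b = 0" using q(2) by simp
        ultimately show ?thesis using b[of "smult d q"] d0 by simp
      qed
      interpret Bb: subring_locale "adjoin B b" by standard (rule B.subring_adjoin)
      interpret C: subring_locale "adjoin (adjoin B b) (inverse h)" by standard (rule Bb.subring_adjoin)
      have ABb: "adjoin A b \<subseteq> adjoin B b" unfolding adjoin_def using coeffs_in_mono[OF AB] by blast
      \<comment> \<open>If 1/p were outside B[b, 1/h], \<open>chevalley\<close> would show that p is
        not bad for h.\<close>
      have "inverse (of_nat p) \<in> adjoin (adjoin B b) (inverse h)"
      proof (rule ccontr)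
        assume "inverse (of_nat p) \<notin> adjoin (adjoin B b) (inverse h)"
        then obtain V where "valuation_subring V" "adjoin (adjoin B b) (inverse h) \<subseteq> V" "inverse (of_nat p) \<notin> V"
          using chevalley[OF C.subring_set C.of_nat_mem] by blast
        then show False using p(2) Bb.subset_adjoin[of "inverse h"] Bb.mem_adjoin[of "inverse h"] ABb by blast
      qed
      moreover have "h \<in> adjoin B b" using h(1) ABb by blast
      ultimately obtain n where "h ^ n * inverse (of_nat p) \<in> adjoin B b"
        using clear_denominator[OF Bb.subring_set _ h(2)] by blast
      then obtain r where r: "coeffs_in B r" "h ^ n * inverse (of_nat p) = poly r b" by (auto simp: adjoin_def)
      have p0: "(of_nat p :: 'a) \<noteq> 0" using p(1) prime_gt_0_nat by auto
      have "h ^ n = of_nat p * poly r b" unfolding r(2)[symmetric] using p0 by (simp add: field_simps)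
      then have "poly (f ^ n - smult (of_nat p) r) b = 0" using f(1) by simp
      moreover have "coeffs_in B (f ^ n - smult (of_nat p) r)"
        by (intro B.coeffs_in_diff B.coeffs_in_power B.coeffs_in_smult B.of_nat_mem r coeffs_in_mono[OF AB f(2)])
      ultimately have "f ^ n = smult (of_nat p) r" using bB by force
      then have "h0 ^ n = of_nat p * lead_coeff r"
        unfolding h0_def by (metis lead_coeff_power lead_coeff_smult)
      then have lr: "lead_coeff r = inverse (of_nat p) * h0 ^ n" using p0 by simp
      have "inverse (of_nat p) = lead_coeff r * inverse h0 ^ n" unfolding lr using h0(2) by (simp add: power_inverse)
      moreover have "lead_coeff r * inverse h0 ^ n \<in> B"
        using r(1) h0B by (intro B.mult_mem B.power_mem) (auto simp: coeffs_in_def)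
      ultimately show False using V1(4) by (auto simp: B_def)
    qed
    moreover have "finite (bad_primes A h0)"
      using A h0 by (simp add: specializable_def)
    ultimately show ?thesis by (rule finite_subset)
  qed
  then show ?thesis by (simp add: specializable_def subring_adjoin)
qed

text \<open>A specializable ring is chosen that contains as many elements of F as possible; then all
  of F is algebraic over it, since a transcendental element could be adjoined. A valuation ring for
  a good prime, in which the leading coefficients of the equations are units, contains F by
  integrality.\<close>

theorem exists_valuation_subring:
  fixes F :: "'a::field_char_0 set"
  assumes "finite F"
  shows "\<exists>V. valuation_subring V \<and> F \<subseteq> V \<and> (\<exists>p. prime p \<and> inverse (of_nat p) \<notin> V)"
proof -
  define Q where "Q B \<longleftrightarrow> B \<subseteq> F \<and> (\<exists>A. specializable A \<and> B \<subseteq> A)" for B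
  have "Q {}" using specializable_Ints by (auto simp: Q_def)
  moreover have "\<And>B. Q B \<Longrightarrow> card B < Suc (card F)"
    using assms by (auto simp: Q_def less_Suc_eq_le intro: card_mono)
  ultimately obtain B where B: "Q B" "\<And>B'. Q B' \<Longrightarrow> card B' \<le> card B"
    using ex_has_greatest_nat[of Q "{}" card "Suc (card F)"] by blast
  then obtain A where A: "specializable A" "B \<subseteq> A" "B \<subseteq> F" by (auto simp: Q_def)
  interpret subring_locale A using A by unfold_locales (simp add: specializable_def)
  have "\<exists>q. coeffs_in A q \<and> q \<noteq> 0 \<and> poly q b = 0" if b: "b \<in> F" for b
  proof (rule ccontr)
    assume neg: "\<not> ?thesis"
    have "b \<notin> B"
    proof
      assume "b \<in> B"
      then have "coeffs_in A [:- b, 1:]" using A(2) one_mem uminus_mem[of b] zero_mem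
        by (auto simp: coeffs_in_def coeff_pCons split: nat.split)
      then show False using neg by (auto dest!: spec[of _ "[:- b, 1:]"])
    qed
    have "specializable (adjoin A b)" using neg by (intro specializable_adjoin A) blast
    moreover have "insert b B \<subseteq> adjoin A b" using A(2) subset_adjoin[of b] mem_adjoin[of b] by blast
    ultimately have "Q (insert b B)" using b A(3) by (auto simp: Q_def)
    then have "card (insert b B) \<le> card B" by (rule B(2))
    then show False using \<open>b \<notin> B\<close> finite_subset[OF A(3) assms] by simp
  qed
  then obtain q where q: "\<And>b. b \<in> F \<Longrightarrow> coeffs_in A (q b)" "\<And>b. b \<in> F \<Longrightarrow> q b \<noteq> 0"
    "\<And>b. b \<in> F \<Longrightarrow> poly (q b) b = 0" by metis
  define h where "h = (\<Prod>b\<in>F. lead_coeff (q b))"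
  have h: "h \<in> A" "h \<noteq> 0" using q assms by (auto simp: h_def coeffs_in_def intro!: prod_mem)
  have "finite (bad_primes A h)"
    using A(1) h by (simp add: specializable_def)
  then have "\<not> {p :: nat. prime p} \<subseteq> bad_primes A h"
    using primes_infinite finite_subset by blast
  then obtain p where "prime p" "\<exists>V. valuation_subring V \<and> A \<subseteq> V \<and> inverse h \<in> V \<and> inverse (of_nat p) \<notin> V"
    unfolding bad_primes_def by blast
  then obtain V where V: "valuation_subring V" "A \<subseteq> V" "inverse h \<in> V" "inverse (of_nat p) \<notin> V" by blast
  interpret V: subring_locale V by standard (rule valuation_subring_imp_subring[OF V(1)])
  have "b \<in> V" if b: "b \<in> F" for b
  proof (rule valuation_subring_integral[OF V(1) coeffs_in_mono[OF V(2) q(1)[OF b]] q(2,3)[OF b]])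
    have "h = lead_coeff (q b) * (\<Prod>c\<in>F - {b}. lead_coeff (q c))"
      unfolding h_def using assms b by (rule prod.remove)
    then have "inverse (lead_coeff (q b)) = inverse h * (\<Prod>c\<in>F - {b}. lead_coeff (q c))"
      using h(2) by (simp add: field_simps)
    moreover have "(\<Prod>c\<in>F - {b}. lead_coeff (q c)) \<in> V"
      using q(1) V(2) by (intro V.prod_mem) (auto simp: coeffs_in_def)
    ultimately show "inverse (lead_coeff (q b)) \<in> V" using V(3) by (simp add: V.mult_mem)
  qed
  then show ?thesis using V \<open>prime p\<close> by blast
qed

section \<open>Fractions in characteristic zero\<close>

definition pairing :: "nat \<Rightarrow> (nat \<Rightarrow> nat \<Rightarrow> 'k::field) \<Rightarrow> 'k weyl \<Rightarrow> 'k" where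
  "pairing N \<theta> a = (\<Sum>i<N. \<Sum>j<N. \<theta> i j * cf a i j)"

lemma pairing_const_mult: "pairing N \<theta> (weyl_const c * a) = c * pairing N \<theta> a"
  by (simp add: pairing_def sum_distrib_left mult_ac)

lemma pairing_sum: "pairing N \<theta> (sum f A) = (\<Sum>i\<in>A. pairing N \<theta> (f i))"
proof (induction A rule: infinite_finite_induct)
  case (insert i A)
  then show ?case by (simp add: pairing_def distrib_left sum.distrib)
qed (simp_all add: pairing_def)

text \<open>
  The data of a hypothetical counterexample \<open>c = \<psi>(a) \<psi>(s)\<^sup>-\<^sup>1\<close>, with all its coefficients in \<open>F\<close>.
  The functional \<open>\<theta>\<close> witnesses that \<open>c\<close> is not in the span of the monomials
  \<open>x\<^sup>i y\<^sup>j\<close> with \<open>i, j \<le> D\<close>.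
\<close>

definition counterexample :: "'k::field set \<Rightarrow> 'k weyl \<Rightarrow> 'k weyl \<Rightarrow> 'k weyl \<Rightarrow> 'k weyl \<Rightarrow> 'k weyl \<Rightarrow>
    nat \<Rightarrow> nat \<Rightarrow> nat \<Rightarrow> nat \<Rightarrow> (nat \<Rightarrow> nat \<Rightarrow> 'k) \<Rightarrow> bool" where
  "counterexample F x y c s a i0 j0 D N \<theta> \<longleftrightarrow> y * x = x * y + 1 \<and>
    c * weyl_subst x y s = weyl_subst x y a \<and> cf s i0 j0 \<noteq> 0 \<and>
    (\<forall>i j. i > D \<or> j > D \<longrightarrow> cf a i j = 0) \<and>
    (\<forall>i j. i \<le> D \<longrightarrow> j \<le> D \<longrightarrow> pairing N \<theta> (x ^ i * y ^ j) = 0) \<and> pairing N \<theta> c = 1 \<and>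
    inverse (cf s i0 j0) \<in> F \<and> (\<forall>i<N. \<forall>j<N. \<theta> i j \<in> F) \<and>
    (\<forall>w\<in>{x, y, c, s, a}. \<forall>i j. cf w i j \<in> F)"

definition critical :: "'k::field set \<Rightarrow> bool" where
  "critical F \<longleftrightarrow> finite F \<and> (\<exists>x y c s a i0 j0 D N \<theta>. counterexample F x y c s a i0 j0 D N \<theta>)"

text \<open>
  A type cannot depend on the elements of a proof, so the valuation ring is fixed once and for all
  by a choice which only depends on the type: it contains the data of a counterexample,
  provided that there is one.
\<close>

definition critical_set :: "'k::field set" where
  "critical_set = (if \<exists>F :: 'k set. critical F then SOME F. critical F else {})"

lemma finite_critical_set: "finite critical_set"
proof -
  have "critical F \<Longrightarrow> finite F" for F :: "'a set" by (simp add: critical_def)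
  then show ?thesis using someI_ex[of "critical :: 'a set \<Rightarrow> bool"] by (auto simp: critical_set_def)
qed

section \<open>Base change to the algebraic closure\<close>

instantiation alg_closure :: (field_char_0) valued_field
begin

definition vring_alg_closure :: "'a alg_closure set" where
  "vring_alg_closure = (SOME V. valuation_subring V \<and> to_ac ` critical_set \<subseteq> V \<and>
    (\<exists>p. prime p \<and> inverse (of_nat p) \<notin> V))"

lemma vring_alg_closure:
  "valuation_subring (vring :: 'a alg_closure set) \<and> to_ac ` critical_set \<subseteq> (vring :: 'a alg_closure set) \<and>
    (\<exists>p. prime p \<and> inverse (of_nat p) \<notin> (vring :: 'a alg_closure set))"
  unfolding vring_alg_closure_def
  by (rule someI_ex, rule exists_valuation_subring) (simp add: finite_critical_set)

instance
  using vring_alg_closure by intro_classes blast+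

end

instance alg_closure :: (field_char_0) closed_valued_field ..

definition base_change :: "'k::field weyl \<Rightarrow> 'k alg_closure weyl" where
  "base_change = weyl_hom (\<lambda>c. weyl_const (to_ac c)) weyl_X weyl_Y"

interpretation base_change: weyl_representation "\<lambda>c :: 'k::field. weyl_const (to_ac c)" weyl_X weyl_Y
proof
  show "weyl_const (to_ac c) * weyl_X = weyl_X * weyl_const (to_ac c)"
    "weyl_const (to_ac c) * weyl_Y = weyl_Y * weyl_const (to_ac c)" for c :: 'k
    by (rule weyl_const_commute)+
qed (simp_all add: weyl_const_add weyl_const_mult weyl_Y_X)

lemmas base_change_hom = base_change.hom_add[folded base_change_def] base_change.hom_mult[folded base_change_def]
  base_change.hom_const[folded base_change_def] base_change.hom_X[folded base_change_def]
  base_change.hom_Y[folded base_change_def] base_change.hom_1[folded base_change_def]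
  base_change.hom_power[folded base_change_def]

lemma cf_base_change: "cf (base_change a) i j = to_ac (cf a i j)"
proof (induction a arbitrary: i j rule: weyl_induct)
  case (const c)
  then show ?case by (simp add: base_change_hom cf_const)
next
  case (add a b)
  then show ?case by (simp add: base_change_hom)
next
  case (X a)
  then show ?case by (simp add: base_change_hom cf_X)
next
  case (Y a)
  then show ?case by (simp add: base_change_hom cf_Y del: of_nat_Suc)
qed

lemma pairing_base_change:
  "pairing N (\<lambda>i j. to_ac (\<theta> i j)) (base_change a) = to_ac (pairing N \<theta> a)"
  by (simp add: pairing_def cf_base_change to_ac_sum)

lemma base_change_weyl_hom:
  assumes "y * x = x * y + 1"
  shows "base_change (weyl_subst x y a) =
    weyl_subst (base_change x) (base_change y) (base_change a)"
proof -
  interpret \<psi>: weyl_representation weyl_const x y by (rule weyl_hom_representation[OF assms])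
  have "base_change y * base_change x = base_change x * base_change y + 1"
    by (simp only: base_change_hom[symmetric] assms)
  then interpret \<psi>': weyl_representation weyl_const "base_change x" "base_change y"
    by (rule weyl_hom_representation)
  show ?thesis
    by (induction a rule: weyl_induct)
      (simp_all add: \<psi>.hom_add \<psi>'.hom_add \<psi>.hom_mult \<psi>'.hom_mult base_change_hom)
qed

lemma (in integral_pair) red_weyl_hom:
  assumes "a \<in> intg"
  shows "weyl_subst x y a \<in> intg \<and> red (weyl_subst x y a) = R.\<psi> (red a)"
proof -
  interpret \<psi>: weyl_representation weyl_const x y by (rule weyl_hom_representation) (rule yx)
  show ?thesis using assms
    by (induction rule: intg_induct)
      (auto simp: \<psi>.hom_add \<psi>.hom_mult intg_const intg_add intg_mult x y red_const red_add red_mult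
        red_X_mult red_Y_mult R.\<psi>.hom_add R.\<psi>.hom_mult)
qed

text \<open>The coefficient with integral inverse keeps the reduction of s nonzero. Then
  \<open>fraction_in_range\<close> yields b with degrees at most D, so the reduced functional kills
  the reduction of c, although its value there is 1.\<close>

lemma (in integral_pair) no_integral_counterexample:
  assumes int: "c \<in> intg" "s \<in> intg" "a \<in> intg"
    and eq: "c * weyl_subst x y s = weyl_subst x y a"
    and s: "cf s k l \<noteq> 0" "inverse (cf s k l) \<in> vring"
    and a: "\<And>i j. i > D \<or> j > D \<Longrightarrow> cf a i j = 0"
    and \<theta>: "\<And>i j. i < N \<Longrightarrow> j < N \<Longrightarrow> \<theta> i j \<in> vring"
    and kill: "\<And>i j. i \<le> D \<Longrightarrow> j \<le> D \<Longrightarrow> pairing N \<theta> (x ^ i * y ^ j) = 0"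
    and one: "pairing N \<theta> c = 1"
  shows False
proof -
  have pair: "pairing N (\<lambda>i j. res (\<theta> i j)) (red w) = res (pairing N \<theta> w)" if "w \<in> intg" for w
  proof -
    have w: "cf w i j \<in> vring" for i j using that by (simp add: intg_def)
    have "res (pairing N \<theta> w) = (\<Sum>i<N. res (\<Sum>j<N. \<theta> i j * cf w i j))"
      unfolding pairing_def by (intro res_sum vring_sum vring_mult \<theta> w) auto
    also have "\<dots> = (\<Sum>i<N. \<Sum>j<N. res (\<theta> i j * cf w i j))"
      by (intro sum.cong refl res_sum vring_mult \<theta> w) auto
    also have "\<dots> = pairing N (\<lambda>i j. res (\<theta> i j)) (red w)"
      unfolding pairing_def cf_red by (intro sum.cong refl res_mult \<theta> w) auto
    finally show ?thesis ..
  qed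
  have "red c * R.\<psi> (red s) = R.\<psi> (red a)"
    using arg_cong[OF eq, of red] red_weyl_hom int by (simp add: red_mult)
  moreover have "red s \<noteq> 0"
  proof
    assume "red s = 0"
    then have "res (cf s k l) = 0" by (simp flip: cf_red)
    then have "res (cf s k l * inverse (cf s k l)) = 0"
      using s int(2) by (subst res_mult) (auto simp: intg_def)
    then show False using s(1) by simp
  qed
  ultimately obtain b where b: "red c = R.\<psi> b" "b * red s = red a"
    using R.fraction_in_range by blast
  have "cf b i j = 0" if "i > D \<or> j > D" for i j
    using cf_factor_bound[OF \<open>red s \<noteq> 0\<close>, of D b] that a by (simp add: b(2) cf_red)
  then have "b = (\<Sum>i<Suc D. \<Sum>j<Suc D. weyl_const (cf b i j) * weyl_X ^ i * weyl_Y ^ j)"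
    by (intro weyl_expand) auto
  then have "red c = R.\<psi> (\<Sum>i<Suc D. \<Sum>j<Suc D. weyl_const (cf b i j) * weyl_X ^ i * weyl_Y ^ j)"
    using b(1) by simp
  then have c: "red c = (\<Sum>i<Suc D. \<Sum>j<Suc D. weyl_const (cf b i j) * (red x ^ i * red y ^ j))"
    by (simp only: R.\<psi>.hom_sum R.\<psi>.hom_mult R.\<psi>.hom_const R.\<psi>.hom_power R.\<psi>.hom_X R.\<psi>.hom_Y mult.assoc)
  have 0: "pairing N (\<lambda>i j. res (\<theta> i j)) (red x ^ i * red y ^ j) = 0" if "i < Suc D" "j < Suc D" for i j
    using pair[of "x ^ i * y ^ j"] kill[of i j] that x y by (simp add: intg_mult intg_power red_mult red_power)
  have "pairing N (\<lambda>i j. res (\<theta> i j)) (red c) = 0"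
    unfolding c pairing_sum pairing_const_mult using 0 by (intro sum.neutral ballI) simp
  then show False using pair[OF int(1)] one by simp
qed

lemma not_critical: "\<not> critical (F :: 'k::field_char_0 set)"
proof
  assume "critical F"
  then have "critical (critical_set :: 'k set)"
    unfolding critical_set_def using someI_ex[of critical] by auto
  then obtain x y c s a :: "'k weyl" and i0 j0 D N \<theta> where
    ce: "counterexample critical_set x y c s a i0 j0 D N \<theta>"
    unfolding critical_def by blast
  have rel: "y * x = x * y + 1"
    and eq: "c * weyl_subst x y s = weyl_subst x y a" and s: "cf s i0 j0 \<noteq> 0"
    and one: "pairing N \<theta> c = 1" and inv: "inverse (cf s i0 j0) \<in> critical_set"
    using ce by (simp_all add: counterexample_def)
  have a: "\<And>i j. i > D \<or> j > D \<Longrightarrow> cf a i j = 0"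
    and kill: "\<And>i j. i \<le> D \<Longrightarrow> j \<le> D \<Longrightarrow> pairing N \<theta> (x ^ i * y ^ j) = 0"
    and \<theta>: "\<And>i j. i < N \<Longrightarrow> j < N \<Longrightarrow> \<theta> i j \<in> critical_set"
    and coeffs: "\<And>w i j. w \<in> {x, y, c, s, a} \<Longrightarrow> cf w i j \<in> critical_set"
    using ce unfolding counterexample_def by blast+
  have V: "to_ac k \<in> vring" if "k \<in> critical_set" for k :: 'k
    using vring_alg_closure that by blast
  have int: "base_change x \<in> intg" "base_change y \<in> intg" "base_change c \<in> intg" "base_change s \<in> intg" "base_change a \<in> intg"
    by (auto simp: intg_def cf_base_change intro!: V coeffs)
  have mult: "base_change (v * w) = base_change v * base_change w" for v w :: "'k weyl"
    by (rule base_change_hom)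
  have "base_change y * base_change x = base_change x * base_change y + 1"
    by (simp only: base_change_hom[symmetric] rel)
  then interpret integral_pair "base_change x" "base_change y" "CHAR('k alg_closure resid)"
    by unfold_locales (auto simp: int)
  show False
  proof (rule no_integral_counterexample[where k = i0 and l = j0 and D = D and N = N and \<theta> = "\<lambda>i j. to_ac (\<theta> i j)"])
    show "base_change c \<in> intg" "base_change s \<in> intg" "base_change a \<in> intg" by (fact int)+
    show "base_change c * weyl_subst (base_change x) (base_change y) (base_change s) =
        weyl_subst (base_change x) (base_change y) (base_change a)"
      by (simp only: base_change_weyl_hom[OF rel, symmetric] mult[symmetric] eq)
    show "cf (base_change s) i0 j0 \<noteq> 0" "inverse (cf (base_change s) i0 j0) \<in> vring"
      using s V[OF inv] by (simp_all add: cf_base_change)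
    show "i > D \<or> j > D \<Longrightarrow> cf (base_change a) i j = 0" for i j
      using a by (simp add: cf_base_change)
    show "i < N \<Longrightarrow> j < N \<Longrightarrow> to_ac (\<theta> i j) \<in> vring" for i j
      by (intro V \<theta>)
    have "base_change x ^ i * base_change y ^ j = base_change (x ^ i * y ^ j)" for i j
      by (simp add: base_change_hom)
    then show "i \<le> D \<Longrightarrow> j \<le> D \<Longrightarrow>
        pairing N (\<lambda>i j. to_ac (\<theta> i j)) (base_change x ^ i * base_change y ^ j) = 0" for i j
      using kill by (simp add: pairing_base_change)
    show "pairing N (\<lambda>i j. to_ac (\<theta> i j)) (base_change c) = 1"
      using one by (simp add: pairing_base_change)
  qed
qed

section \<open>Separating functionals and the final contradiction\<close>

abbreviation weyl_scale :: "'k::field \<Rightarrow> 'k weyl \<Rightarrow> 'k weyl" where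
  "weyl_scale c a \<equiv> weyl_const c * a"

interpretation weyl: vector_space "weyl_scale :: 'k::field \<Rightarrow> _"
  by standard (simp_all add: algebra_simps weyl_const_add weyl_const_mult)

interpretation weyl_functional: vector_space_pair "weyl_scale :: 'k::field \<Rightarrow> _" "(*) :: 'k \<Rightarrow> 'k \<Rightarrow> 'k"
  by unfold_locales (simp_all add: algebra_simps)

text \<open>A functional obtained by extending from a basis has infinitely many values on monomials.
  Only finitely many elements matter, so it is cut off at a bound N for their degrees, which keeps
  the data to be made integral finite.\<close>

lemma separating_functional:
  fixes S :: "'k::field weyl set"
  assumes "finite S" "c \<notin> weyl.span S"
  obtains N \<theta> where "\<And>a. a \<in> S \<Longrightarrow> pairing N \<theta> a = 0" "pairing N \<theta> c = 1"
proof -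
  obtain B where B: "B \<subseteq> S" "weyl.independent B" "S \<subseteq> weyl.span B"
    using weyl.maximal_independent_subset[of S] by blast
  have "c \<notin> weyl.span B" using assms(2) weyl.span_mono[OF B(1)] by blast
  then have "weyl.independent (insert c B)" using B(2) by (simp add: weyl.independent_insertI)
  then obtain g where g: "Vector_Spaces.linear weyl_scale (*) g"
    "\<And>b. b \<in> insert c B \<Longrightarrow> g b = (if b = c then 1 else 0)"
    using weyl_functional.linear_independent_extend[of "insert c B" "\<lambda>b. if b = c then 1 else 0"] by blast
  interpret g: Vector_Spaces.linear weyl_scale "(*)" g by (rule g(1))
  have "g b = 0" if "b \<in> B" for b
    using g(2)[of b] that \<open>c \<notin> weyl.span B\<close> weyl.span_base[of c B] by auto
  then have gS: "g a = 0" if "a \<in> S" for a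
    using weyl_functional.linear_eq_0_on_span[OF g(1)] that B(3) by blast
  have "\<forall>a. \<exists>n. \<forall>i j. i \<ge> n \<or> j \<ge> n \<longrightarrow> cf a i j = 0" for a :: "'k weyl"
    using cf_bound by metis
  then obtain n where n: "\<And>a :: 'k weyl. \<And>i j. i \<ge> n a \<or> j \<ge> n a \<Longrightarrow> cf a i j = 0" by metis
  define N where "N = Max (n ` insert c S)"
  have "pairing N (\<lambda>i j. g (weyl_X ^ i * weyl_Y ^ j)) a = g a" if "a \<in> insert c S" for a
  proof -
    have "n a \<le> N" unfolding N_def using that assms(1) by (intro Max_ge) auto
    then have "a = (\<Sum>i<N. \<Sum>j<N. weyl_const (cf a i j) * weyl_X ^ i * weyl_Y ^ j)"
      using n[of a] by (intro weyl_expand) auto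
    then have "g a = g (\<Sum>i<N. \<Sum>j<N. weyl_scale (cf a i j) (weyl_X ^ i * weyl_Y ^ j))"
      by (simp add: mult.assoc)
    also have "\<dots> = pairing N (\<lambda>i j. g (weyl_X ^ i * weyl_Y ^ j)) a"
      by (simp add: g.sum g.scale pairing_def mult.commute)
    finally show ?thesis ..
  qed
  then show ?thesis using gS g(2)[of c] by (intro that[of N "\<lambda>i j. g (weyl_X ^ i * weyl_Y ^ j)"]) auto
qed

lemma finite_cf: "finite {cf a i j | i j. True}"
proof -
  obtain N where N: "\<And>i j. i \<ge> N \<or> j \<ge> N \<Longrightarrow> cf a i j = 0" using cf_bound[of a] by blast
  have "{cf a i j | i j. True} \<subseteq> insert 0 ((\<lambda>(i, j). cf a i j) ` ({..<N} \<times> {..<N}))"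
  proof safe
    fix i j
    assume "cf a i j \<notin> (\<lambda>(i, j). cf a i j) ` ({..<N} \<times> {..<N})"
    then have "\<not> (i < N \<and> j < N)" by (auto simp: image_iff)
    then show "cf a i j = 0" using N by (simp add: not_less)
  qed
  then show ?thesis by (rule finite_subset) simp
qed

theorem weyl_fraction_in_range:
  fixes x y c :: "'k::field_char_0 weyl"
  assumes yx: "y * x = x * y + 1" and s: "s \<noteq> 0"
    and eq: "c * weyl_subst x y s = weyl_subst x y a"
  shows "c \<in> range (weyl_subst x y)"
proof (rule ccontr)
  interpret \<psi>: weyl_representation weyl_const x y by (rule weyl_hom_representation[OF yx])
  assume c: "c \<notin> range (weyl_subst x y)"
  obtain D where D: "\<And>i j. i \<ge> D \<or> j \<ge> D \<Longrightarrow> cf a i j = 0" using cf_bound[of a] by blast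
  define S where "S = (\<lambda>(i, j). x ^ i * y ^ j) ` ({..D} \<times> {..D})"
  have "weyl.subspace (range (weyl_subst x y))"
    unfolding weyl.subspace_def
  proof (intro conjI ballI allI)
    show "0 \<in> range (weyl_subst x y)" using \<psi>.hom_0 by (metis rangeI)
    show "u + v \<in> range (weyl_subst x y)"
      if uv: "u \<in> range (weyl_subst x y)" "v \<in> range (weyl_subst x y)" for u v
    proof -
      obtain u' v' where "u = weyl_subst x y u'" "v = weyl_subst x y v'" using uv by blast
      then have "u + v = weyl_subst x y (u' + v')" by (simp only: \<psi>.hom_add)
      then show ?thesis by blast
    qed
    show "weyl_scale k u \<in> range (weyl_subst x y)" if u: "u \<in> range (weyl_subst x y)" for k u
    proof -
      obtain u' where "u = weyl_subst x y u'" using u by blast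
      then have "weyl_scale k u = weyl_subst x y (weyl_scale k u')" by (simp only: \<psi>.hom_mult \<psi>.hom_const)
      then show ?thesis by blast
    qed
  qed
  moreover have "S \<subseteq> range (weyl_subst x y)"
  proof
    fix w assume "w \<in> S"
    then obtain i j where "w = x ^ i * y ^ j" by (auto simp: S_def)
    then have "w = weyl_subst x y (weyl_X ^ i * weyl_Y ^ j)" by (simp add: \<psi>.hom_mult \<psi>.hom_power)
    then show "w \<in> range (weyl_subst x y)" by blast
  qed
  ultimately have "c \<notin> weyl.span S" using weyl.span_minimal c by blast
  moreover have "finite S" by (simp add: S_def)
  ultimately obtain N \<theta> where \<theta>: "\<And>w. w \<in> S \<Longrightarrow> pairing N \<theta> w = 0" "pairing N \<theta> c = 1"
    using separating_functional by blast
  obtain i0 j0 where ij: "cf s i0 j0 \<noteq> 0" using s weyl_eqI[of s 0] by auto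
  define F where "F = insert (inverse (cf s i0 j0)) ((\<lambda>(i, j). \<theta> i j) ` ({..<N} \<times> {..<N}) \<union>
    (\<Union>w\<in>{x, y, c, s, a}. {cf w i j | i j. True}))"
  have "finite F" unfolding F_def using finite_cf by auto
  moreover have "\<theta> i j \<in> F" if "i < N" "j < N" for i j using that by (auto simp: F_def)
  moreover have "cf w i j \<in> F" if "w \<in> {x, y, c, s, a}" for w i j using that unfolding F_def by blast
  moreover have "pairing N \<theta> (x ^ i * y ^ j) = 0" if "i \<le> D" "j \<le> D" for i j
    using that by (intro \<theta>) (auto simp: S_def)
  moreover have "inverse (cf s i0 j0) \<in> F" by (simp add: F_def)
  ultimately have "counterexample F x y c s a i0 j0 D N \<theta>"
    unfolding counterexample_def using yx eq ij D \<theta>(2) less_imp_le by blast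
  then have "critical F" using \<open>finite F\<close> unfolding critical_def by blast
  then show False using not_critical by blast
qed

lemma subalgebra_hull_eq_range:
  fixes x y :: "'k::field weyl"
  assumes "y * x = x * y + 1"
  shows "weyl_subalgebra hull {x, y} = range (weyl_subst x y)"
proof -
  interpret \<psi>: weyl_representation weyl_const x y by (rule weyl_hom_representation[OF assms])
  show ?thesis
  proof (rule hull_unique)
    show "{x, y} \<subseteq> range (weyl_subst x y)"
      using \<psi>.hom_X \<psi>.hom_Y by (metis empty_subsetI insert_subset rangeI)
    show "weyl_subalgebra (range (weyl_subst x y))"
      unfolding weyl_subalgebra_def
    proof (intro conjI ballI)
      show "range weyl_const \<subseteq> range (weyl_subst x y)"
        using \<psi>.hom_const by (metis image_subsetI rangeI)
    next
      fix u v assume "u \<in> range (weyl_subst x y)" "v \<in> range (weyl_subst x y)"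
      then obtain u' v' where "u = weyl_subst x y u'" "v = weyl_subst x y v'" by blast
      then have "u + v = weyl_subst x y (u' + v')" "u * v = weyl_subst x y (u' * v')"
        by (simp_all only: \<psi>.hom_add \<psi>.hom_mult)
      then show "u + v \<in> range (weyl_subst x y)" "u * v \<in> range (weyl_subst x y)"
        by blast+
    qed
  next
    fix T assume T: "{x, y} \<subseteq> T" "weyl_subalgebra T"
    have "weyl_subst x y a \<in> T" for a
      using T by (induction a rule: weyl_induct) (auto simp: \<psi>.hom_add \<psi>.hom_mult weyl_subalgebra_def)
    then show "range (weyl_subst x y) \<subseteq> T" by blast
  qed
qed

theorem theorem1p3:
  fixes x y :: "'k::field_char_0 weyl"
    and \<phi> :: "'k weyl \<Rightarrow> 'd::division_ring"
  assumes "skew_field_of_fractions \<phi>"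
    and "commutator y x = 1"
  shows "fractions \<phi> (weyl_subalgebra hull {x, y}) \<inter> range \<phi>
    = \<phi> ` (weyl_subalgebra hull {x, y})"
proof -
  have yx: "y * x = x * y + 1" using assms(2) by (simp add: commutator_def algebra_simps)
  interpret \<psi>: weyl_representation weyl_const x y by (rule weyl_hom_representation[OF yx])
  have inj: "inj \<phi>" and one: "\<phi> 1 = 1" and add: "\<And>a b. \<phi> (a + b) = \<phi> a + \<phi> b"
    and mult: "\<And>a b. \<phi> (a * b) = \<phi> a * \<phi> b"
    using assms(1) by (auto simp: skew_field_of_fractions_def ring_embedding_def)
  have zero: "\<phi> 0 = 0" using add[of 0 0] by simp
  show ?thesis
    unfolding subalgebra_hull_eq_range[OF yx]
  proof (intro equalityI subsetI)
    fix d assume "d \<in> fractions \<phi> (range (weyl_subst x y)) \<inter> range \<phi>"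
    then obtain a s c where d: "d = \<phi> c" "\<phi> c = \<phi> (weyl_subst x y a) * inverse (\<phi> (weyl_subst x y s))"
      and s: "weyl_subst x y s \<noteq> 0"
      by (auto simp: fractions_def)
    have "\<phi> (weyl_subst x y s) \<noteq> 0" using s inj zero by (metis injD)
    then have "\<phi> (c * weyl_subst x y s) = \<phi> (weyl_subst x y a)"
      by (simp add: mult d(2) mult.assoc)
    then have "c * weyl_subst x y s = weyl_subst x y a" using inj by (metis injD)
    moreover have "s \<noteq> 0" using s by auto
    ultimately have "c \<in> range (weyl_subst x y)" using weyl_fraction_in_range[OF yx] by blast
    then show "d \<in> \<phi> ` range (weyl_subst x y)" using d(1) by blast
  next
    fix d assume "d \<in> \<phi> ` range (weyl_subst x y)"
    then obtain a where a: "d = \<phi> (weyl_subst x y a)" by blast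
    \<comment> \<open>Elements of the subalgebra are fractions with denominator 1.\<close>
    have "d = \<phi> (weyl_subst x y a) * inverse (\<phi> (weyl_subst x y 1))" by (simp add: a one)
    moreover have "weyl_subst x y 1 \<noteq> 0" by simp
    ultimately show "d \<in> fractions \<phi> (range (weyl_subst x y)) \<inter> range \<phi>"
      using a unfolding fractions_def by blast
  qed
qed

end
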